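(* Let $k$ be an algebraically closed field of characteristic $0$. For the generic curve $Y^2=F(X)G(X)$ with $F(X)=X^3+aX^2+bX+1$, $G(X)=4X^3+b^2X^2+2bX+1$, where $a,b$ are independent transcendentals over $k$, the absolute invariants $i_1,i_2,i_3$ of the sextic $FG$ and the invariants $r_1=r_1(F,G)$, $r_2=r_2(F,G)$ of the pair of cubics all lie in $k(u,v)$, where $u=ab$ and $v=b^3$, and $$k(i_1,i_2,i_3)=k(r_1,r_2)$$ as subfields of $k(u,v)$.
   Context: For cubics $F=a_3X^3+a_2X^2+a_1X+a_0$ and $G=b_3X^3+b_2X^2+b_1X+b_0$, put $H(F,G)=a_3b_0-\tfrac13a_2b_1+\tfrac13a_1b_2-a_0b_3$, let $R(F,G)$ be the resultant and $D(\cdot)$ the discriminant, and define $$r_1(F,G)=\frac{H(F,G)^3}{R(F,G)},\qquad r_2(F,G)=\frac{H(F,G)^4}{D(F)D(G)} .$$ The absolute invariants of a binary sextic with $J_2\ne0$ are $$i_1=144\frac{J_4}{J_2^2},\qquad i_2=-1728\frac{J_2J_4-3J_6}{J_2^3},\qquad i_3=486\frac{J_{10}}{J_2^5},$$ where $J_2,J_4,J_6,J_{10}$ are the Igusa–Clebsch invariants: for $f(X)=c\prod_{i=1}^6(X-\alpha_i)$, with $(ij)=\alpha_i-\alpha_j$, $$J_2=c^2\sum_{15}(12)^2(34)^2(56)^2,\qquad J_4=c^4\sum_{10}(12)^2(23)^2(31)^2(45)^2(56)^2(64)^2,$$ $$J_6=c^6\sum_{60}(12)^2(23)^2(31)^2(45)^2(56)^2(64)^2(14)^2(25)^2(36)^2,\qquad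 J_{10}=c^{10}\prod_{i<j}(ij)^2,$$ each sum running over the distinct expressions (in the indicated number) obtained by permuting the indices. *)

theory Defs
  imports
    "Subresultants.Resultant_Prelim"
    "HOL-Combinatorics.Permutations"
    "HOL-Computational_Algebra.Computational_Algebra"
begin

section \<open>Subfields of an ambient field\<close>

definition is_subfield :: "'a::field set \<Rightarrow> bool" where
  "is_subfield K \<longleftrightarrow> 0 \<in> K \<and> 1 \<in> K \<and>
     (\<forall>x\<in>K. \<forall>y\<in>K. x + y \<in> K \<and> x * y \<in> K) \<and>
     (\<forall>x\<in>K. - x \<in> K \<and> inverse x \<in> K)"

definition alg_closed_subfield :: "'a::field set \<Rightarrow> bool" where
  "alg_closed_subfield K \<longleftrightarrow> is_subfield K \<and>
     (\<forall>p. set (coeffs p) \<subseteq> K \<and> degree p > 0 \<longrightarrow> (\<exists>x\<in>K. poly p x = 0))"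

text \<open>\<open>adjoin K S\<close> is the subfield written $K(S)$.\<close>

definition adjoin :: "'a::field set \<Rightarrow> 'a set \<Rightarrow> 'a set" where
  "adjoin K S = is_subfield hull (K \<union> S)"

text \<open>A bivariate polynomial is a polynomial (in the second variable) whose coefficients are
  polynomials (in the first variable).\<close>

definition independent_transcendentals :: "'a::field set \<Rightarrow> 'a \<Rightarrow> 'a \<Rightarrow> bool" where
  "independent_transcendentals K a b \<longleftrightarrow>
     (\<forall>p :: 'a poly poly. (\<forall>q\<in>set (coeffs p). set (coeffs q) \<subseteq> K) \<and>
        poly (map_poly (\<lambda>q. poly q a) p) b = 0 \<longrightarrow> p = 0)"


section \<open>Invariants of a pair of cubics\<close>

definition poly_discriminant :: "'a::field poly \<Rightarrow> 'a" where
  "poly_discriminant p =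
     (-1) ^ (degree p * (degree p - 1) div 2) * resultant p (pderiv p) / lead_coeff p"

definition cubic_H :: "'a::field poly \<Rightarrow> 'a poly \<Rightarrow> 'a" where
  "cubic_H F G = coeff F 3 * coeff G 0 - 1/3 * coeff F 2 * coeff G 1
                 + 1/3 * coeff F 1 * coeff G 2 - coeff F 0 * coeff G 3"

definition cubic_r1 :: "'a::field poly \<Rightarrow> 'a poly \<Rightarrow> 'a" where
  "cubic_r1 F G = cubic_H F G ^ 3 / resultant F G"

definition cubic_r2 :: "'a::field poly \<Rightarrow> 'a poly \<Rightarrow> 'a" where
  "cubic_r2 F G = cubic_H F G ^ 4 / (poly_discriminant F * poly_discriminant G)"


section \<open>Igusa--Clebsch invariants and absolute invariants of a binary sextic\<close>

text \<open>An expression $(ij)^2(kl)^2\cdots$ is encoded by its set of edges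
  \<open>{{i,j},{k,l},\<dots>}\<close>. Two such expressions in indeterminates \<open>\<alpha> 1, \<dots>, \<alpha> 6\<close> are distinct
  iff their edge sets are, so the sum over the distinct expressions obtained from one of
  them by permuting the indices is the sum over the orbit of its edge set. As the sum is over edge
  sets, expressions that are formally distinct but happen to have the same value are all counted.\<close>

definition edge_sets_orbit :: "nat set set \<Rightarrow> nat set set set" where
  "edge_sets_orbit E = {(`) \<sigma> ` E | \<sigma>. \<sigma> permutes {1..6}}"

definition edge_expr :: "(nat \<Rightarrow> 'a::comm_ring_1) \<Rightarrow> nat set set \<Rightarrow> 'a" where
  "edge_expr \<alpha> E = (\<Prod>e\<in>E. (\<alpha> (Min e) - \<alpha> (Max e))\<^sup>2)"

definition orbit_sum :: "(nat \<Rightarrow> 'a::comm_ring_1) \<Rightarrow> nat set set \<Rightarrow> 'a" where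
  "orbit_sum \<alpha> E = (\<Sum>E'\<in>edge_sets_orbit E. edge_expr \<alpha> E')"

text \<open>The roots of a sextic in some order; the order is irrelevant to the invariants,
  see \<open>igusa_clebsch_eq\<close> below.\<close>

definition sextic_roots :: "'a::field poly \<Rightarrow> nat \<Rightarrow> 'a" where
  "sextic_roots f = (SOME \<alpha>. f = smult (lead_coeff f) (\<Prod>i\<in>{1..6}. [:- \<alpha> i, 1:]))"

text \<open>The orbits in the next three definitions have 15, 10 and 60 elements.\<close>

definition igusa_J2 :: "'a::field poly \<Rightarrow> 'a" where
  "igusa_J2 f = lead_coeff f ^ 2 * orbit_sum (sextic_roots f) {{1,2}, {3,4}, {5,6}}"

definition igusa_J4 :: "'a::field poly \<Rightarrow> 'a" where
  "igusa_J4 f = lead_coeff f ^ 4 * orbit_sum (sextic_roots f)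
     {{1,2}, {2,3}, {3,1}, {4,5}, {5,6}, {6,4}}"

definition igusa_J6 :: "'a::field poly \<Rightarrow> 'a" where
  "igusa_J6 f = lead_coeff f ^ 6 * orbit_sum (sextic_roots f)
     {{1,2}, {2,3}, {3,1}, {4,5}, {5,6}, {6,4}, {1,4}, {2,5}, {3,6}}"

definition igusa_J10 :: "'a::field poly \<Rightarrow> 'a" where
  "igusa_J10 f = lead_coeff f ^ 10 *
     (\<Prod>j\<in>{1..6}. \<Prod>i\<in>{1..<j}. (sextic_roots f i - sextic_roots f j)\<^sup>2)"

definition abs_i1 :: "'a::field poly \<Rightarrow> 'a" where
  "abs_i1 f = 144 * igusa_J4 f / igusa_J2 f ^ 2"

definition abs_i2 :: "'a::field poly \<Rightarrow> 'a" where
  "abs_i2 f = - 1728 * (igusa_J2 f * igusa_J4 f - 3 * igusa_J6 f) / igusa_J2 f ^ 3"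

definition abs_i3 :: "'a::field poly \<Rightarrow> 'a" where
  "abs_i3 f = 486 * igusa_J10 f / igusa_J2 f ^ 5"


subsection \<open>Independence of the order of the roots\<close>

lemma sextic_splits:
  fixes f :: "'a::alg_closed_field poly"
  assumes "degree f = 6"
  shows "\<exists>\<alpha>::nat \<Rightarrow> 'a. f = smult (lead_coeff f) (\<Prod>i\<in>{1..6}. [:- \<alpha> i, 1:])"
proof -
  have "f \<noteq> 0" using assms by auto
  then obtain A where A: "size A = degree f" "f = smult (lead_coeff f) (\<Prod>x\<in>#A. [:-x, 1:])"
    using alg_closed_imp_factorization by blast
  obtain xs where xs: "mset xs = A" using ex_mset by blast
  then have len: "length xs = 6" using A(1) assms by auto
  have "(\<Prod>x\<in>#A. [:-x, 1:]) = (\<Prod>x\<leftarrow>xs. [:-x, 1:])"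
    by (simp add: xs[symmetric] prod_mset_prod_list flip: mset_map)
  also have "\<dots> = (\<Prod>i = 0..<6. [:- (xs ! i), 1:])"
    by (simp add: prod.list_conv_set_nth len)
  also have "\<dots> = (\<Prod>i\<in>{1..6}. [:- (xs ! (i - 1)), 1:])"
    by (rule prod.reindex_bij_witness[of _ "\<lambda>i. i - 1" Suc]) auto
  finally show ?thesis using A(2) by (intro exI[of _ "\<lambda>i. xs ! (i - 1)"]) simp
qed

lemma edge_sets_orbit_image:
  "edge_sets_orbit E = (\<lambda>\<sigma>. (`) \<sigma> ` E) ` {\<sigma>. \<sigma> permutes {1..6}}"
  by (auto simp: edge_sets_orbit_def)

lemma edge_sqdiff_cong:
  fixes \<alpha> \<beta> :: "nat \<Rightarrow> 'a::comm_ring_1"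
  assumes "\<And>x. x \<in> {1..6} \<Longrightarrow> \<alpha> x = \<beta> (p x)" "i \<in> {1..6}" "j \<in> {1..6}"
  shows "(\<alpha> (Min {i, j}) - \<alpha> (Max {i, j}))\<^sup>2 = (\<beta> (Min (p ` {i, j})) - \<beta> (Max (p ` {i, j})))\<^sup>2"
  using assms by (auto simp: min_def max_def power2_commute)

lemma orbit_sum_permute:
  fixes \<alpha> \<beta> :: "nat \<Rightarrow> 'a::comm_ring_1"
  assumes p: "p permutes {1..6}" and ab: "\<And>x. x \<in> {1..6} \<Longrightarrow> \<alpha> x = \<beta> (p x)"
    and E: "\<And>e. e \<in> E \<Longrightarrow> \<exists>i\<in>{1..6}. \<exists>j\<in>{1..6}. e = {i, j}"
  shows "orbit_sum \<alpha> E = orbit_sum \<beta> E"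
proof -
  have inj: "inj ((`) q)" if "inj q" for q :: "nat \<Rightarrow> nat"
    using that by (simp add: inj_image_eq_iff inj_def)
  note ip = permutes_inj[OF p]
  have *: "edge_expr \<alpha> E' = edge_expr \<beta> ((`) p ` E')" if "E' \<in> edge_sets_orbit E" for E'
  proof -
    from that obtain \<sigma> where \<sigma>: "\<sigma> permutes {1..6}" "E' = (`) \<sigma> ` E"
      by (auto simp: edge_sets_orbit_def)
    have "(\<alpha> (Min e) - \<alpha> (Max e))\<^sup>2 = (\<beta> (Min (p ` e)) - \<beta> (Max (p ` e)))\<^sup>2" if "e \<in> E'" for e
    proof -
      have cong: "(\<alpha> (Min {i, j}) - \<alpha> (Max {i, j}))\<^sup>2
          = (\<beta> (Min (p ` {i, j})) - \<beta> (Max (p ` {i, j})))\<^sup>2"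
        if "i \<in> {1..6}" "j \<in> {1..6}" for i j
        by (rule edge_sqdiff_cong) (use ab that in auto)
      from that \<sigma>(2) obtain e' where "e' \<in> E" "e = \<sigma> ` e'" by auto
      then obtain i j where "i \<in> {1..6}" "j \<in> {1..6}" "e = {\<sigma> i, \<sigma> j}"
        using E[of e'] by auto
      then show ?thesis
        using cong permutes_in_image[OF \<sigma>(1)] by metis
    qed
    then show ?thesis
      unfolding edge_expr_def
      by (subst prod.reindex) (auto intro: inj_on_subset[OF inj[OF ip]])
  qed
  have comp: "(`) q ` E' \<in> edge_sets_orbit E"
    if q: "q permutes {1..6}" and E': "E' \<in> edge_sets_orbit E" for q E'
  proof -
    from E' obtain \<sigma> where \<sigma>: "\<sigma> permutes {1..6}" "E' = (`) \<sigma> ` E"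
      by (auto simp: edge_sets_orbit_def)
    have "(`) q ` E' = (`) (q \<circ> \<sigma>) ` E" unfolding \<sigma>(2) by (simp add: image_image image_comp)
    with permutes_compose[OF \<sigma>(1) q] show ?thesis unfolding edge_sets_orbit_def by blast
  qed
  have ids: "(`) (inv_into UNIV p) ` (`) p ` E' = E'" "(`) p ` (`) (inv_into UNIV p) ` E' = E'" for E'
    using permutes_inverses[OF p] by (simp_all add: image_image)
  show ?thesis
    unfolding orbit_sum_def
    by (rule sum.reindex_bij_witness[of _ "\<lambda>E'. (`) (inv_into UNIV p) ` E'" "\<lambda>E'. (`) p ` E'"])
       (use ids comp p permutes_inv[OF p] * in auto)
qed

lemma prod_pairs_eq_edge_expr:
  "(\<Prod>j\<in>{1..6::nat}. \<Prod>i\<in>{1..<j}. (\<alpha> i - \<alpha> j)\<^sup>2) = edge_expr \<alpha> {e. e \<subseteq> {1..6} \<and> card e = 2}"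
proof -
  have "(\<Prod>j\<in>{1..6::nat}. \<Prod>i\<in>{1..<j}. (\<alpha> i - \<alpha> j)\<^sup>2)
      = (\<Prod>(j, i)\<in>Sigma {1..6} (\<lambda>j. {1..<j}). (\<alpha> i - \<alpha> j)\<^sup>2)"
    by (subst prod.Sigma) auto
  also have "\<dots> = (\<Prod>e\<in>{e. e \<subseteq> {1..6} \<and> card e = 2}. (\<alpha> (Min e) - \<alpha> (Max e))\<^sup>2)"
  proof (rule prod.reindex_bij_witness[of _ "\<lambda>e. (Max e, Min e)" "\<lambda>(j, i). {i, j}"])
    fix e :: "nat set" assume e: "e \<in> {e. e \<subseteq> {1..6} \<and> card e = 2}"
    then obtain x y where xy: "e = {x, y}" "x \<noteq> y" by (auto simp: card_2_iff)
    show "(case (Max e, Min e) of (j, i) \<Rightarrow> {i, j}) = e"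
      using xy by (auto simp: min_def max_def)
    show "(Max e, Min e) \<in> Sigma {1..6} (\<lambda>j. {1..<j})"
      using e xy by (auto simp: min_def max_def)
  qed (auto simp: min_def max_def)
  finally show ?thesis by (simp add: edge_expr_def)
qed

lemma orbit_complete:
  "edge_sets_orbit {e. e \<subseteq> {1..6} \<and> card e = 2} = {{e. e \<subseteq> {1..6} \<and> card e = 2}}"
proof -
  have sub: "(`) \<sigma> ` {e. e \<subseteq> {1..6} \<and> card e = 2} \<subseteq> {e. e \<subseteq> {1..6} \<and> card e = 2}"
    if "\<sigma> permutes {1..6::nat}" for \<sigma>
    using permutes_in_image[OF that] card_image[OF inj_on_subset[OF permutes_inj[OF that]]]
    by (force simp: subset_iff)
  have fixed: "(`) \<sigma> ` {e. e \<subseteq> {1..6} \<and> card e = 2} = {e. e \<subseteq> {1..6} \<and> card e = 2}"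
    if s: "\<sigma> permutes {1..6::nat}" for \<sigma>
  proof (rule antisym[OF sub[OF s]])
    have "{e. e \<subseteq> {1..6} \<and> card e = 2}
        = (`) \<sigma> ` (`) (inv_into UNIV \<sigma>) ` {e. e \<subseteq> {1..6::nat} \<and> card e = 2}"
      using permutes_inverses[OF s] by (simp add: image_image)
    also have "\<dots> \<subseteq> (`) \<sigma> ` {e. e \<subseteq> {1..6} \<and> card e = 2}"
      by (rule image_mono[OF sub[OF permutes_inv[OF s]]])
    finally show "{e. e \<subseteq> {1..6} \<and> card e = 2} \<subseteq> (`) \<sigma> ` {e. e \<subseteq> {1..6} \<and> card e = 2}" .
  qed
  have "edge_sets_orbit {e. e \<subseteq> {1..6} \<and> card e = 2}
      = (\<lambda>\<sigma>. (`) \<sigma> ` {e. e \<subseteq> {1..6} \<and> card e = 2}) ` {\<sigma>. \<sigma> permutes {1..6}}"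
    by (rule edge_sets_orbit_image)
  also have "\<dots> = (\<lambda>\<sigma>. {e. e \<subseteq> {1..6} \<and> card e = 2}) ` {\<sigma>. \<sigma> permutes {1..6::nat}}"
    by (rule image_cong[OF refl]) (erule fixed[OF CollectD[of _ "\<lambda>\<sigma>. \<sigma> permutes {1..6}"]])
  also have "\<dots> = {{e. e \<subseteq> {1..6} \<and> card e = 2}}"
    by (rule image_constant[of id]) (rule CollectI, rule permutes_id)
  finally show ?thesis .
qed

lemma igusa_clebsch_eq:
  fixes \<alpha> :: "nat \<Rightarrow> 'a::field"
  assumes f: "f = smult c (\<Prod>i\<in>{1..6}. [:- \<alpha> i, 1:])" and c: "c \<noteq> 0"
  shows "igusa_J2 f = c ^ 2 * orbit_sum \<alpha> {{1,2}, {3,4}, {5,6}}"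
    and "igusa_J4 f = c ^ 4 * orbit_sum \<alpha> {{1,2}, {2,3}, {3,1}, {4,5}, {5,6}, {6,4}}"
    and "igusa_J6 f = c ^ 6 * orbit_sum \<alpha>
           {{1,2}, {2,3}, {3,1}, {4,5}, {5,6}, {6,4}, {1,4}, {2,5}, {3,6}}"
    and "igusa_J10 f = c ^ 10 * (\<Prod>j\<in>{1..6}. \<Prod>i\<in>{1..<j}. (\<alpha> i - \<alpha> j)\<^sup>2)"
proof -
  have "lead_coeff (\<Prod>i\<in>{1..6::nat}. [:- \<alpha> i, 1:]) = 1"
    by (simp add: lead_coeff_prod)
  then have lc: "lead_coeff f = c" unfolding f by simp
  define \<beta> where "\<beta> = sextic_roots f"
  have f': "f = smult c (\<Prod>i\<in>{1..6}. [:- \<beta> i, 1:])"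
    unfolding \<beta>_def sextic_roots_def lc by (rule someI[of _ \<alpha>]) (rule f)
  have pr: "proots (smult c (\<Prod>i\<in>{1..6}. [:- \<gamma> i, 1:])) = image_mset \<gamma> (mset_set {1..6::nat})"
    for \<gamma> :: "nat \<Rightarrow> 'a"
    by (simp add: c proots_prod sum_unfold_sum_mset)
  have "image_mset \<beta> (mset_set {1..6}) = image_mset \<alpha> (mset_set {1..6})"
    using pr[of \<alpha>] pr[of \<beta>] f f' by metis
  then obtain p where p: "p permutes {1..6}" "\<forall>x\<in>{1..6}. \<beta> x = \<alpha> (p x)"
    by (rule image_mset_eq_implies_permutes[rotated]) auto
  have eq: "orbit_sum \<beta> E = orbit_sum \<alpha> E"
    if "\<And>e. e \<in> E \<Longrightarrow> \<exists>i\<in>{1..6}. \<exists>j\<in>{1..6}. e = {i, j}" for E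
    by (rule orbit_sum_permute[OF p(1)]) (use p that in auto)
  have pairI: "\<exists>x\<in>{1..6}. \<exists>y\<in>{1..6::nat}. {i, j} = {x, y}"
    if "i \<in> {1..6}" "j \<in> {1..6}" for i j
    using that by blast
  have e2: "\<And>e. e \<in> {{1,2}, {3,4}, {5,6}} \<Longrightarrow> \<exists>i\<in>{1..6}. \<exists>j\<in>{1..6::nat}. e = {i, j}"
    by (elim insertE emptyE; hypsubst; intro pairI; simp)
  have e6: "\<And>e. e \<in> {{1,2}, {2,3}, {3,1}, {4,5}, {5,6}, {6,4}, {1,4}, {2,5}, {3,6}} \<Longrightarrow>
      \<exists>i\<in>{1..6}. \<exists>j\<in>{1..6::nat}. e = {i, j}"
    by (elim insertE emptyE; hypsubst; intro pairI; simp)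
  have e4: "\<And>e. e \<in> {{1,2}, {2,3}, {3,1}, {4,5}, {5,6}, {6,4}} \<Longrightarrow>
      \<exists>i\<in>{1..6}. \<exists>j\<in>{1..6::nat}. e = {i, j}"
    by (elim insertE emptyE; hypsubst; intro pairI; simp)
  show "igusa_J2 f = c ^ 2 * orbit_sum \<alpha> {{1,2}, {3,4}, {5,6}}"
    unfolding igusa_J2_def lc \<beta>_def[symmetric] by (simp only: eq[OF e2])
  show "igusa_J4 f = c ^ 4 * orbit_sum \<alpha> {{1,2}, {2,3}, {3,1}, {4,5}, {5,6}, {6,4}}"
    unfolding igusa_J4_def lc \<beta>_def[symmetric] by (simp only: eq[OF e4])
  show "igusa_J6 f = c ^ 6 * orbit_sum \<alpha>
           {{1,2}, {2,3}, {3,1}, {4,5}, {5,6}, {6,4}, {1,4}, {2,5}, {3,6}}"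
    unfolding igusa_J6_def lc \<beta>_def[symmetric] by (simp only: eq[OF e6])
  have "orbit_sum \<beta> {e. e \<subseteq> {1..6} \<and> card e = 2} = orbit_sum \<alpha> {e. e \<subseteq> {1..6} \<and> card e = 2}"
    by (rule eq) (auto simp: card_2_iff)
  then show "igusa_J10 f = c ^ 10 * (\<Prod>j\<in>{1..6}. \<Prod>i\<in>{1..<j}. (\<alpha> i - \<alpha> j)\<^sup>2)"
    unfolding igusa_J10_def lc \<beta>_def[symmetric] prod_pairs_eq_edge_expr
    by (simp only: orbit_sum_def orbit_complete sum.insert finite.emptyI empty_iff not_False_eq_True sum.empty add_0_right)
qed

end

theory Submission
  imports Defs
begin

text
  \<open>Put \<open>w = 3 H(F, G)\<close>, \<open>T = 2 (a b - 9)\<close>, \<open>Z = - disc F = - R(F, G)\<close>, so that \<open>disc G = 16 (w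
    + T)\<close>, and \<open>t = T / w\<close>, \<open>q = Z / w\<^sup>3\<close>. Then \<open>r\<^sub>1 = - 1 / (27 q)\<close> and \<open>r\<^sub>2 = - 1 / (1296 q (t
    + 1))\<close>, hence \<open>k(r\<^sub>1, r\<^sub>2) = k(t, q)\<close>. Up to rational factors, \<open>J\<^sub>2\<close>, \<open>J\<^sub>4\<close> and \<open>J\<^sub>6\<close> are sums over
    the ten splittings of the six roots into two triples: the roots of \<open>F\<close> and those of \<open>G\<close>, or
    these triples after exchanging a root \<open>x\<close> of \<open>F\<close> with a root \<open>y\<close> of \<open>G\<close>. In the latter case
    the summand is a polynomial in \<open>x\<close>, \<open>y\<close>, \<open>a\<close>, \<open>b\<close>, which is reduced modulo the cubics and
    summed with the help of power sums. It turns out that \<open>J\<^sub>4 / J\<^sub>2\<^sup>2\<close>, \<open>J\<^sub>6 / J\<^sub>2\<^sup>3\<close>, \<open>J\<^sub>1\<^sub>0 / J\<^sub>2\<^sup>5\<close> are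
    rational multiples of explicit elements \<open>A\<close>, \<open>B\<close>, \<open>C\<close> of \<open>k(t, q)\<close>, and \<open>k(i\<^sub>1, i\<^sub>2, i\<^sub>3)
    = k(A, B, C)\<close>. Conversely, eliminating \<open>q\<close> from \<open>A\<close>, \<open>B\<close>, \<open>C\<close> leaves two polynomials over
    \<open>k(A, B, C)\<close> with the root \<open>t\<close>. Dividing both by \<open>X - t\<close> and specializing \<open>(a, b)\<close> to a
    suitable point of the curve \<open>b\<^sup>3 = 27\<close> shows that they have no other common factor, so their
    greatest common divisor \<open>X - t\<close> has coefficients in \<open>k(A, B, C)\<close>.\<close>

section \<open>Subfields and common roots\<close>

lemma is_subfieldD:
  assumes "is_subfield K"
  shows "0 \<in> K" "1 \<in> K" "x \<in> K \<Longrightarrow> y \<in> K \<Longrightarrow> x + y \<in> K" "x \<in> K \<Longrightarrow> y \<in> K \<Longrightarrow> x * y \<in> K"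
    "x \<in> K \<Longrightarrow> - x \<in> K" "x \<in> K \<Longrightarrow> inverse x \<in> K"
  using assms by (auto simp: is_subfield_def)

lemma is_subfield_diff:
  assumes "is_subfield K" "x \<in> K" "y \<in> K"
  shows "x - y \<in> K"
  using is_subfieldD(3)[OF assms(1), of x "- y"] is_subfieldD(5)[OF assms(1)] assms by simp

lemma is_subfield_divide:
  assumes "is_subfield K" "x \<in> K" "y \<in> K"
  shows "x / y \<in> K"
  using is_subfieldD(4)[OF assms(1), of x "inverse y"] is_subfieldD(6)[OF assms(1)] assms
  by (simp add: divide_inverse)

lemma is_subfield_power:
  assumes "is_subfield K" "x \<in> K"
  shows "x ^ n \<in> K"
  by (induction n) (use assms is_subfieldD[OF assms(1)] in auto)

lemma is_subfield_of_nat: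
  assumes "is_subfield K"
  shows "of_nat n \<in> K"
  by (induction n) (use is_subfieldD[OF assms(1)] in auto)

lemma is_subfield_numeral:
  assumes "is_subfield K"
  shows "numeral n \<in> K"
  using is_subfield_of_nat[OF assms, of "numeral n"] by simp

lemmas is_subfield_closed = is_subfieldD is_subfield_diff is_subfield_divide is_subfield_power
  is_subfield_numeral is_subfield_of_nat

section \<open>Generated subfields\<close>

lemma is_subfield_adjoin: "is_subfield (adjoin K S)"
  unfolding adjoin_def by (rule hull_in) (auto simp: is_subfield_def)

lemma adjoin_base: "x \<in> K \<Longrightarrow> x \<in> adjoin K S"
  unfolding adjoin_def using hull_subset[of "K \<union> S" is_subfield] by auto

lemma adjoin_gen: "x \<in> S \<Longrightarrow> x \<in> adjoin K S"
  unfolding adjoin_def using hull_subset[of "K \<union> S" is_subfield] by auto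

lemma adjoin_least: "is_subfield M \<Longrightarrow> K \<subseteq> M \<Longrightarrow> S \<subseteq> M \<Longrightarrow> adjoin K S \<subseteq> M"
  unfolding adjoin_def by (rule hull_minimal) auto

section \<open>Polynomials with coefficients in a subfield\<close>

definition poly_over :: "'a::zero set \<Rightarrow> 'a poly \<Rightarrow> bool" where
  "poly_over K p \<longleftrightarrow> (\<forall>n. coeff p n \<in> K)"

lemma poly_over_pCons: "a \<in> K \<Longrightarrow> poly_over K p \<Longrightarrow> poly_over K (pCons a p)"
  by (auto simp: poly_over_def coeff_pCons split: nat.split)

lemma poly_over_0: "is_subfield K \<Longrightarrow> poly_over K 0"
  by (auto simp: poly_over_def is_subfieldD)

lemma poly_over_1: "is_subfield K \<Longrightarrow> poly_over K 1"
  using poly_over_pCons[of 1 K 0] by (simp add: poly_over_0 is_subfieldD one_pCons)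

lemma sum_mem_subfield:
  assumes "is_subfield K" "\<And>i. i \<in> I \<Longrightarrow> f i \<in> K"
  shows "sum f I \<in> K"
  using assms(2) by (induction I rule: infinite_finite_induct)
    (auto intro: is_subfieldD[OF assms(1)])

lemma poly_over_add: "is_subfield K \<Longrightarrow> poly_over K p \<Longrightarrow> poly_over K q \<Longrightarrow> poly_over K (p + q)"
  by (auto simp: poly_over_def is_subfieldD)

lemma poly_over_diff: "is_subfield K \<Longrightarrow> poly_over K p \<Longrightarrow> poly_over K q \<Longrightarrow> poly_over K (p - q)"
  by (auto simp: poly_over_def is_subfield_diff)

lemma poly_over_mult: "is_subfield K \<Longrightarrow> poly_over K p \<Longrightarrow> poly_over K q \<Longrightarrow> poly_over K (p * q)"
  by (auto simp: poly_over_def coeff_mult intro!: sum_mem_subfield is_subfieldD(4))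

lemma poly_over_power: "is_subfield K \<Longrightarrow> poly_over K p \<Longrightarrow> poly_over K (p ^ n)"
  by (induction n) (auto simp: poly_over_1 poly_over_mult)

lemma poly_over_monom: "is_subfield K \<Longrightarrow> c \<in> K \<Longrightarrow> poly_over K (monom c n)"
  by (auto simp: poly_over_def is_subfieldD)

lemma poly_over_numeral: "is_subfield K \<Longrightarrow> poly_over K (numeral n)"
  by (simp add: numeral_poly poly_over_pCons poly_over_0 is_subfield_numeral)

lemmas poly_over_intros = poly_over_0 poly_over_1 poly_over_pCons poly_over_add poly_over_diff
  poly_over_mult poly_over_power poly_over_numeral

text \<open>In characteristic 0 every subfield absorbs the rational factors by which the computed
  expressions differ from the invariants.\<close>

lemma Rats_subset_subfield:
  fixes K :: "'a::field_char_0 set"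
  assumes "is_subfield K"
  shows "\<rat> \<subseteq> K"
proof
  fix x :: 'a assume "x \<in> \<rat>"
  then obtain i j :: int where x: "x = of_int i / of_int j"
    by (metis Rats_cases' )
  have "of_int i \<in> K" for i
    by (cases i) (auto intro: is_subfield_closed[OF assms])
  then show "x \<in> K" unfolding x by (intro is_subfield_divide assms)
qed

text \<open>The Euclidean algorithm stays inside \<open>K[X]\<close>.\<close>

lemma common_root_mem_subfield:
  fixes p q :: "'a::alg_closed_field poly"
  assumes K: "is_subfield K"
  shows "poly_over K p \<Longrightarrow> poly_over K q \<Longrightarrow> p = [:- t, 1:] * p' \<Longrightarrow> q = [:- t, 1:] * q' \<Longrightarrow>
    (\<And>x. poly p' x = 0 \<Longrightarrow> poly q' x \<noteq> 0) \<Longrightarrow> t \<in> K"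
\<comment> \<open>The zero polynomial has measure 0 and a nonzero constant measure 1, so a division
  step that ends in 0 always decreases the measure.\<close>
proof (induction "(if p = 0 then 0 else Suc (degree p)) + (if q = 0 then 0 else Suc (degree q))"
    arbitrary: p q p' q' rule: less_induct)
  case less
  \<comment> \<open>When one polynomial is 0, its cofactor vanishes everywhere and the other
    cofactor has no root. Over an algebraically closed field the latter is a constant
    \<open>c\<close>, and \<open>t\<close> is read off from the coefficients of
    \<open>c * (X - t)\<close>.\<close>
  have base: "t \<in> K" if r: "poly_over K r" "r = [:- t, 1:] * r'" "\<And>x. poly r' x \<noteq> 0" for r r'
  proof -
    from r(3) obtain c where c: "r' = [:c:]"
      by (metis alg_closed_imp_poly_has_root degree_eq_zeroE gr0I)
    with r(3)[of 0] have "c \<noteq> 0" by simp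
    moreover have "coeff r 0 = - (t * c)" "coeff r 1 = c" by (simp_all add: r(2) c)
    ultimately have "t = - (coeff r 0 / coeff r 1)" by simp
    then show ?thesis using r(1) K by (metis is_subfieldD(5) is_subfield_divide poly_over_def)
  qed
  \<comment> \<open>Subtracting \<open>m * q\<close> cancels the leading term of \<open>p\<close>
    without leaving \<open>K[X]\<close>. The cofactor becomes \<open>p' - m * q'\<close>, which has
    the same common roots with \<open>q'\<close> as \<open>p'\<close> has. The opposite order of
    degrees is reached by exchanging the two polynomials.\<close>
  have step: "t \<in> K" if pq: "poly_over K p" "poly_over K q" "p = [:- t, 1:] * p'"
    "q = [:- t, 1:] * q'"
      "\<And>x. poly p' x = 0 \<Longrightarrow> poly q' x \<noteq> 0" "p \<noteq> 0" "q \<noteq> 0" "degree q \<le> degree p"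
      and IH: "\<And>r r'. poly_over K r \<Longrightarrow> r = 0 \<or> degree r < degree p \<Longrightarrow> r = [:- t, 1:] * r' \<Longrightarrow>
        (\<And>x. poly r' x = 0 \<Longrightarrow> poly q' x \<noteq> 0) \<Longrightarrow> t \<in> K" for p q p' q'
  proof -
    define m where "m = monom (lead_coeff p / lead_coeff q) (degree p - degree q)"
    define r where "r = p - m * q"
    have m: "poly_over K m"
      unfolding m_def using K pq(1,2) by (intro poly_over_monom is_subfield_divide)
        (auto simp: poly_over_def)
    have r: "poly_over K r" unfolding r_def by (intro poly_over_diff poly_over_mult K pq m)
    have dm: "degree (m * q) = degree p" "lead_coeff (m * q) = lead_coeff p"
    proof -
      have "m \<noteq> 0" using pq(6,7) by (simp add: m_def)
      moreover have "degree m = degree p - degree q"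
        unfolding m_def by (rule degree_monom_eq) (use pq(6,7) in simp)
      ultimately show "degree (m * q) = degree p"
        using pq(7,8) by (simp add: degree_mult_eq)
      show "lead_coeff (m * q) = lead_coeff p"
        unfolding lead_coeff_mult using pq(7) by (simp only: m_def lead_coeff_monom) simp
    qed
    have "degree r \<le> degree p" unfolding r_def by (rule degree_diff_le) (auto simp: dm)
    moreover have "coeff r (degree p) = 0" using dm by (simp add: r_def)
    ultimately have "r = 0 \<or> degree r < degree p"
      by (metis leading_coeff_0_iff le_neq_implies_less)
    then show ?thesis
    proof (rule IH[OF r])
      show "r = [:- t, 1:] * (p' - m * q')"
        unfolding r_def by (subst pq(3), subst pq(4)) (simp only: right_diff_distrib
          mult.left_commute)
      show "poly q' x \<noteq> 0" if "poly (p' - m * q') x = 0" for x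
        using that pq(5)[of x] by auto
    qed
  qed
  have t: "[:- t, 1:] \<noteq> 0" by simp
  show ?case
  proof (cases "p = 0 \<or> q = 0")
    case True
    then show ?thesis
    proof
      assume "p = 0"
      then have "p' = 0" using less.prems(3) t by (metis mult_eq_0_iff)
      with base[OF less.prems(2,4)] less.prems(5) show ?thesis by auto
    next
      assume "q = 0"
      then have "q' = 0" using less.prems(4) t by (metis mult_eq_0_iff)
      with base[OF less.prems(1,3)] less.prems(5) show ?thesis by (metis poly_0)
    qed
  next
    case False
    show ?thesis
    proof (cases "degree q \<le> degree p")
      case True
      show ?thesis
      proof (rule step[OF less.prems])
        fix r r' assume r: "poly_over K r" "r = 0 \<or> degree r < degree p" "r = [:- t, 1:] * r'"
          "\<And>x. poly r' x = 0 \<Longrightarrow> poly q' x \<noteq> 0"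
        show "t \<in> K"
          by (rule less.hyps[OF _ r(1) less.prems(2) r(3) less.prems(4) r(4)]) (use r(2)
            False in auto)
      qed (use False True in auto)
    next
      case F: False
      show ?thesis
      proof (rule step[OF less.prems(2,1,4,3)])
        fix r r' assume r: "poly_over K r" "r = 0 \<or> degree r < degree q" "r = [:- t, 1:] * r'"
          "\<And>x. poly r' x = 0 \<Longrightarrow> poly p' x \<noteq> 0"
        then have no_root: "\<And>x. poly p' x = 0 \<Longrightarrow> poly r' x \<noteq> 0" by blast
        show "t \<in> K"
          by (rule less.hyps[OF _ less.prems(1) r(1) less.prems(3) r(3) no_root]) (use r(2)
            False in auto)
      qed (use False F less.prems(5) in auto)
    qed
  qed
qed

section \<open>Specialization of two transcendentals\<close>

definition bipoly_over :: "'a::field set \<Rightarrow> 'a poly poly \<Rightarrow> bool" where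
  "bipoly_over K p \<longleftrightarrow> (\<forall>i j. coeff (coeff p i) j \<in> K)"

lemma bipoly_over_add: "is_subfield K \<Longrightarrow> bipoly_over K p \<Longrightarrow> bipoly_over K q \<Longrightarrow> bipoly_over K (p + q)"
  by (simp add: bipoly_over_def is_subfieldD)

lemma bipoly_over_mult: "is_subfield K \<Longrightarrow> bipoly_over K p \<Longrightarrow> bipoly_over K q \<Longrightarrow> bipoly_over K (p * q)"
  by (auto simp: bipoly_over_def coeff_mult coeff_sum intro!: sum_mem_subfield is_subfieldD(4))

lemma bipoly_over_const: "is_subfield K \<Longrightarrow> c \<in> K \<Longrightarrow> bipoly_over K [:[:c:]:]"
  by (auto simp: bipoly_over_def coeff_pCons is_subfieldD split: nat.split)

lemma bipoly_over_vars: "is_subfield K \<Longrightarrow> bipoly_over K [:[:0, 1:]:]" "is_subfield K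
  \<Longrightarrow> bipoly_over K [:0, 1:]"
  by (auto simp: bipoly_over_def coeff_pCons is_subfieldD split: nat.split)

text \<open>The outer variable is evaluated first, at the constant polynomial \<open>[:b:]\<close>;
  both stages are then instances of \<open>poly\<close> and hence ring homomorphisms.\<close>

definition ev2 :: "'a::comm_ring_1 \<Rightarrow> 'a \<Rightarrow> 'a poly poly \<Rightarrow> 'a" where
  "ev2 a b p = poly (poly p [:b:]) a"

lemma ev2_simps [simp]:
  "ev2 a b (p + q) = ev2 a b p + ev2 a b q" "ev2 a b (p * q) = ev2 a b p * ev2 a b q"
  "ev2 a b (- p) = - ev2 a b p" "ev2 a b [:[:c:]:] = c" "ev2 a b [:[:0, 1:]:] = a"
    "ev2 a b [:0, 1:] = b"
  "ev2 a b 0 = 0"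
  by (simp_all add: ev2_def)

lemma ev2_conv: "poly (map_poly (\<lambda>q. poly q a) p) b = ev2 a b p"
  by (induction p) (auto simp: ev2_def map_poly_pCons)

lemma independent_transcendentals_ev2:
  assumes "independent_transcendentals K a b" "bipoly_over K p" "ev2 a b p = 0"
  shows "p = 0"
proof -
  have "\<forall>q\<in>set (coeffs p). set (coeffs q) \<subseteq> K"
  proof (intro ballI subsetI)
    fix q c assume "q \<in> set (coeffs p)" "c \<in> set (coeffs q)"
    then obtain i j where "q = coeff p i" "c = coeff q j" by (metis coeffs_nth in_set_conv_nth
      degree_0 coeff_0 list.size(3) length_coeffs_degree less_Suc_eq_le not_less_zero coeffs_eq_Nil)
    with assms(2) show "c \<in> K" by (auto simp: bipoly_over_def)
  qed
  with assms show ?thesis by (auto simp: independent_transcendentals_def ev2_conv)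
qed

text
  \<open>The place \<open>(a, b) \<mapsto> (a0, b0)\<close> of \<open>K(a, b)\<close>: the element \<open>x\<close> is regular there and takes the
    value \<open>y\<close>.\<close>

definition specializes :: "'a::field set \<Rightarrow> 'a \<times> 'a \<Rightarrow> 'a \<times> 'a \<Rightarrow> 'a \<Rightarrow> 'a \<Rightarrow> bool" where
  "specializes K g g0 x y \<longleftrightarrow> (\<exists>p q. bipoly_over K p \<and> bipoly_over K q \<and>
     ev2 (fst g0) (snd g0) q \<noteq> 0 \<and> ev2 (fst g) (snd g) q \<noteq> 0 \<and>
     x = ev2 (fst g) (snd g) p / ev2 (fst g) (snd g) q \<and>
     y = ev2 (fst g0) (snd g0) p / ev2 (fst g0) (snd g0) q)"

locale bivariate_place =
  fixes K :: "'a::field set" and a b a0 b0 :: 'a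
  assumes K: "is_subfield K" and indep: "independent_transcendentals K a b"
begin

abbreviation spec :: "'a \<Rightarrow> 'a \<Rightarrow> bool" where
  "spec \<equiv> specializes K (a, b) (a0, b0)"

lemma specE:
  assumes "spec x y"
  obtains p q where "bipoly_over K p" "bipoly_over K q" "ev2 a0 b0 q \<noteq> 0" "ev2 a b q \<noteq> 0"
    "x = ev2 a b p / ev2 a b q" "y = ev2 a0 b0 p / ev2 a0 b0 q"
  using assms by (auto simp: specializes_def)

text \<open>A denominator that is nonzero at the special point is a nonzero polynomial, so by
  independence it does not vanish at \<open>(a, b)\<close> either.\<close>

lemma specI:
  assumes "bipoly_over K p" "bipoly_over K q" "ev2 a0 b0 q \<noteq> 0"
    "x = ev2 a b p / ev2 a b q" "y = ev2 a0 b0 p / ev2 a0 b0 q"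
  shows "spec x y"
proof -
  have "ev2 a b q \<noteq> 0"
    using independent_transcendentals_ev2[OF indep assms(2)] assms(3) by auto
  with assms show ?thesis by (auto simp: specializes_def)
qed

lemma spec_const: "c \<in> K \<Longrightarrow> spec c c"
  by (rule specI[of "[:[:c:]:]" "[:[:1:]:]"]) (use K in \<open>auto intro: bipoly_over_const
    is_subfieldD\<close>)

lemma spec_a: "spec a a0"
  by (rule specI[of "[:[:0, 1:]:]" "[:[:1:]:]"]) (use K in \<open>auto intro: bipoly_over_const
    bipoly_over_vars is_subfieldD\<close>)

lemma spec_b: "spec b b0"
  by (rule specI[of "[:0, 1:]" "[:[:1:]:]"]) (use K in \<open>auto intro: bipoly_over_const
    bipoly_over_vars is_subfieldD\<close>)

lemma spec_add:
  assumes "spec x y" "spec x' y'"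
  shows "spec (x + x') (y + y')"
proof -
  from assms(1) obtain p q where pq: "bipoly_over K p" "bipoly_over K q" "ev2 a0 b0 q \<noteq> 0"
    "ev2 a b q \<noteq> 0"
    "x = ev2 a b p / ev2 a b q" "y = ev2 a0 b0 p / ev2 a0 b0 q" by (rule specE)
  from assms(2) obtain p' q' where pq': "bipoly_over K p'" "bipoly_over K q'" "ev2 a0 b0 q' \<noteq> 0"
    "ev2 a b q' \<noteq> 0"
    "x' = ev2 a b p' / ev2 a b q'" "y' = ev2 a0 b0 p' / ev2 a0 b0 q'" by (rule specE)
  show ?thesis
    by (rule specI[of "p * q' + p' * q" "q * q'"])
       (use pq pq' in \<open>auto intro!: bipoly_over_add bipoly_over_mult K simp: add_frac_eq\<close>)
qed

lemma spec_mult: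
  assumes "spec x y" "spec x' y'"
  shows "spec (x * x') (y * y')"
proof -
  from assms(1) obtain p q where pq: "bipoly_over K p" "bipoly_over K q" "ev2 a0 b0 q \<noteq> 0"
    "ev2 a b q \<noteq> 0"
    "x = ev2 a b p / ev2 a b q" "y = ev2 a0 b0 p / ev2 a0 b0 q" by (rule specE)
  from assms(2) obtain p' q' where pq': "bipoly_over K p'" "bipoly_over K q'" "ev2 a0 b0 q' \<noteq> 0"
    "ev2 a b q' \<noteq> 0"
    "x' = ev2 a b p' / ev2 a b q'" "y' = ev2 a0 b0 p' / ev2 a0 b0 q'" by (rule specE)
  show ?thesis
    by (rule specI[of "p * p'" "q * q'"])
       (use pq pq' in \<open>auto intro!: bipoly_over_mult K\<close>)
qed

lemma spec_uminus:
  assumes "spec x y"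
  shows "spec (- x) (- y)"
  using spec_mult[OF spec_const[of "- 1"] assms] is_subfieldD[OF K] by simp

lemma spec_diff: "spec x y \<Longrightarrow> spec x' y' \<Longrightarrow> spec (x - x') (y - y')"
  using spec_add[of x y "- x'" "- y'"] spec_uminus by simp

lemma spec_inverse:
  assumes "spec x y" "y \<noteq> 0"
  shows "spec (inverse x) (inverse y)"
proof -
  from assms(1) obtain p q where pq: "bipoly_over K p" "bipoly_over K q" "ev2 a0 b0 q \<noteq> 0"
    "ev2 a b q \<noteq> 0"
    "x = ev2 a b p / ev2 a b q" "y = ev2 a0 b0 p / ev2 a0 b0 q" by (rule specE)
  show ?thesis
    by (rule specI[of q p]) (use pq assms(2) in auto)
qed

lemma spec_divide: "spec x y \<Longrightarrow> spec x' y' \<Longrightarrow> y' \<noteq> 0 \<Longrightarrow> spec (x / x') (y / y')"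
  using spec_mult[of x y "inverse x'" "inverse y'"] spec_inverse by (simp add: divide_inverse)

lemma spec_0: "spec 0 0" and spec_1: "spec 1 1"
  by (simp_all add: spec_const is_subfieldD[OF K])

lemma spec_power: "spec x y \<Longrightarrow> spec (x ^ n) (y ^ n)"
  by (induction n) (auto simp: spec_1 spec_mult)

lemma spec_of_nat: "spec (of_nat n) (of_nat n)"
  by (induction n) (auto simp: spec_0 spec_1 spec_add)

lemma spec_numeral: "spec (numeral n) (numeral n)"
  using spec_of_nat[of "numeral n"] by simp

text \<open>The numerator of a zero fraction vanishes at \<open>(a, b)\<close>, hence is the zero
  polynomial and has value 0 at the special point too. Nonvanishing of a generic quantity is thus
  reduced to a numerical evaluation.\<close>

lemma spec_nonzero:
  assumes "spec x y" "y \<noteq> 0"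
  shows "x \<noteq> 0"
proof
  assume "x = 0"
  with assms(1) obtain p q where pq: "bipoly_over K p" "ev2 a b q \<noteq> 0" "0 = ev2 a b p / ev2 a b q"
    "y = ev2 a0 b0 p / ev2 a0 b0 q"
    by (elim specE) simp
  then have "ev2 a b p = 0" by simp
  from independent_transcendentals_ev2[OF indep pq(1) this] assms(2) pq(4) show False by simp
qed

lemma spec_sum: "(\<And>i. i \<in> I \<Longrightarrow> spec (f i) (g i)) \<Longrightarrow> spec (sum f I) (sum g I)"
  by (induction I rule: infinite_finite_induct) (auto simp: spec_0 spec_add)

lemma spec_prod: "(\<And>i. i \<in> I \<Longrightarrow> spec (f i) (g i)) \<Longrightarrow> spec (prod f I) (prod g I)"
  by (induction I rule: infinite_finite_induct) (auto simp: spec_1 spec_mult)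

lemmas spec_intros = spec_0 spec_1 spec_numeral spec_add spec_diff spec_mult spec_uminus spec_power

text \<open>By the Leibniz formula a determinant is a sum of signed products of entries, and
  specialization respects sums and products.\<close>

lemma spec_det:
  assumes M: "M \<in> carrier_mat n n" "M0 \<in> carrier_mat n n"
    and "\<And>i j. i < n \<Longrightarrow> j < n \<Longrightarrow> spec (M $$ (i, j)) (M0 $$ (i, j))"
  shows "spec (det M) (det M0)"
  unfolding det_def'[OF M(1)] det_def'[OF M(2)]
proof (intro spec_sum spec_mult spec_prod)
  fix p assume "p \<in> {p. p permutes {0..<n}}"
  then have "p i < n" if "i < n" for i using that permutes_in_image[of p "{0..<n}" i] by auto
  then show "spec (M $$ (i, p i)) (M0 $$ (i, p i))" if "i \<in> {0..<n}" for i using that assms by auto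
  show "spec (signof p) (signof p)"
    by (simp add: sign_def spec_1 spec_uminus)
qed

section \<open>Coefficientwise specialization of polynomials\<close>

definition poly_spec :: "'a poly \<Rightarrow> 'a poly \<Rightarrow> bool" where
  "poly_spec p p0 \<longleftrightarrow> (\<forall>n. spec (coeff p n) (coeff p0 n))"

lemma poly_spec_pCons: "spec x y \<Longrightarrow> poly_spec p p0 \<Longrightarrow> poly_spec (pCons x p) (pCons y p0)"
  by (auto simp: poly_spec_def coeff_pCons split: nat.split)

lemma poly_spec_0: "poly_spec 0 0"
  by (auto simp: poly_spec_def spec_0)

lemma poly_spec_1: "poly_spec 1 1"
  using poly_spec_pCons[OF spec_1 poly_spec_0] by (simp add: one_pCons)

lemma poly_spec_numeral: "poly_spec (numeral n) (numeral n)"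
  by (simp add: numeral_poly poly_spec_pCons poly_spec_0 spec_numeral)

lemma poly_spec_add: "poly_spec p p0 \<Longrightarrow> poly_spec q q0 \<Longrightarrow> poly_spec (p + q) (p0 + q0)"
  by (auto simp: poly_spec_def spec_add)

lemma poly_spec_diff: "poly_spec p p0 \<Longrightarrow> poly_spec q q0 \<Longrightarrow> poly_spec (p - q) (p0 - q0)"
  by (auto simp: poly_spec_def spec_diff)

lemma poly_spec_mult: "poly_spec p p0 \<Longrightarrow> poly_spec q q0 \<Longrightarrow> poly_spec (p * q) (p0 * q0)"
  by (auto simp: poly_spec_def coeff_mult intro!: spec_sum spec_mult)

lemma poly_spec_power: "poly_spec p p0 \<Longrightarrow> poly_spec (p ^ n) (p0 ^ n)"
  by (induction n) (auto simp: poly_spec_1 poly_spec_mult)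

lemmas poly_spec_intros = poly_spec_0 poly_spec_1 poly_spec_pCons poly_spec_numeral poly_spec_add
  poly_spec_diff poly_spec_mult poly_spec_power

text \<open>Division by the monic \<open>X - t\<close> is synthetic division from the top
  coefficient down, which only adds and multiplies. One bound \<open>Suc N\<close> serves both
  polynomials because the degree may drop under specialization.\<close>

lemma poly_spec_linear_cofactor:
  assumes P: "poly_spec P P0" "P = [:- t, 1:] * p" "P0 = [:- t0, 1:] * p0" "spec t t0"
    and deg: "degree P \<le> Suc N" "degree P0 \<le> Suc N"
  shows "poly_spec p p0"
proof -
  have c: "coeff P (Suc n) = coeff p n - t * coeff p (Suc n)"
    "coeff P0 (Suc n) = coeff p0 n - t0 * coeff p0 (Suc n)" for n
    unfolding P(2,3) by simp_all
  have deg_cofactor: "degree r \<le> N" if "degree ([:- s, 1:] * r) \<le> Suc N" for r :: "'a poly" and s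
    using that by (cases "r = 0") (simp_all add: degree_mult_eq del: mult_pCons_left)
  have dp: "degree p \<le> N" "degree p0 \<le> N"
    using deg deg_cofactor P(2,3) by blast+
  \<comment> \<open>Descending induction on the index \<open>N - n\<close>; once \<open>n\<close>
    has reached \<open>N\<close>, truncated subtraction keeps the index at 0.\<close>
  have "spec (coeff p (N - n)) (coeff p0 (N - n))" for n
  proof (induction n)
    case 0
    have "coeff p (Suc N) = 0" "coeff p0 (Suc N) = 0" using dp by (auto intro: coeff_eq_0)
    with c[of N] P(1) show ?case by (metis diff_zero diff_0_right mult_zero_right poly_spec_def)
  next
    case (Suc n)
    show ?case
    proof (cases "n < N")
      case True
      then have "Suc (N - Suc n) = N - n" by simp
      with c[of "N - Suc n"] have
        "coeff p (N - Suc n) = coeff P (N - n) + t * coeff p (N - n)"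
        "coeff p0 (N - Suc n) = coeff P0 (N - n) + t0 * coeff p0 (N - n)" by auto
      with Suc P(1,4) show ?thesis by (simp add: poly_spec_def spec_add spec_mult)
    qed (use Suc in auto)
  qed
  note * = this
  show ?thesis unfolding poly_spec_def
  proof
    fix n show "spec (coeff p n) (coeff p0 n)"
    proof (cases "n \<le> N")
      case True then show ?thesis using *[of "N - n"] by simp
    next
      case False
      then have "coeff p n = 0" "coeff p0 n = 0" using dp by (auto intro: coeff_eq_0)
      then show ?thesis by (simp add: spec_0)
    qed
  qed
qed

lemma poly_bound: "degree p \<le> N \<Longrightarrow> poly p (x::'a) = (\<Sum>k\<le>N. coeff p k * x ^ k)"
  unfolding poly_altdef by (rule sum.mono_neutral_left) (auto simp: coeff_eq_0)

text \<open>A common root makes the Sylvester matrix singular, whereas at the special point its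
  determinant is a power of \<open>coeff p0 0\<close>. The matrix is built with the formal degrees
  \<open>m\<close> and \<open>n\<close>, since the true degrees may be smaller.\<close>

lemma spec_no_common_root:
  assumes pq: "poly_spec p p0" "poly_spec q (monom 1 m)" "degree p \<le> n" "degree q \<le> m"
    "coeff p0 0 \<noteq> 0"
  shows "\<not> (poly p t = 0 \<and> poly q t = 0)"
proof
  assume root: "poly p t = 0 \<and> poly q t = 0"
  define S where "S = sylvester_mat_sub m n q p"
  define S0 where "S0 = sylvester_mat_sub m n (monom 1 m) p0"
  note ix = sylvester_mat_sub_index[of _ m n]
  have S0: "S0 \<in> carrier_mat (m + n) (m + n)" and S: "S \<in> carrier_mat (m + n) (m + n)"
    by (auto simp: S_def S0_def)
  have ss: "spec (S $$ (i, j)) (S0 $$ (i, j))" if "i < m + n" "j < m + n" for i j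
    using that pq(1,2) by (auto simp: S_def S0_def ix poly_spec_def spec_0 simp del: coeff_monom)
  \<comment> \<open>Each of the first \<open>n\<close> rows, shifts of \<open>X ^ m\<close>, has its
    single nonzero entry 1 on the diagonal; each of the last \<open>m\<close> rows ends on the
    diagonal with \<open>coeff p0 0\<close>.\<close>
  have "det S0 = prod_list (diag_mat S0)"
    by (rule det_lower_triangular[OF _ S0]) (auto simp: S0_def ix)
  also have "\<dots> \<noteq> 0"
    using pq(5) by (auto simp: prod_list_zero_iff diag_mat_def S0_def ix)
  finally have "det S0 \<noteq> 0" .
  with spec_det[OF S S0 ss] have ne: "det S \<noteq> 0" by (rule spec_nonzero)
  show False
  proof (cases "m + n = 0")
    \<comment> \<open>The matrix is empty and has no nonzero kernel vector; instead \<open>q\<close>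
      is a constant that specializes to 1.\<close>
    case True
    then have "q = [:coeff q 0:]" using pq(4) by (simp add: degree_eq_zeroE) (metis coeff_pCons_0
      degree_0_id degree_eq_zeroE)
    then have "poly q t = coeff q 0" by (metis poly_const_conv mult_zero_right add_0_right poly_0
      poly_pCons)
    moreover have "spec (coeff q 0) 1" using pq(2) True by (metis add_is_0 coeff_monom
      poly_spec_def)
    ultimately show ?thesis using root spec_nonzero[of "coeff q 0" 1] by simp
  next
    case False
    \<comment> \<open>The descending powers of \<open>t\<close> form a kernel vector: every row of
      \<open>S\<close> yields a power of \<open>t\<close> times \<open>poly q t\<close> or
      \<open>poly p t\<close>.\<close>
    define v where "v = vec (m + n) (\<lambda>j. t ^ (m + n - 1 - j))"
    have "v \<noteq> 0\<^sub>v (m + n)"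
    proof
      assume "v = 0\<^sub>v (m + n)"
      then have "v $ (m + n - 1) = 0\<^sub>v (m + n) $ (m + n - 1)" by simp
      with False show False by (simp add: v_def)
    qed
    moreover have "S *\<^sub>v v = 0\<^sub>v (m + n)"
    proof (rule eq_vecI)
      fix i assume i: "i < dim_vec (0\<^sub>v (m + n) :: 'a vec)"
      have pt: "poly p t = (\<Sum>k\<le>n. coeff p k * t ^ k)" "poly q t = (\<Sum>k\<le>m. coeff q k * t ^ k)"
        using poly_bound[OF pq(3)] poly_bound[OF pq(4)] by auto
      have "(S *\<^sub>v v) $ i = (\<Sum>j<m+n. S $$ (i, j) * t ^ (m + n - 1 - j))"
        using i S by (simp add: scalar_prod_def v_def atLeast0LessThan)
      also have "\<dots> = 0"
      proof (cases "i < n")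
        case True
        have "(\<Sum>j<m+n. S $$ (i, j) * t ^ (m + n - 1 - j)) =
          (\<Sum>j\<in>{i..i+m}. coeff q (m + i - j) * t ^ (m + n - 1 - j))"
          using i True by (intro sum.mono_neutral_cong_right) (auto simp: S_def ix)
        also have "\<dots> = (\<Sum>k\<le>m. coeff q k * t ^ (k + (n - 1 - i)))"
          using True by (intro sum.reindex_bij_witness[of _ "\<lambda>k. m + i - k" "\<lambda>j. m + i - j"]) auto
        also have "\<dots> = poly q t * t ^ (n - 1 - i)"
          by (simp add: pt power_add sum_distrib_right mult.assoc)
        finally show ?thesis using root by simp
      next
        case False
        have "(\<Sum>j<m+n. S $$ (i, j) * t ^ (m + n - 1 - j)) =
          (\<Sum>j\<in>{i-n..i}. coeff p (i - j) * t ^ (m + n - 1 - j))"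
          using i False by (intro sum.mono_neutral_cong_right) (auto simp: S_def ix)
        also have "\<dots> = (\<Sum>k\<le>n. coeff p k * t ^ (k + (m + n - 1 - i)))"
          using False i by (intro sum.reindex_bij_witness[of _ "\<lambda>k. i - k" "\<lambda>j. i - j"]) auto
        also have "\<dots> = poly p t * t ^ (m + n - 1 - i)"
          by (simp add: pt power_add sum_distrib_right mult.assoc)
        finally show ?thesis using root by simp
      qed
      finally show "(S *\<^sub>v v) $ i = 0\<^sub>v (m + n) $ i" using i by simp
    qed (use S in auto)
    moreover have "v \<in> carrier_vec (m + n)" by (simp add: v_def)
    ultimately have "det S = 0" using det_0_iff_vec_prod_zero_field[OF S] by blast
    with ne show False by simp
  qed
qed

end

section \<open>Orbit sums\<close>

lemma atLeastAtMost_1_6: "{1..6::nat} = {1, 2, 3, 4, 5, 6}"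
  by auto

text \<open>The fibre is a coset of the stabilizer of \<open>E\<close>: left multiplication by
  \<open>\<rho>\<close> is the bijection.\<close>

lemma card_fibre_permutes_image:
  assumes \<rho>: "\<rho> permutes S"
  shows "card {\<sigma>. \<sigma> permutes S \<and> (`) \<sigma> ` E = (`) \<rho> ` E} = card {\<sigma>. \<sigma> permutes S \<and> (`) \<sigma> ` E = E}"
proof -
  have linv: "inv_into UNIV \<rho> \<circ> \<rho> = id" "\<rho> \<circ> inv_into UNIV \<rho> = id"
    using permutes_inv_o[OF \<rho>] by auto
  have "bij_betw ((\<circ>) \<rho>) {\<sigma>. \<sigma> permutes S \<and> (`) \<sigma> ` E = E} {\<sigma>. \<sigma> permutes S \<and> (`) \<sigma> ` E = (`) \<rho> `
    E}"
  proof (rule bij_betw_byWitness[where f' = "(\<circ>) (inv_into UNIV \<rho>)"])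
    show "\<forall>\<sigma>\<in>{\<sigma>. \<sigma> permutes S \<and> (`) \<sigma> ` E = E}. inv_into UNIV \<rho> \<circ> (\<rho> \<circ> \<sigma>) = \<sigma>"
      by (simp add: o_assoc linv)
    show "\<forall>\<sigma>\<in>{\<sigma>. \<sigma> permutes S \<and> (`) \<sigma> ` E = (`) \<rho> ` E}. \<rho> \<circ> (inv_into UNIV \<rho> \<circ> \<sigma>) = \<sigma>"
      by (simp add: o_assoc linv)
    have comp: "(`) (f \<circ> g) ` E = (`) f ` (`) g ` E" for f g :: "'a \<Rightarrow> 'a"
      by (simp add: image_image image_comp)
    show "(\<circ>) \<rho> ` {\<sigma>. \<sigma> permutes S \<and> (`) \<sigma> ` E = E} \<subseteq> {\<sigma>. \<sigma> permutes S \<and> (`) \<sigma> ` E = (`) \<rho> ` E}"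
      by (rule image_subsetI) (use \<rho> comp[of \<rho>] in \<open>metis (mono_tags, lifting)
        mem_Collect_eq permutes_compose\<close>)
    have "(`) (inv_into UNIV \<rho>) ` (`) \<rho> ` E = E"
      using comp[of "inv_into UNIV \<rho>" \<rho>] linv by simp
    then show "(\<circ>) (inv_into UNIV \<rho>) ` {\<sigma>. \<sigma> permutes S \<and> (`) \<sigma> ` E = (`) \<rho> ` E} \<subseteq> {\<sigma>. \<sigma> permutes
      S \<and> (`) \<sigma> ` E = E}"
      by (intro image_subsetI) (use permutes_inv[OF \<rho>] comp[of
        "inv_into UNIV \<rho>"] in \<open>metis (mono_tags, lifting) mem_Collect_eq permutes_compose\<close>)
  qed
  then show ?thesis by (simp add: bij_betw_same_card)
qed

text
  \<open>The factor is the order of the stabilizer of \<open>E\<close>; its value is irrelevant to the fields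
    generated by absolute invariants, so it is never computed.\<close>

lemma orbit_sum_eq_sum_permutes:
  fixes \<alpha> :: "nat \<Rightarrow> 'a::comm_ring_1"
  obtains m where "m > 0"
    "of_nat m * orbit_sum \<alpha> E = (\<Sum>\<sigma> | \<sigma> permutes {1..6}. edge_expr \<alpha> ((`) \<sigma> ` E))"
proof
  define m where "m = card {\<sigma>. \<sigma> permutes {1..6} \<and> (`) \<sigma> ` E = E}"
  have fin: "finite {\<sigma>. \<sigma> permutes {1..6::nat}}" by (simp add: finite_permutations)
  have "{\<sigma>. \<sigma> permutes {1..6} \<and> (`) \<sigma> ` E = E} \<noteq> {}"
    using permutes_id by (auto intro!: exI[of _ id])
  moreover have "finite {\<sigma>. \<sigma> permutes {1..6} \<and> (`) \<sigma> ` E = E}"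
    by (rule finite_subset[OF _ fin]) auto
  ultimately show "m > 0" by (simp add: m_def card_gt_0_iff)
  have "(\<Sum>\<sigma> | \<sigma> permutes {1..6}. edge_expr \<alpha> ((`) \<sigma> ` E)) =
     (\<Sum>E'\<in>(\<lambda>\<sigma>. (`) \<sigma> ` E) ` {\<sigma>. \<sigma> permutes {1..6}}.
        \<Sum>\<sigma> | \<sigma> \<in> {\<sigma>. \<sigma> permutes {1..6}} \<and> (`) \<sigma> ` E = E'. edge_expr \<alpha> ((`) \<sigma> ` E))"
    by (rule sum.image_gen[OF fin])
  also have "\<dots> = (\<Sum>E'\<in>edge_sets_orbit E. of_nat m * edge_expr \<alpha> E')"
    unfolding edge_sets_orbit_image
  proof (rule sum.cong[OF refl])
    fix E' assume "E' \<in> (\<lambda>\<sigma>. (`) \<sigma> ` E) ` {\<sigma>. \<sigma> permutes {1..6}}"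
    then obtain \<rho> where \<rho>: "\<rho> permutes {1..6}" "E' = (`) \<rho> ` E" by auto
    have "(\<Sum>\<sigma> | \<sigma> \<in> {\<sigma>. \<sigma> permutes {1..6}} \<and> (`) \<sigma> ` E = E'. edge_expr \<alpha> ((`) \<sigma> ` E)) =
      (\<Sum>\<sigma> | \<sigma> permutes {1..6} \<and> (`) \<sigma> ` E = E'. edge_expr \<alpha> E')"
      by (rule sum.cong) auto
    also have "\<dots> = of_nat m * edge_expr \<alpha> E'"
      using card_fibre_permutes_image[OF \<rho>(1), of E] by (simp add: m_def \<rho>(2))
    finally show "(\<Sum>\<sigma> | \<sigma> \<in> {\<sigma>. \<sigma> permutes {1..6}} \<and> (`) \<sigma> ` E = E'. edge_expr \<alpha> ((`) \<sigma> ` E)) =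
      of_nat m * edge_expr \<alpha> E'" .
  qed
  finally show "of_nat m * orbit_sum \<alpha> E = (\<Sum>\<sigma> | \<sigma> permutes {1..6}. edge_expr \<alpha> ((`) \<sigma> ` E))"
    by (simp add: orbit_sum_def sum_distrib_left)
qed

lemma edge_expr_image:
  fixes \<alpha> :: "nat \<Rightarrow> 'a::comm_ring_1"
  assumes "inj \<sigma>"
  shows "edge_expr \<alpha> ((`) \<sigma> ` E) = (\<Prod>e\<in>E. (\<alpha> (Min (\<sigma> ` e)) - \<alpha> (Max (\<sigma> ` e)))\<^sup>2)"
  unfolding edge_expr_def
  by (subst prod.reindex) (use assms in \<open>auto simp: inj_on_def inj_image_eq_iff\<close>)

lemma sqdiff_Min_Max: "(\<alpha> (Min {i, j}) - \<alpha> (Max {i, j}))\<^sup>2 = (\<alpha> i - \<alpha> j)\<^sup>2"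
  for \<alpha> :: "nat \<Rightarrow> 'a::comm_ring_1"
  by (auto simp: min_def max_def power2_commute)

text \<open>Summing over the whole symmetric group instead of an orbit allows the six arguments to
  be reindexed freely; repeated terms only contribute an integer factor.\<close>

definition sum6 :: "(nat \<Rightarrow> 'a) \<Rightarrow> ('a \<Rightarrow> 'a \<Rightarrow> 'a \<Rightarrow> 'a \<Rightarrow> 'a \<Rightarrow> 'a \<Rightarrow> 'b::comm_monoid_add) \<Rightarrow> 'b" where
  "sum6 \<alpha> f = (\<Sum>\<sigma> | \<sigma> permutes {1..6}. f (\<alpha> (\<sigma> 1)) (\<alpha> (\<sigma> 2)) (\<alpha> (\<sigma> 3)) (\<alpha> (\<sigma> 4)) (\<alpha> (\<sigma> 5)) (\<alpha> (\<sigma>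
    6)))"

lemma permutes_of_list6:
  assumes "{a1, a2, a3, a4, a5, a6} = {1..6::nat}"
  obtains \<rho> where "\<rho> permutes {1..6}" "\<rho> 1 = a1" "\<rho> 2 = a2" "\<rho> 3 = a3" "\<rho> 4 = a4" "\<rho> 5 = a5"
    "\<rho> 6 = a6"
proof
  define \<rho> where "\<rho> = (\<lambda>n. if n = 1 then a1 else if n = 2 then a2 else if n = 3 then a3
    else if n = 4 then a4 else if n = 5 then a5 else if n = 6 then a6 else n)"
  show v: "\<rho> 1 = a1" "\<rho> 2 = a2" "\<rho> 3 = a3" "\<rho> 4 = a4" "\<rho> 5 = a5" "\<rho> 6 = a6"
    by (simp_all add: \<rho>_def)
  have im: "\<rho> ` {1..6} = {1..6}"
    unfolding assms[symmetric] by (subst assms) (simp only: atLeastAtMost_1_6 image_insert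
      image_empty v)
  \<comment> \<open>Six values that fill a six-element set are distinct.\<close>
  then have "inj_on \<rho> {1..6}" by (intro eq_card_imp_inj_on) auto
  with im have "bij_betw \<rho> {1..6} {1..6}" by (simp add: bij_betw_def)
  then show "\<rho> permutes {1..6}" by (rule bij_imp_permutes) (auto simp: \<rho>_def)
qed

text \<open>Composing on the right with the permutation that takes 1, ..., 6 to the given positions
  permutes the range of summation.\<close>

lemma sum6_positions:
  assumes "{a1, a2, a3, a4, a5, a6} = {1..6::nat}"
  shows "sum6 \<alpha> f = (\<Sum>\<sigma> | \<sigma> permutes {1..6}. f (\<alpha> (\<sigma> a1)) (\<alpha> (\<sigma> a2)) (\<alpha> (\<sigma> a3)) (\<alpha> (\<sigma> a4)) (\<alpha> (\<sigma>
    a5)) (\<alpha> (\<sigma> a6)))"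
proof -
  from permutes_of_list6[OF assms] obtain \<rho> where
    \<rho>: "\<rho> permutes {1..6}" "\<rho> 1 = a1" "\<rho> 2 = a2" "\<rho> 3 = a3" "\<rho> 4 = a4" "\<rho> 5 = a5" "\<rho> 6 = a6" .
  show ?thesis unfolding sum6_def
    by (subst sum_permutations_compose_right[OF \<rho>(1)]) (simp only: o_apply \<rho>)
qed

section \<open>Sums over subsets of a given size\<close>

lemma sum_card_subsets_insert:
  assumes "finite S" "x \<notin> S"
  shows "(\<Sum>A | A \<subseteq> insert x S \<and> card A = Suc n. g A) =
    (\<Sum>A | A \<subseteq> S \<and> card A = Suc n. g A) + (\<Sum>A | A \<subseteq> S \<and> card A = n. g (insert x A))"
proof -
  have "{A. A \<subseteq> insert x S \<and> card A = Suc n} =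
    {A. A \<subseteq> S \<and> card A = Suc n} \<union> insert x ` {A. A \<subseteq> S \<and> card A = n}" (is "?L = ?R")
  proof
    show "?L \<subseteq> ?R"
    proof
      fix A assume A: "A \<in> ?L"
      show "A \<in> ?R"
      proof (cases "x \<in> A")
        case True
        then have "A = insert x (A - {x})" "A - {x} \<subseteq> S" "card (A - {x}) = n" using A by auto
        then show ?thesis by blast
      qed (use A in auto)
    qed
    show "?R \<subseteq> ?L" using assms by (auto simp: card_insert_if finite_subset)
  qed
  moreover have "inj_on (insert x) {A. A \<subseteq> S \<and> card A = n}"
    using assms by (auto simp: inj_on_def insert_ident subset_iff)
  moreover have "{A. A \<subseteq> S \<and> card A = Suc n} \<inter> insert x ` {A. A \<subseteq> S \<and> card A = n} = {}"
    using assms by auto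
  ultimately show ?thesis
    using assms by (simp add: sum.union_disjoint sum.reindex)
qed

lemma sum_card_subsets_0: "finite S \<Longrightarrow> (\<Sum>A | A \<subseteq> S \<and> card A = 0. g A) = g {}"
proof -
  assume "finite S"
  then have "{A. A \<subseteq> S \<and> card A = 0} = {{}}" by (auto dest: finite_subset)
  then show ?thesis by simp
qed

lemma sum_card_subsets_empty:
  fixes g :: "'a set \<Rightarrow> 'b::comm_monoid_add"
  shows "(\<Sum>A | A \<subseteq> {} \<and> card A = Suc n. g A) = 0"
proof -
  have "{A::'a set. A \<subseteq> {} \<and> card A = Suc n} = {}" by auto
  then show ?thesis by (simp only: sum.empty)
qed

lemma sum_subsets_empty:
  fixes g :: "'a set \<Rightarrow> 'b::comm_monoid_add"
  shows "(\<Sum>A | A = {} \<and> card A = 0. g A) = g {}" "(\<Sum>A | A = {} \<and> card A = Suc n. g A) = 0"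
  using sum_card_subsets_0[of "{}" g] sum_card_subsets_empty[of g n] by simp_all

text \<open>Pascal's recursion enumerates the twenty triples. Each is paired with its complement,
  because a splitting into two triples does not order them.\<close>

lemma sum_three_subsets_six:
  fixes g :: "nat set \<Rightarrow> 'b::comm_monoid_add"
  shows "(\<Sum>A | A \<subseteq> {1..6} \<and> card A = 3. g A) =
    (g {1,2,3} + g {4,5,6}) + (g {2,3,4} + g {1,5,6}) + (g {2,3,5} + g {1,4,6}) + (g {2,3,6}
      + g {1,4,5})
    + (g {1,3,4} + g {2,5,6}) + (g {1,3,5} + g {2,4,6}) + (g {1,3,6} + g {2,4,5})
    + (g {1,2,4} + g {3,5,6}) + (g {1,2,5} + g {3,4,6}) + (g {1,2,6} + g {3,4,5})"
proof -
  have 3: "3 = Suc (Suc (Suc 0))" by simp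
  show ?thesis
    unfolding atLeastAtMost_1_6 3
    by (simp add: sum_card_subsets_insert sum_card_subsets_0 sum_subsets_empty del: card_0_eq
      card_Suc_eq add_ac)
      (simp add: add_ac insert_commute)
qed

text \<open>A function of an unordered pair of unordered triples: adjacent transpositions generate
  the permutations of each triple.\<close>

locale cubic_pair_function =
  fixes f :: "'a \<Rightarrow> 'a \<Rightarrow> 'a \<Rightarrow> 'a \<Rightarrow> 'a \<Rightarrow> 'a \<Rightarrow> 'b::comm_semiring_1"
  assumes sym: "f x1 x2 x3 y1 y2 y3 = f x2 x1 x3 y1 y2 y3" "f x1 x2 x3 y1 y2 y3 = f x1 x3 x2 y1 y2
    y3"
    "f x1 x2 x3 y1 y2 y3 = f x1 x2 x3 y2 y1 y3" "f x1 x2 x3 y1 y2 y3 = f x1 x2 x3 y1 y3 y2"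
    and swap: "f x1 x2 x3 y1 y2 y3 = f y1 y2 y3 x1 x2 x3"
begin

text \<open>A permutation that preserves \<open>{1, 2, 3}\<close> also preserves its complement, so
  it acts on each triple separately; the six arrangements of a triple are checked one by
  one.\<close>

lemma invariant:
  assumes \<sigma>: "\<sigma> permutes {1..6::nat}" "\<sigma> ` {1, 2, 3} = {1, 2, 3}"
  shows "f (\<beta> (\<sigma> 1)) (\<beta> (\<sigma> 2)) (\<beta> (\<sigma> 3)) (\<beta> (\<sigma> 4)) (\<beta> (\<sigma> 5)) (\<beta> (\<sigma> 6)) = f (\<beta> 1) (\<beta> 2) (\<beta> 3) (\<beta> 4)
    (\<beta> 5) (\<beta> 6)"
proof -
  note inj = permutes_inj[OF \<sigma>(1)]
  have "\<sigma> ` {4, 5, 6} = \<sigma> ` ({1..6::nat} - {1, 2, 3})" by (rule arg_cong[of _ _ "(`) \<sigma>"]) auto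
  also have "\<dots> = {1..6::nat} - {1, 2, 3}"
    using \<sigma> by (simp only: image_set_diff[OF inj] permutes_image)
  also have "\<dots> = {4, 5, 6::nat}" by auto
  finally have y: "\<sigma> ` {4, 5, 6} = {4, 5, 6}" .
  have perm: "(p = a \<and> q = b \<and> r = c) \<or> (p = a \<and> q = c \<and> r = b) \<or> (p = b \<and> q = a \<and> r = c) \<or>
      (p = b \<and> q = c \<and> r = a) \<or> (p = c \<and> q = a \<and> r = b) \<or> (p = c \<and> q = b \<and> r = a)"
    if "{p, q, r} = {a, b, c}" "p \<noteq> q" "q \<noteq> r" "p \<noteq> r" for p q r a b c :: nat
    using that by (metis insert_iff singletonD)
  have ne: "\<sigma> 1 \<noteq> \<sigma> 2" "\<sigma> 2 \<noteq> \<sigma> 3" "\<sigma> 1 \<noteq> \<sigma> 3" "\<sigma> 4 \<noteq> \<sigma> 5" "\<sigma> 5 \<noteq> \<sigma> 6" "\<sigma> 4 \<noteq> \<sigma> 6"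
    by (simp_all add: inj_eq[OF inj])
  have fx: "f (\<beta> 1) (\<beta> 3) (\<beta> 2) y1 y2 y3 = f (\<beta> 1) (\<beta> 2) (\<beta> 3) y1 y2 y3"
    "f (\<beta> 2) (\<beta> 1) (\<beta> 3) y1 y2 y3 = f (\<beta> 1) (\<beta> 2) (\<beta> 3) y1 y2 y3"
    "f (\<beta> 2) (\<beta> 3) (\<beta> 1) y1 y2 y3 = f (\<beta> 1) (\<beta> 2) (\<beta> 3) y1 y2 y3"
    "f (\<beta> 3) (\<beta> 1) (\<beta> 2) y1 y2 y3 = f (\<beta> 1) (\<beta> 2) (\<beta> 3) y1 y2 y3"
    "f (\<beta> 3) (\<beta> 2) (\<beta> 1) y1 y2 y3 = f (\<beta> 1) (\<beta> 2) (\<beta> 3) y1 y2 y3" for y1 y2 y3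
    by (rule sym(2) sym(1) trans[OF sym(2) sym(1)] trans[OF sym(1) sym(2)]
      trans[OF sym(1) trans[OF sym(2) sym(1)]])+
  have fy: "f x1 x2 x3 (\<beta> 4) (\<beta> 6) (\<beta> 5) = f x1 x2 x3 (\<beta> 4) (\<beta> 5) (\<beta> 6)"
    "f x1 x2 x3 (\<beta> 5) (\<beta> 4) (\<beta> 6) = f x1 x2 x3 (\<beta> 4) (\<beta> 5) (\<beta> 6)"
    "f x1 x2 x3 (\<beta> 5) (\<beta> 6) (\<beta> 4) = f x1 x2 x3 (\<beta> 4) (\<beta> 5) (\<beta> 6)"
    "f x1 x2 x3 (\<beta> 6) (\<beta> 4) (\<beta> 5) = f x1 x2 x3 (\<beta> 4) (\<beta> 5) (\<beta> 6)"
    "f x1 x2 x3 (\<beta> 6) (\<beta> 5) (\<beta> 4) = f x1 x2 x3 (\<beta> 4) (\<beta> 5) (\<beta> 6)" for x1 x2 x3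
    by (rule sym(4) sym(3) trans[OF sym(4) sym(3)] trans[OF sym(3) sym(4)]
      trans[OF sym(3) trans[OF sym(4) sym(3)]])+
  have "f (\<beta> (\<sigma> 1)) (\<beta> (\<sigma> 2)) (\<beta> (\<sigma> 3)) y1 y2 y3 = f (\<beta> 1) (\<beta> 2) (\<beta> 3) y1 y2 y3" for y1 y2 y3
    using perm[of "\<sigma> 1" "\<sigma> 2" "\<sigma> 3" 1 2 3, OF \<sigma>(2)[unfolded image_insert image_empty] ne(1-3)]
    by (elim disjE conjE) (simp_all only: fx)
  moreover have "f x1 x2 x3 (\<beta> (\<sigma> 4)) (\<beta> (\<sigma> 5)) (\<beta> (\<sigma> 6)) = f x1 x2 x3 (\<beta> 4) (\<beta> 5) (\<beta> 6)" for x1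
    x2 x3
    using perm[of "\<sigma> 4" "\<sigma> 5" "\<sigma> 6" 4 5 6, OF y[unfolded image_insert image_empty] ne(4-6)]
    by (elim disjE conjE) (simp_all only: fy)
  ultimately show ?thesis by simp
qed

definition stab :: nat where
  "stab = card {\<sigma>. \<sigma> permutes {1..6::nat} \<and> \<sigma> ` {1, 2, 3} = {1, 2, 3}}"

lemma stab_pos: "stab > 0"
proof -
  have "{\<sigma>. \<sigma> permutes {1..6::nat} \<and> \<sigma> ` {1, 2, 3} = {1, 2, 3}} \<noteq> {}"
    using permutes_id by (auto intro!: exI[of _ id])
  moreover have "finite {\<sigma>. \<sigma> permutes {1..6::nat} \<and> \<sigma> ` {1, 2, 3} = {1, 2, 3}}"
    by (rule finite_subset[OF _ finite_permutations[of "{1..6::nat}"]]) auto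
  ultimately show ?thesis unfolding stab_def by (simp add: card_gt_0_iff)
qed

text \<open>The permutations taking \<open>{1, 2, 3}\<close> to a given triple form a coset of the
  stabilizer, and by \<open>invariant\<close> the summand is constant on it.\<close>

lemma fibre_sum:
  assumes "{a1, a2, a3, a4, a5, a6} = {1..6::nat}"
  shows "(\<Sum>\<sigma> | \<sigma> permutes {1..6} \<and> \<sigma> ` {1, 2, 3} = {a1, a2, a3}.
      f (\<alpha> (\<sigma> 1)) (\<alpha> (\<sigma> 2)) (\<alpha> (\<sigma> 3)) (\<alpha> (\<sigma> 4)) (\<alpha> (\<sigma> 5)) (\<alpha> (\<sigma> 6))) =
    of_nat stab * f (\<alpha> a1) (\<alpha> a2) (\<alpha> a3) (\<alpha> a4) (\<alpha> a5) (\<alpha> a6)" (is "?L = _")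
proof -
  from permutes_of_list6[OF assms] obtain \<rho> where
    \<rho>: "\<rho> permutes {1..6}" "\<rho> 1 = a1" "\<rho> 2 = a2" "\<rho> 3 = a3" "\<rho> 4 = a4" "\<rho> 5 = a5" "\<rho> 6 = a6" .
  have linv: "inv_into UNIV \<rho> \<circ> \<rho> = id" "\<rho> \<circ> inv_into UNIV \<rho> = id"
    using permutes_inv_o[OF \<rho>(1)] by auto
  have a: "\<rho> ` {1, 2, 3} = {a1, a2, a3}" using \<rho> by simp
  have "?L = (\<Sum>\<sigma> | \<sigma> permutes {1..6::nat} \<and> \<sigma> ` {1, 2, 3} = {1, 2, 3}.
      f (\<alpha> a1) (\<alpha> a2) (\<alpha> a3) (\<alpha> a4) (\<alpha> a5) (\<alpha> a6))"
  proof (rule sum.reindex_bij_witness[of _ "(\<circ>) \<rho>" "(\<circ>) (inv_into UNIV \<rho>)"])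
    fix \<sigma> assume \<sigma>: "\<sigma> \<in> {\<sigma>. \<sigma> permutes {1..6::nat} \<and> \<sigma> ` {1, 2, 3} = {a1, a2, a3}}"
    show "\<rho> \<circ> (inv_into UNIV \<rho> \<circ> \<sigma>) = \<sigma>" by (simp only: o_assoc linv id_o)
    have st: "(inv_into UNIV \<rho> \<circ> \<sigma>) ` {1, 2, 3} = {1, 2, 3}"
      using \<sigma> a linv(1) by (simp only: image_comp[symmetric] mem_Collect_eq)
        (metis image_comp image_id id_apply)
    moreover have p: "inv_into UNIV \<rho> \<circ> \<sigma> permutes {1..6}" using \<sigma> \<rho>(1) permutes_inv
      permutes_compose by blast
    ultimately show "inv_into UNIV \<rho> \<circ> \<sigma> \<in> {\<sigma>. \<sigma> permutes {1..6} \<and> \<sigma> ` {1, 2, 3} = {1, 2, 3}}" by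
      simp
    have "\<rho> ((inv_into UNIV \<rho> \<circ> \<sigma>) n) = \<sigma> n" for n using permutes_inverses[OF \<rho>(1)] by simp
    with invariant[OF p st, of "\<lambda>n. \<alpha> (\<rho> n)"] \<rho>
    show "f (\<alpha> a1) (\<alpha> a2) (\<alpha> a3) (\<alpha> a4) (\<alpha> a5) (\<alpha> a6) =
      f (\<alpha> (\<sigma> 1)) (\<alpha> (\<sigma> 2)) (\<alpha> (\<sigma> 3)) (\<alpha> (\<sigma> 4)) (\<alpha> (\<sigma> 5)) (\<alpha> (\<sigma> 6))"
      by metis
  next
    fix \<sigma> assume \<sigma>: "\<sigma> \<in> {\<sigma>. \<sigma> permutes {1..6::nat} \<and> \<sigma> ` {1, 2, 3} = {1, 2, 3}}"
    show "inv_into UNIV \<rho> \<circ> (\<rho> \<circ> \<sigma>) = \<sigma>" by (simp only: o_assoc linv id_o)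
    have "(\<rho> \<circ> \<sigma>) ` {1, 2, 3} = {a1, a2, a3}"
      using \<sigma> a by (simp only: image_comp[symmetric] mem_Collect_eq)
    with \<sigma> \<rho>(1) show "\<rho> \<circ> \<sigma> \<in> {\<sigma>. \<sigma> permutes {1..6} \<and> \<sigma> ` {1, 2, 3} = {a1, a2, a3}}"
      using permutes_compose by blast
  qed
  then show ?thesis by (simp add: stab_def)
qed

text \<open>The permutations are grouped by the image of \<open>{1, 2, 3}\<close>. Complementary
  images contribute equally by \<open>swap\<close>, so each of the ten splittings is counted
  \<open>2 * stab\<close> times.\<close>

lemma sum6_eq:
  "sum6 \<alpha> f = of_nat (2 * stab) * (f (\<alpha> 1) (\<alpha> 2) (\<alpha> 3) (\<alpha> 4) (\<alpha> 5) (\<alpha> 6) +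
     f (\<alpha> 2) (\<alpha> 3) (\<alpha> 4) (\<alpha> 1) (\<alpha> 5) (\<alpha> 6) + f (\<alpha> 2) (\<alpha> 3) (\<alpha> 5) (\<alpha> 1) (\<alpha> 4) (\<alpha> 6) + f (\<alpha> 2) (\<alpha> 3)
       (\<alpha> 6) (\<alpha> 1) (\<alpha> 4) (\<alpha> 5) +
     f (\<alpha> 1) (\<alpha> 3) (\<alpha> 4) (\<alpha> 2) (\<alpha> 5) (\<alpha> 6) + f (\<alpha> 1) (\<alpha> 3) (\<alpha> 5) (\<alpha> 2) (\<alpha> 4) (\<alpha> 6) + f (\<alpha> 1) (\<alpha> 3)
       (\<alpha> 6) (\<alpha> 2) (\<alpha> 4) (\<alpha> 5) +
     f (\<alpha> 1) (\<alpha> 2) (\<alpha> 4) (\<alpha> 3) (\<alpha> 5) (\<alpha> 6) + f (\<alpha> 1) (\<alpha> 2) (\<alpha> 5) (\<alpha> 3) (\<alpha> 4) (\<alpha> 6)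
       + f (\<alpha> 1) (\<alpha> 2) (\<alpha> 6) (\<alpha> 3) (\<alpha> 4) (\<alpha> 5))"
proof -
  define h where "h \<sigma> = f (\<alpha> (\<sigma> 1)) (\<alpha> (\<sigma> 2)) (\<alpha> (\<sigma> 3)) (\<alpha> (\<sigma> 4)) (\<alpha> (\<sigma> 5)) (\<alpha> (\<sigma> 6))" for \<sigma> ::
    "nat \<Rightarrow> nat"
  define g where "g A = (\<Sum>\<sigma> | \<sigma> permutes {1..6} \<and> \<sigma> ` {1, 2, 3} = A. h \<sigma>)" for A
  have g: "g {a1, a2, a3} + g {a4, a5, a6} = of_nat (2 * stab) * f (\<alpha> a1) (\<alpha> a2) (\<alpha> a3) (\<alpha> a4) (\<alpha>
    a5) (\<alpha> a6)"
    if a: "{a1, a2, a3, a4, a5, a6} = {1..6}" for a1 a2 a3 a4 a5 a6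
  proof -
    have a': "{a4, a5, a6, a1, a2, a3} = {1..6}" using a by (simp add: insert_commute)
    have "g {a4, a5, a6} = of_nat stab * f (\<alpha> a4) (\<alpha> a5) (\<alpha> a6) (\<alpha> a1) (\<alpha> a2) (\<alpha> a3)"
      unfolding g_def h_def by (rule fibre_sum[OF a'])
    also have "\<dots> = of_nat stab * f (\<alpha> a1) (\<alpha> a2) (\<alpha> a3) (\<alpha> a4) (\<alpha> a5) (\<alpha> a6)"
      using swap by metis
    finally show ?thesis
      unfolding g_def h_def using fibre_sum[OF a, of \<alpha>] by (simp add: algebra_simps flip: mult_2)
  qed
  have fin: "finite {\<sigma>. \<sigma> permutes {1..6::nat}}" by (simp add: finite_permutations)
  have "sum6 \<alpha> f = (\<Sum>\<sigma>\<in>{\<sigma>. \<sigma> permutes {1..6}}. h \<sigma>)" by (simp add: sum6_def h_def)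
  also have "\<dots> = (\<Sum>A | A \<subseteq> {1..6} \<and> card A = 3. \<Sum>\<sigma> | \<sigma> \<in> {\<sigma>. \<sigma> permutes {1..6}} \<and> \<sigma> ` {1, 2, 3} =
    A. h \<sigma>)"
  proof (rule sum.group[symmetric, OF fin])
    show "(\<lambda>\<sigma>. \<sigma> ` {1, 2, 3}) ` {\<sigma>. \<sigma> permutes {1..6}} \<subseteq> {A. A \<subseteq> {1..6::nat} \<and> card A = 3}"
    proof (rule image_subsetI, rule CollectI, rule conjI)
      fix \<sigma> assume "\<sigma> \<in> {\<sigma>. \<sigma> permutes {1..6::nat}}"
      then have s: "\<sigma> permutes {1..6}" by simp
      have "\<sigma> ` {1, 2, 3} \<subseteq> \<sigma> ` {1..6}" by (rule image_mono) auto
      with permutes_image[OF s] show "\<sigma> ` {1, 2, 3} \<subseteq> {1..6}" by blast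
      have "card (\<sigma> ` {1, 2, 3}) = card {1, 2, 3::nat}"
        by (rule card_image[OF inj_on_subset[OF permutes_inj[OF s]]]) simp
      then show "card (\<sigma> ` {1, 2, 3}) = 3" by simp
    qed
  qed simp
  also have "\<dots> = (\<Sum>A | A \<subseteq> {1..6} \<and> card A = 3. g A)" by (simp add: g_def)
  finally have sum: "sum6 \<alpha> f = (\<Sum>A | A \<subseteq> {1..6} \<and> card A = 3. g A)" .
  have parts:
    "g {1, 2, 3} + g {4, 5, 6} = of_nat (2 * stab) * f (\<alpha> 1) (\<alpha> 2) (\<alpha> 3) (\<alpha> 4) (\<alpha> 5) (\<alpha> 6)"
    "g {2, 3, 4} + g {1, 5, 6} = of_nat (2 * stab) * f (\<alpha> 2) (\<alpha> 3) (\<alpha> 4) (\<alpha> 1) (\<alpha> 5) (\<alpha> 6)"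
    "g {2, 3, 5} + g {1, 4, 6} = of_nat (2 * stab) * f (\<alpha> 2) (\<alpha> 3) (\<alpha> 5) (\<alpha> 1) (\<alpha> 4) (\<alpha> 6)"
    "g {2, 3, 6} + g {1, 4, 5} = of_nat (2 * stab) * f (\<alpha> 2) (\<alpha> 3) (\<alpha> 6) (\<alpha> 1) (\<alpha> 4) (\<alpha> 5)"
    "g {1, 3, 4} + g {2, 5, 6} = of_nat (2 * stab) * f (\<alpha> 1) (\<alpha> 3) (\<alpha> 4) (\<alpha> 2) (\<alpha> 5) (\<alpha> 6)"
    "g {1, 3, 5} + g {2, 4, 6} = of_nat (2 * stab) * f (\<alpha> 1) (\<alpha> 3) (\<alpha> 5) (\<alpha> 2) (\<alpha> 4) (\<alpha> 6)"
    "g {1, 3, 6} + g {2, 4, 5} = of_nat (2 * stab) * f (\<alpha> 1) (\<alpha> 3) (\<alpha> 6) (\<alpha> 2) (\<alpha> 4) (\<alpha> 5)"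
    "g {1, 2, 4} + g {3, 5, 6} = of_nat (2 * stab) * f (\<alpha> 1) (\<alpha> 2) (\<alpha> 4) (\<alpha> 3) (\<alpha> 5) (\<alpha> 6)"
    "g {1, 2, 5} + g {3, 4, 6} = of_nat (2 * stab) * f (\<alpha> 1) (\<alpha> 2) (\<alpha> 5) (\<alpha> 3) (\<alpha> 4) (\<alpha> 6)"
    "g {1, 2, 6} + g {3, 4, 5} = of_nat (2 * stab) * f (\<alpha> 1) (\<alpha> 2) (\<alpha> 6) (\<alpha> 3) (\<alpha> 4) (\<alpha> 5)"
    by (rule g; auto)+
  show ?thesis
    unfolding sum sum_three_subsets_six using parts by (simp only: distrib_left)
qed

end

section \<open>Splittings of the roots of two cubics\<close>

text \<open>The discriminant of the monic cubic with roots \<open>x\<close>, \<open>y\<close>,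
  \<open>z\<close>.\<close>

definition triangle :: "'a::comm_ring_1 \<Rightarrow> 'a \<Rightarrow> 'a \<Rightarrow> 'a" where
  "triangle x y z = (x - y)^2 * (y - z)^2 * (z - x)^2"

definition matching :: "'a::comm_ring_1 \<Rightarrow> 'a \<Rightarrow> 'a \<Rightarrow> 'a \<Rightarrow> 'a \<Rightarrow> 'a \<Rightarrow> 'a" where
  "matching x1 x2 x3 y1 y2 y3 = (x1 - y1)^2 * (x2 - y2)^2 * (x3 - y3)^2"

text \<open>All six bijections between the triples are summed, which makes the expression symmetric
  within each triple, unlike a single \<open>matching\<close>.\<close>

definition matchings :: "'a::comm_ring_1 \<Rightarrow> 'a \<Rightarrow> 'a \<Rightarrow> 'a \<Rightarrow> 'a \<Rightarrow> 'a \<Rightarrow> 'a" where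
  "matchings x1 x2 x3 y1 y2 y3 = matching x1 x2 x3 y1 y2 y3 + matching x1 x2 x3 y1 y3 y2
    + matching x1 x2 x3 y2 y1 y3 + matching x1 x2 x3 y2 y3 y1
    + matching x1 x2 x3 y3 y1 y2 + matching x1 x2 x3 y3 y2 y1"

text \<open>\<open>p2\<close>, \<open>p1\<close>, \<open>p0\<close> and \<open>q2\<close>,
  \<open>q1\<close>, \<open>q0\<close> are the lower coefficients of the monic cubics whose roots
  are the two triples.\<close>

lemma matchings_elementary:
  fixes x1 x2 x3 y1 y2 y3 :: "'a::idom"
  assumes "p2 = - (x1 + x2 + x3)" "p1 = x1 * x2 + x1 * x3 + x2 * x3" "p0 = - (x1 * x2 * x3)"
    and "q2 = - (y1 + y2 + y3)" "q1 = y1 * y2 + y1 * y3 + y2 * y3" "q0 = - (y1 * y2 * y3)"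
  shows "matchings x1 x2 x3 y1 y2 y3 = 16*p1*q2*q0 + 16*p2*p0*q1 + 6*q0^2 + 6*p0*q2*q1 + 6*p0^2
    + 6*p2*p1*q0 + 2*p1^2*q2^2 + 2*p2^2*q1^2 - 2*p2*p1*q2*q1 - 4*p1*q1^2 - 4*p1*p0*q2 - 4*p1^2*q1
    - 4*p2*q1*q0 - 4*p2*p0*q2^2 - 4*p2^2*q2*q0 - 66*p0*q0"
  unfolding assms matchings_def matching_def by Groebner_Basis.algebra

lemma triangle_elementary:
  fixes x1 x2 x3 :: "'a::idom"
  assumes "p2 = - (x1 + x2 + x3)" "p1 = x1 * x2 + x1 * x3 + x2 * x3" "p0 = - (x1 * x2 * x3)"
  shows "triangle x1 x2 x3 = p2^2*p1^2 - 4*p1^3 - 4*p2^3*p0 - 27*p0^2 + 18*p2*p1*p0"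
  unfolding assms triangle_def by Groebner_Basis.algebra

text \<open>The shape of a remainder modulo one cubic in \<open>x\<close> and one cubic in
  \<open>y\<close>.\<close>

definition biquad :: "'a::comm_ring_1 \<Rightarrow> 'a \<Rightarrow> 'a \<Rightarrow> 'a \<Rightarrow> 'a \<Rightarrow> 'a \<Rightarrow> 'a \<Rightarrow> 'a \<Rightarrow> 'a \<Rightarrow> 'a \<Rightarrow> 'a \<Rightarrow> 'a" where
  "biquad c00 c01 c02 c10 c11 c12 c20 c21 c22 x y = c00 + c01 * y + c02 * y^2
    + (c10 + c11 * y + c12 * y^2) * x + (c20 + c21 * y + c22 * y^2) * x^2"

definition grid_sum :: "('a \<Rightarrow> 'a \<Rightarrow> 'b::comm_monoid_add) \<Rightarrow> 'a \<Rightarrow> 'a \<Rightarrow> 'a \<Rightarrow> 'a \<Rightarrow> 'a \<Rightarrow> 'a \<Rightarrow> 'b" where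
  "grid_sum f x1 x2 x3 y1 y2 y3 = f x1 y1 + f x1 y2 + f x1 y3 + f x2 y1 + f x2 y2 + f x2 y3
    + f x3 y1 + f x3 y2 + f x3 y3"

text \<open>The sum of \<open>x^i * y^j\<close> over the nine pairs of roots is the product of two
  power sums, those of exponent 0 being 3.\<close>

lemma grid_sum_biquad:
  fixes x1 x2 x3 y1 y2 y3 :: "'a::idom"
  assumes "x1 + x2 + x3 = P1" "x1^2 + x2^2 + x3^2 = P2" "y1 + y2 + y3 = Q1" "y1^2 + y2^2
    + y3^2 = Q2"
  shows "grid_sum (biquad c00 c01 c02 c10 c11 c12 c20 c21 c22) x1 x2 x3 y1 y2 y3 =
    9 * c00 + 3 * c01 * Q1 + 3 * c02 * Q2 + (3 * c10 + c11 * Q1 + c12 * Q2) * P1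
    + (3 * c20 + c21 * Q1 + c22 * Q2) * P2"
  unfolding assms[symmetric] grid_sum_def biquad_def by Groebner_Basis.algebra

text
  \<open>Normal forms modulo \<open>x\<^sup>3 + b x\<^sup>2 + a x + 1\<close> and \<open>y\<^sup>3 + 2 b y\<^sup>2 + b\<^sup>2 y
    + 4\<close>, the reversals of \<open>F\<close> and \<open>G\<close>: if \<open>x, p, q\<close> are the roots of the first and \<open>y, r, s\<close>
    those of the second, they give the value of an invariant at the splitting \<open>{p, q, y}, {x, r,
    s}\<close>. The large cofactors in the proofs below are the quotients of the divisions by these two
    cubics.\<close>

definition triangle_x_form :: "'a::comm_ring_1 \<Rightarrow> 'a \<Rightarrow> 'a \<Rightarrow> 'a \<Rightarrow> 'a" where
  "triangle_x_form a b x y = a^2 * b^2 - 4 * a^3 - 4 * a^2 * b * x - 8 * a^2 * b * y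
    - 4 * a^2 * x^2 - 8 * a^2 * y^2 + a * b^3 * x + 2 * a * b^3 * y + a * b^2 * x^2
    - 6 * a * b^2 * x * y + 2 * a * b^2 * y^2 - 8 * a * b * x^2 * y - 7 * a * b * x * y^2
    + 6 * a * b - 9 * a * x^2 * y^2 + 12 * a * x + 24 * a * y - b^3 - 7 * b^2 * x - 8 * b^2 * y
    - 6 * b * x^2 + 18 * b * x * y - 3 * b * y^2 + 18 * x^2 * y + 9 * x * y^2 - 27"

definition triangle_y_form :: "'a::comm_ring_1 \<Rightarrow> 'a \<Rightarrow> 'a \<Rightarrow> 'a \<Rightarrow> 'a" where
  "triangle_y_form a b x y = 6 * a * b^2 * x * y + 4 * a * b * x^2 * y + 5 * a * b * x * y^2
    + 3 * a * x^2 * y^2 - 24 * a * x + 16 * b^3 + 64 * b^2 * x + 38 * b^2 * y + 48 * b * x^2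
    + 84 * b * x * y + 21 * b * y^2 + 36 * x^2 * y + 27 * x * y^2 - 72"

definition matchings_form :: "'a::comm_ring_1 \<Rightarrow> 'a \<Rightarrow> 'a \<Rightarrow> 'a \<Rightarrow> 'a" where
  "matchings_form a b = biquad (4 * a^2 * b^2 - 8 * a * b^4 + 152 * a * b + 2 * b^6 - 32 * b^3
    - 342) (8 * a^2 * b - 4 * a * b^3 - 12 * a + 16 * b^2) (8 * a^2 - 4 * a * b^2
    + 12 * b) (8 * a * b^3 - 48 * a - 56 * b^2) (24 * a * b^2 - 6 * b^4 - 54 * b) (18 * a * b
    - 6 * b^3) (4 * b^4 - 108 * b) (4 * a * b + 2 * b^3 - 90) (6 * a - 2 * b^2)"

definition triangles_form :: "'a::comm_ring_1 \<Rightarrow> 'a \<Rightarrow> 'a \<Rightarrow> 'a \<Rightarrow> 'a" where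
  "triangles_form a b = biquad (192 * a^3 - 64 * a^3 * b^3 + 16 * a^2 * b^5 + 744 * a^2 * b^2
    - 104 * a * b^4 - 4536 * a * b - 16 * b^6 + 696 * b^3 + 5184) (38 * a^2 * b^4
    - 128 * a^3 * b^2 + 1188 * a^2 * b - 2 * a * b^6 - 174 * a * b^3 - 2592 * a
    - 10 * b^5) (21 * a^2 * b^3 - 64 * a^3 * b + 432 * a^2 - 2 * a * b^5 - 36 * a * b^2 + 2 * b^4
    - 513 * b) (24 * a^3 * b^2 - 72 * a^2 * b^4 - 432 * a^2 * b + 16 * a * b^6 + 960 * a * b^3
    - 648 * a - 176 * b^5 - 1080 * b^2) (6 * a^3 * b^4 - 28 * a^3 * b - 2 * a^2 * b^6
    - 276 * a^2 * b^3 - 540 * a^2 + 76 * a * b^5 + 3042 * a * b^2 - 610 * b^4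
    - 4644 * b) (5 * a^3 * b^3 - 48 * a^3 - 2 * a^2 * b^5 - 159 * a^2 * b^2 + 56 * a * b^4
    + 1539 * a * b - 390 * b^3 - 2025) (8 * a^3 * b - 72 * a^2 * b^3 - 216 * a^2 + 16 * a * b^5
    + 936 * a * b^2 - 160 * b^4 - 1728 * b) (2 * a^3 * b^3 - 12 * a^3 - 2 * a^2 * b^5
    - 222 * a^2 * b^2 + 86 * a * b^4 + 2268 * a * b - 624 * b^3 - 3240) (a^3 * b^2 - 2 * a^2 * b^4
    - 108 * a^2 * b + 66 * a * b^3 + 891 * a - 432 * b^2)"

definition triangle_matchings_form :: "'a::comm_ring_1 \<Rightarrow> 'a \<Rightarrow> 'a \<Rightarrow> 'a \<Rightarrow> 'a" where
  "triangle_matchings_form a b x y = 16 * a^3 * b^4 * x * y + 8 * a^3 * b^3 * x^2 * y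
    + 14 * a^3 * b^3 * x * y^2 + 6 * a^3 * b^2 * x^2 * y^2 - 32 * a^3 * b * x^2
    + 200 * a^3 * b * x * y - 24 * a^3 * x^2 * y + 96 * a^3 * x * y^2 - 50 * a^2 * b^6 * x * y
    - 34 * a^2 * b^5 * x^2 * y - 42 * a^2 * b^5 * x * y^2 + 64 * a^2 * b^5
    - 26 * a^2 * b^4 * x^2 * y^2 + 184 * a^2 * b^4 * x + 144 * a^2 * b^4 * y - 8 * a^2 * b^3 * x^2
    + 814 * a^2 * b^3 * x * y + 78 * a^2 * b^3 * y^2 + 422 * a^2 * b^2 * x^2 * y
    + 704 * a^2 * b^2 * x * y^2 - 704 * a^2 * b^2 + 336 * a^2 * b * x^2 * y^2 - 4008 * a^2 * b * x
    - 696 * a^2 * b * y - 72 * a^2 * x^2 - 288 * a^2 * x * y - 288 * a^2 * y^2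
    + 12 * a * b^8 * x * y + 8 * a * b^7 * x^2 * y + 10 * a * b^7 * x * y^2 - 128 * a * b^7
    + 6 * a * b^6 * x^2 * y^2 - 496 * a * b^6 * x - 306 * a * b^6 * y - 320 * a * b^5 * x^2
    - 760 * a * b^5 * x * y - 170 * a * b^5 * y^2 - 304 * a * b^4 * x^2 * y
    - 334 * a * b^4 * x * y^2 + 3000 * a * b^4 - 46 * a * b^3 * x^2 * y^2 + 12064 * a * b^3 * x
    + 5734 * a * b^3 * y + 8256 * a * b^2 * x^2 + 13764 * a * b^2 * x * y + 3162 * a * b^2 * y^2
    + 6336 * a * b * x^2 * y + 3906 * a * b * x * y^2 - 8712 * a * b + 54 * a * x^2 * y^2
    + 3024 * a * x + 1080 * a * y + 32 * b^9 + 128 * b^8 * x + 76 * b^8 * y + 96 * b^7 * x^2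
    + 174 * b^7 * x * y + 42 * b^7 * y^2 + 78 * b^6 * x^2 * y + 60 * b^6 * x * y^2 - 720 * b^6
    + 6 * b^5 * x^2 * y^2 - 2728 * b^5 * x - 1334 * b^5 * y - 2152 * b^4 * x^2
    - 3690 * b^4 * x * y - 722 * b^4 * y^2 - 1914 * b^3 * x^2 * y - 1308 * b^3 * x * y^2
    - 504 * b^3 - 288 * b^2 * x^2 * y^2 - 11592 * b^2 * x - 6570 * b^2 * y - 6696 * b * x^2
    - 17928 * b * x * y - 3726 * b * y^2 - 5832 * x^2 * y - 5994 * x * y^2 + 14904"

definition prism_form :: "'a::comm_ring_1 \<Rightarrow> 'a \<Rightarrow> 'a \<Rightarrow> 'a \<Rightarrow> 'a" where
  "prism_form a b = biquad (2816 * a^5 * b^2 - 256 * a^5 * b^5 + 576 * a^4 * b^7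
    - 9856 * a^4 * b^4 + 2592 * a^4 * b - 256 * a^3 * b^9 - 728 * a^3 * b^6 + 119896 * a^3 * b^3
    + 31968 * a^3 + 32 * a^2 * b^11 + 1616 * a^2 * b^8 - 13496 * a^2 * b^5 - 852120 * a^2 * b^2
    - 80 * a * b^10 - 12464 * a * b^7 + 264744 * a * b^4 + 1658232 * a * b - 32 * b^12
    + 1968 * b^9 - 13664 * b^6 - 328536 * b^3 - 1043928) (3584 * a^5 * b - 512 * a^5 * b^4
    + 1168 * a^4 * b^6 - 17088 * a^4 * b^3 - 17856 * a^4 - 566 * a^3 * b^8 + 1070 * a^3 * b^5
    + 196224 * a^3 * b^2 + 92 * a^2 * b^10 + 1970 * a^2 * b^7 - 56038 * a^2 * b^4
    - 606960 * a^2 * b - 4 * a * b^12 - 204 * a * b^9 - 1126 * a * b^6 + 145062 * a * b^3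
    + 561816 * a - 20 * b^11 + 592 * b^8 + 474 * b^5 - 62046 * b^2) (1536 * a^5 - 256 * a^5 * b^3
    + 590 * a^4 * b^5 - 8848 * a^4 * b^2 - 302 * a^3 * b^7 + 2222 * a^3 * b^4 + 67464 * a^3 * b
    + 58 * a^2 * b^9 + 70 * a^2 * b^6 - 22332 * a^2 * b^3 - 77112 * a^2 - 4 * a * b^11
    - 24 * a * b^8 + 4586 * a * b^5 - 57942 * a * b^2 + 4 * b^10 - 866 * b^7 + 15678 * b^4
    + 82134 * b) (64 * a^5 * b^4 + 32 * a^5 * b - 472 * a^4 * b^6 + 4584 * a^4 * b^3 - 576 * a^4
    + 688 * a^3 * b^8 - 6064 * a^3 * b^5 - 93504 * a^3 * b^2 - 272 * a^2 * b^10 - 3736 * a^2 * b^7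
    + 184832 * a^2 * b^4 - 8856 * a^2 * b + 32 * a * b^12 + 2688 * a * b^9 - 60640 * a * b^6
    - 290448 * a * b^3 + 206064 * a - 352 * b^11 + 4720 * b^8 + 69576 * b^5
    + 121176 * b^2) (16 * a^5 * b^6 - 64 * a^5 * b^3 - 192 * a^5 - 54 * a^4 * b^8
    + 178 * a^4 * b^5 + 512 * a^4 * b^2 + 28 * a^3 * b^10 + 1932 * a^3 * b^7 - 33256 * a^3 * b^4
    - 118512 * a^3 * b - 4 * a^2 * b^12 - 1094 * a^2 * b^9 - 3824 * a^2 * b^6 + 547314 * a^2 * b^3
    + 121176 * a^2 + 152 * a * b^11 + 7880 * a * b^8 - 185692 * a * b^5 - 1273428 * a * b^2
    - 1196 * b^10 + 13570 * b^7 + 272934 * b^4 + 900072 * b) (14 * a^5 * b^5 - 144 * a^5 * b^2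
    - 46 * a^4 * b^7 + 608 * a^4 * b^4 - 3816 * a^4 * b + 26 * a^3 * b^9 + 902 * a^3 * b^6
    - 22024 * a^3 * b^3 - 4752 * a^3 - 4 * a^2 * b^11 - 700 * a^2 * b^8 + 2338 * a^2 * b^5
    + 269622 * a^2 * b^2 + 112 * a * b^10 + 3938 * a * b^7 - 111366 * a * b^4 - 607986 * a * b
    - 756 * b^9 + 10016 * b^6 + 147420 * b^3 + 400950) (16 * a^5 * b^3 + 96 * a^5
    - 344 * a^4 * b^5 + 2840 * a^4 * b^2 + 656 * a^3 * b^7 - 7408 * a^3 * b^4 - 58032 * a^3 * b
    - 272 * a^2 * b^9 - 3048 * a^2 * b^6 + 168576 * a^2 * b^3 + 70632 * a^2 + 32 * a * b^11
    + 2512 * a * b^8 - 50992 * a * b^5 - 424224 * a * b^2 - 320 * b^10 + 2848 * b^7 + 89928 * b^4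
    + 293544 * b) (4 * a^5 * b^5 - 22 * a^4 * b^7 - 386 * a^4 * b^4 + 2880 * a^4 * b
    + 20 * a^3 * b^9 + 1692 * a^3 * b^6 - 30724 * a^3 * b^3 - 21600 * a^3 - 4 * a^2 * b^11
    - 1066 * a^2 * b^8 + 2920 * a^2 * b^5 + 396306 * a^2 * b^2 + 172 * a * b^10 + 6148 * a * b^7
    - 172224 * a * b^4 - 933120 * a * b - 1224 * b^9 + 16274 * b^6 + 237330 * b^3
    + 641520) (2 * a^5 * b^4 + 16 * a^5 * b - 14 * a^4 * b^6 - 220 * a^4 * b^3 + 2088 * a^4
    + 18 * a^3 * b^8 + 750 * a^3 * b^5 - 16404 * a^3 * b^2 - 4 * a^2 * b^10 - 678 * a^2 * b^7
    + 7006 * a^2 * b^4 + 159840 * a^2 * b + 132 * a * b^9 + 2682 * a * b^6 - 111690 * a * b^3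
    - 195858 * a - 840 * b^8 + 14970 * b^5 + 95580 * b^2)"

context
  fixes a b x p q y r s :: "'a::idom"
  assumes x: "x^3 + b*x^2 + a*x + 1 = 0" and pq: "p + q = - (b + x)" "p * q = x^2 + b*x + a"
    and y: "y^3 + 2*b*y^2 + b^2*y + 4 = 0" and rs: "r + s = - (2*b + y)" "r * s = y^2 + 2*b*y + b^2"
begin

lemma triangle_x: "triangle p q y = triangle_x_form a b x y"
proof -
  \<comment> \<open>\<open>(p - q)^2\<close> and \<open>(y - p) * (y - q)\<close> depend on
    \<open>p\<close> and \<open>q\<close> only through their sum and product, which are polynomials
    in \<open>x\<close>.\<close>
  have "triangle p q y = ((p + q)^2 - 4 * (p * q)) * (y^2 - (p + q) * y + p * q)^2"
    unfolding triangle_def by Groebner_Basis.algebra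
  also have "\<dots> = triangle_x_form a b x y + (b^3 - 6 * a * b - 7 * a * x - 8 * a * y - b^2 * x
    - 2 * b^2 * y - 5 * b * x^2 - 10 * b * x * y - 9 * b * y^2 - 3 * x^3 - 6 * x^2 * y
    - 9 * x * y^2 - 6 * y^3 + 3) * (x^3 + b*x^2 + a*x + 1) + (2 * b^2 * x - 2 * a * x - 4 * a * y
    + b^2 * y + 2 * b * x^2 - 2 * b * x * y - 3 * x^2 * y + 6) * (y^3 + 2*b*y^2 + b^2*y + 4)"
    unfolding pq triangle_x_form_def by Groebner_Basis.algebra
  finally show ?thesis by (simp only: x y mult_zero_right add_0_right)
qed

lemma triangle_y: "triangle x r s = triangle_y_form a b x y"
proof -
  have "triangle x r s = ((r + s)^2 - 4 * (r * s)) * (x^2 - (r + s) * x + r * s)^2"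
    unfolding triangle_def by Groebner_Basis.algebra
  also have "\<dots> = triangle_y_form a b x y + (-(12 * b^2 * y + 4 * b * x * y + 17 * b * y^2
    + 3 * x * y^2 + 6 * y^3)) * (x^3 + b*x^2 + a*x + 1) + (6 * a * x - 4 * b^3 - 16 * b^2 * x
    - 11 * b^2 * y - 12 * b * x^2 - 20 * b * x * y - 10 * b * y^2 - 9 * x^2 * y - 6 * x * y^2
    - 3 * y^3 + 18) * (y^3 + 2*b*y^2 + b^2*y + 4)"
    unfolding rs triangle_y_form_def by Groebner_Basis.algebra
  finally show ?thesis by (simp only: x y mult_zero_right add_0_right)
qed

lemma matchings_swap: "matchings p q y x r s = matchings_form a b x y"
proof -
  \<comment> \<open>The elementary symmetric functions of the two triples are written in terms of
    \<open>p + q\<close>, \<open>p * q\<close>, \<open>r + s\<close>, \<open>r * s\<close>, which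
    \<open>pq\<close> and \<open>rs\<close> then replace by polynomials in \<open>x\<close> and
    \<open>y\<close>.\<close>
  have "matchings p q y x r s = 16*(p * q + (p + q) * y)*(-(x + (r + s)))*(-(x * (r * s)))
    + 16*(-((p + q) + y))*(-(p * q * y))*(x * (r + s) + r * s) + 6*(-(x * (r * s)))^2
    + 6*(-(p * q * y))*(-(x + (r + s)))*(x * (r + s) + r * s) + 6*(-(p * q * y))^2 + 6*(-((p + q)
    + y))*(p * q + (p + q) * y)*(-(x * (r * s))) + 2*(p * q + (p + q) * y)^2*(-(x + (r + s)))^2
    + 2*(-((p + q) + y))^2*(x * (r + s) + r * s)^2 - 2*(-((p + q) + y))*(p * q + (p + q) * y)*(-(x
    + (r + s)))*(x * (r + s) + r * s) - 4*(p * q + (p + q) * y)*(x * (r + s) + r * s)^2 - 4*(p * q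
    + (p + q) * y)*(-(p * q * y))*(-(x + (r + s))) - 4*(p * q + (p + q) * y)^2*(x * (r + s)
    + r * s) - 4*(-((p + q) + y))*(x * (r + s) + r * s)*(-(x * (r * s))) - 4*(-((p + q)
    + y))*(-(p * q * y))*(-(x + (r + s)))^2 - 4*(-((p + q) + y))^2*(-(x + (r
    + s)))*(-(x * (r * s))) - 66*(-(p * q * y))*(-(x * (r * s)))"
    by (rule matchings_elementary) (simp_all add: algebra_simps)
  also have "\<dots> = matchings_form a b x y + (2 * a * x - 4 * a * y - 16 * b^3 + 8 * b^2 * x
    - 102 * b^2 * y - 2 * b * x^2 + 30 * b * x * y - 192 * b * y^2 + 2 * x^3 - 6 * x^2 * y
    + 24 * x * y^2 - 94 * y^3 - 2) * (x^3 + b*x^2 + a*x + 1) + (12 * a * x - 38 * a * b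
    + 4 * a * y + 12 * b^3 + 12 * b^2 * x + 28 * b * x^2 + 6 * b * x * y + 2 * b * y^2
    + 24 * x^2 * y - 6 * x * y^2 + 2 * y^3 + 86) * (y^3 + 2*b*y^2 + b^2*y + 4)"
    unfolding pq rs matchings_form_def biquad_def by Groebner_Basis.algebra
  finally show ?thesis by (simp only: x y mult_zero_right add_0_right)
qed

lemma triangles_swap: "triangle p q y * triangle x r s = triangles_form a b x y"
proof -
  have "triangle p q y * triangle x r s = triangles_form a b x y + (96 * a^3 - 24 * a^3 * b^2 * y
    - 16 * a^3 * b * x * y - 20 * a^3 * b * y^2 - 12 * a^3 * x * y^2 + 6 * a^2 * b^4 * y
    + 4 * a^2 * b^3 * x * y - 35 * a^2 * b^3 * y^2 - 29 * a^2 * b^2 * x * y^2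
    - 80 * a^2 * b^2 * y^3 - 280 * a^2 * b^2 - 60 * a^2 * b * x * y^3 - 192 * a^2 * b * x
    - 39 * a^2 * b * y^4 - 96 * a^2 * b * y - 27 * a^2 * x * y^4 - 144 * a^2 * x * y
    + 144 * a^2 * y^2 + 64 * a * b^4 + 48 * a * b^3 * x - 372 * a * b^3 * y
    - 372 * a * b^2 * x * y - 978 * a * b^2 * y^2 - 666 * a * b * x * y^2 - 774 * a * b * y^3
    + 720 * a * b - 270 * a * x * y^3 - 216 * a * y^4 - 432 * b^3 - 288 * b^2 * x + 612 * b^2 * y
    + 648 * b * x * y + 1782 * b * y^2 + 648 * x * y^2 + 810 * y^3) * (x^3 + b*x^2 + a*x + 1)
    + (3 * a^3 * x^2 * y - 6 * a^3 * b^2 * x - 2 * a^3 * b * x^2 - a^3 * b * x * y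
    + 2 * a^2 * b^4 * x + 2 * a^2 * b^3 * x^2 + 10 * a^2 * b^3 * x * y + 10 * a^2 * b^2 * x^2 * y
    - 134 * a^2 * b^2 + 12 * a^2 * b * x - 129 * a^2 * b * y + 54 * a^2 * x^2 + 27 * a^2 * x * y
    + 34 * a * b^4 - 12 * a * b^3 * x + 42 * a * b^3 * y - 54 * a * b^2 * x^2
    - 108 * a * b^2 * x * y - 126 * a * b * x^2 * y + 846 * a * b + 108 * a * x + 216 * a * y
    - 156 * b^3 + 36 * b^2 * x - 63 * b^2 * y + 216 * b * x^2 + 108 * b * x * y + 243 * x^2 * y
    - 810) * (y^3 + 2*b*y^2 + b^2*y + 4)"
    unfolding triangle_x triangle_y triangle_x_form_def triangle_y_form_def triangles_form_def
      biquad_def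
    by Groebner_Basis.algebra
  then show ?thesis by (simp only: x y mult_zero_right add_0_right)
qed

lemma prism_swap:
  "triangle p q y * triangle x r s * matchings p q y x r s = prism_form a b x y"
proof -
  \<comment> \<open>The triple product is reduced in two stages: two factors are brought to normal
    form before the third is multiplied in.\<close>
  have "triangle x r s * matchings p q y x r s = triangle_matchings_form a b x y
    + (32 * a^2 * b^4 * y + 128 * a^2 * b^3 * y^2 + 16 * a^2 * b^2 * x * y^2
    + 164 * a^2 * b^2 * y^3 + 36 * a^2 * b * x * y^3 + 66 * a^2 * b * y^4 - 288 * a^2 * b * y
    + 18 * a^2 * x * y^4 - 288 * a^2 * y^2 + 8 * a * b^6 * y + 16 * a * b^5 * x * y
    - 12 * a * b^5 * y^2 + 20 * a * b^4 * x * y^2 - 42 * a * b^4 * y^3 + 288 * a * b^4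
    - 2 * a * b^3 * x * y^3 - 22 * a * b^3 * y^4 + 1016 * a * b^3 * y - 6 * a * b^2 * x * y^4
    - 240 * a * b^2 * x * y + 1284 * a * b^2 * y^2 - 252 * a * b * x * y^2 + 702 * a * b * y^3
    + 288 * a * b - 54 * a * x * y^3 + 162 * a * y^4 + 432 * a * y + 64 * b^6 + 192 * b^5 * x
    - 64 * b^5 * y + 240 * b^4 * x * y - 332 * b^4 * y^2 - 24 * b^3 * x * y^2 - 258 * b^3 * y^3
    - 4416 * b^3 - 72 * b^2 * x * y^3 - 5184 * b^2 * x - 54 * b^2 * y^4 - 11232 * b^2 * y
    - 8208 * b * x * y - 9180 * b * y^2 - 3240 * x * y^2 - 2430 * y^3) * (x^3 + b*x^2 + a*x + 1)
    + (8 * a^3 * b * x^2 - 24 * a^3 * b^2 * x - 26 * a^3 * b * x * y + 6 * a^3 * x^2 * y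
    - 6 * a^2 * b^4 * x + 2 * a^2 * b^3 * x^2 + 2 * a^2 * b^3 * x * y + 18 * a^2 * b^2 * x^2 * y
    + 104 * a^2 * b^2 + 18 * a^2 * b * x + 102 * a^2 * b * y + 306 * a^2 * x^2 + 36 * a^2 * x * y
    - 8 * a * b^5 * x^2 - 8 * a * b^4 * x^2 * y - 70 * a * b^4 + 376 * a * b^3 * x
    - 62 * a * b^3 * y + 552 * a * b^2 * x^2 + 390 * a * b^2 * x * y + 486 * a * b * x^2 * y
    - 630 * a * b + 2160 * a * x - 162 * a * y - 102 * b^5 * x - 142 * b^4 * x^2
    - 126 * b^4 * x * y - 150 * b^3 * x^2 * y + 438 * b^3 - 270 * b^2 * x + 306 * b^2 * y
    - 486 * b * x^2 + 324 * b * x * y + 2430) * (y^3 + 2*b*y^2 + b^2*y + 4)"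
    unfolding matchings_swap triangle_y triangle_y_form_def matchings_form_def
      triangle_matchings_form_def biquad_def by Groebner_Basis.algebra
  then have "triangle x r s * matchings p q y x r s = triangle_matchings_form a b x y"
    by (simp only: x y mult_zero_right add_0_right)
  then have "triangle p q y * triangle x r s * matchings p q y x r s =
      triangle_x_form a b x y * triangle_matchings_form a b x y"
    by (simp only: triangle_x mult.assoc)
  also have "\<dots> = prism_form a b x y + (128 * a^5 * b * x - 64 * a^5 * b^4 * y
    - 32 * a^5 * b^3 * x * y - 56 * a^5 * b^3 * y^2 - 24 * a^5 * b^2 * x * y^2 - 800 * a^5 * b * y
    + 96 * a^5 * x * y - 384 * a^5 * y^2 + 216 * a^4 * b^6 * y + 144 * a^4 * b^5 * x * y
    + 70 * a^4 * b^5 * y^2 + 46 * a^4 * b^4 * x * y^2 - 228 * a^4 * b^4 * y^3 - 736 * a^4 * b^4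
    - 120 * a^4 * b^3 * x * y^3 - 114 * a^4 * b^3 * y^4 - 3024 * a^4 * b^3 * y
    - 54 * a^4 * b^2 * x * y^4 - 1456 * a^4 * b^2 * x * y - 4360 * a^4 * b^2 * y^2
    - 864 * a^4 * b * x * y^2 - 2616 * a^4 * b * y^3 + 15648 * a^4 * b + 216 * a^4 * x * y^3
    + 288 * a^4 * x - 864 * a^4 * y^4 + 864 * a^4 * y - 98 * a^3 * b^8 * y
    - 66 * a^3 * b^7 * x * y + 250 * a^3 * b^7 * y^2 + 222 * a^3 * b^6 * x * y^2
    + 666 * a^3 * b^6 * y^3 + 2168 * a^3 * b^6 + 514 * a^3 * b^5 * x * y^3 + 1272 * a^3 * b^5 * x
    + 326 * a^3 * b^5 * y^4 + 1854 * a^3 * b^5 * y + 234 * a^3 * b^4 * x * y^4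
    + 1654 * a^3 * b^4 * x * y - 5414 * a^3 * b^4 * y^2 - 2676 * a^3 * b^3 * x * y^2
    - 11118 * a^3 * b^3 * y^3 - 52328 * a^3 * b^3 - 6378 * a^3 * b^2 * x * y^3
    - 32904 * a^3 * b^2 * x - 5610 * a^3 * b^2 * y^4 - 19536 * a^3 * b^2 * y
    - 3024 * a^3 * b * x * y^4 - 25200 * a^3 * b * x * y + 29376 * a^3 * b * y^2
    + 4104 * a^3 * y^3 - 12960 * a^3 + 12 * a^2 * b^10 * y + 8 * a^2 * b^9 * x * y
    - 70 * a^2 * b^9 * y^2 - 58 * a^2 * b^8 * x * y^2 - 160 * a^2 * b^8 * y^3 - 1008 * a^2 * b^8
    - 120 * a^2 * b^7 * x * y^3 - 704 * a^2 * b^7 * x - 78 * a^2 * b^7 * y^4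
    + 2302 * a^2 * b^7 * y - 54 * a^2 * b^6 * x * y^4 + 2148 * a^2 * b^6 * x * y
    + 8172 * a^2 * b^6 * y^2 + 4786 * a^2 * b^5 * x * y^2 + 7750 * a^2 * b^5 * y^3
    + 18040 * a^2 * b^5 + 2636 * a^2 * b^4 * x * y^3 + 16912 * a^2 * b^4 * x
    + 2680 * a^2 * b^4 * y^4 - 57118 * a^2 * b^4 * y + 414 * a^2 * b^3 * x * y^4
    - 54732 * a^2 * b^3 * x * y - 170898 * a^2 * b^3 * y^2 - 118206 * a^2 * b^2 * x * y^2
    - 125874 * a^2 * b^2 * y^3 + 172584 * a^2 * b^2 - 51408 * a^2 * b * x * y^3
    + 27216 * a^2 * b * x - 32022 * a^2 * b * y^4 + 53136 * a^2 * b * y - 486 * a^2 * x * y^4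
    + 22032 * a^2 * x * y - 8424 * a^2 * y^2 + 128 * a * b^10 + 96 * a * b^9 * x
    - 738 * a * b^9 * y - 738 * a * b^8 * x * y - 1986 * a * b^8 * y^2 - 1374 * a * b^7 * x * y^2
    - 1626 * a * b^7 * y^3 + 1720 * a * b^7 - 642 * a * b^6 * x * y^3 - 232 * a * b^6 * x
    - 474 * a * b^6 * y^4 + 10702 * a * b^6 * y - 54 * a * b^5 * x * y^4 + 11366 * a * b^5 * x * y
    + 30194 * a * b^5 * y^2 + 29196 * a * b^4 * x * y^2 + 30522 * a * b^4 * y^3 - 118056 * a * b^4
    + 18702 * a * b^3 * x * y^3 - 56232 * a * b^3 * x + 10782 * a * b^3 * y^4
    + 166680 * a * b^3 * y + 2592 * a * b^2 * x * y^4 + 158328 * a * b^2 * x * y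
    + 511812 * a * b^2 * y^2 + 220644 * a * b * x * y^2 + 324972 * a * b * y^3 - 98496 * a * b
    + 53460 * a * x * y^3 + 54432 * a * y^4 - 15552 * a * y - 864 * b^9 - 576 * b^8 * x
    + 1182 * b^8 * y + 1260 * b^7 * x * y + 3630 * b^7 * y^2 + 1368 * b^6 * x * y^2
    + 1782 * b^6 * y^3 + 18520 * b^6 + 108 * b^5 * x * y^3 + 12912 * b^5 * x + 54 * b^5 * y^4
    - 25050 * b^5 * y - 27252 * b^4 * x * y - 77652 * b^4 * y^2 - 32724 * b^3 * x * y^2
    - 40770 * b^3 * y^3 + 76248 * b^3 - 5184 * b^2 * x * y^3 + 40176 * b^2 * x - 2592 * b^2 * y^4
    - 95256 * b^2 * y - 85536 * b * x * y - 347004 * b * y^2 - 104976 * x * y^2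
    - 160380 * y^3) * (x^3 + b*x^2 + a*x + 1) + (2 * a^5 * b^3 * x * y - 16 * a^5 * b^4 * x
    - 4 * a^5 * b^3 * x^2 + 6 * a^5 * b^2 * x^2 * y + 56 * a^5 * b * x - 24 * a^5 * x^2
    + 96 * a^5 * x * y + 54 * a^4 * b^6 * x + 22 * a^4 * b^5 * x^2 + 38 * a^4 * b^5 * x * y
    + 2 * a^4 * b^4 * x^2 * y - 528 * a^4 * b^4 - 426 * a^4 * b^3 * x - 510 * a^4 * b^3 * y
    - 6 * a^4 * b^2 * x^2 + 224 * a^4 * b^2 * x * y + 528 * a^4 * b * x^2 * y + 4152 * a^4 * b
    + 288 * a^4 * x + 3168 * a^4 * y - 28 * a^3 * b^8 * x - 20 * a^3 * b^7 * x^2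
    - 86 * a^3 * b^7 * x * y - 78 * a^3 * b^6 * x^2 * y + 1206 * a^3 * b^6 - 276 * a^3 * b^5 * x
    + 1190 * a^3 * b^5 * y - 772 * a^3 * b^4 * x^2 + 578 * a^3 * b^4 * x * y
    + 714 * a^3 * b^3 * x^2 * y - 19622 * a^3 * b^3 + 1392 * a^3 * b^2 * x - 20262 * a^3 * b^2 * y
    + 11412 * a^3 * b * x^2 + 5526 * a^3 * b * x * y + 3510 * a^3 * x^2 * y - 19656 * a^3
    + 4 * a^2 * b^10 * x + 4 * a^2 * b^9 * x^2 + 20 * a^2 * b^9 * x * y + 20 * a^2 * b^8 * x^2 * y
    - 540 * a^2 * b^8 + 182 * a^2 * b^7 * x - 598 * a^2 * b^7 * y + 602 * a^2 * b^6 * x^2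
    + 696 * a^2 * b^6 * x * y + 802 * a^2 * b^5 * x^2 * y + 2982 * a^2 * b^5
    + 2594 * a^2 * b^4 * x + 9186 * a^2 * b^4 * y - 5514 * a^2 * b^3 * x^2
    - 16464 * a^2 * b^3 * x * y - 18630 * a^2 * b^2 * x^2 * y + 165294 * a^2 * b^2
    + 10584 * a^2 * b * x + 62694 * a^2 * b * y - 23004 * a^2 * x^2 - 8586 * a^2 * x * y
    + 68 * a * b^10 - 24 * a * b^9 * x + 84 * a * b^9 * y - 108 * a * b^8 * x^2
    - 204 * a * b^8 * x * y - 240 * a * b^7 * x^2 * y + 1720 * a * b^7 - 708 * a * b^6 * x
    - 460 * a * b^6 * y - 918 * a * b^5 * x^2 + 1910 * a * b^5 * x * y + 1428 * a * b^4 * x^2 * y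
    - 55500 * a * b^4 - 14508 * a * b^3 * x - 27720 * a * b^3 * y + 31590 * a * b^2 * x^2
    + 30834 * a * b^2 * x * y + 56052 * a * b * x^2 * y - 308772 * a * b - 27216 * a * x
    - 54432 * a * y - 312 * b^9 + 42 * b^8 * x - 126 * b^8 * y + 402 * b^7 * x^2
    + 198 * b^7 * x * y + 468 * b^6 * x^2 * y + 3772 * b^6 + 1572 * b^5 * x + 2112 * b^5 * y
    - 4302 * b^4 * x^2 - 2574 * b^4 * x * y - 8316 * b^3 * x^2 * y + 62748 * b^3 + 11826 * b^2 * x
    + 13770 * b^2 * y - 50544 * b * x^2 - 15552 * b * x * y - 53946 * x^2 * y + 160380) * (y^3
    + 2*b*y^2 + b^2*y + 4)"
    unfolding triangle_x_form_def triangle_matchings_form_def prism_form_def biquad_def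
    by Groebner_Basis.algebra
  finally show ?thesis by (simp only: x y mult_zero_right add_0_right)
qed

end

text \<open>The sum over the ten splittings of six elements into two triples.\<close>

definition split_sum :: "('a \<Rightarrow> 'a \<Rightarrow> 'a \<Rightarrow> 'a \<Rightarrow> 'a \<Rightarrow> 'a \<Rightarrow> 'b::comm_monoid_add) \<Rightarrow> 'a \<Rightarrow> 'a \<Rightarrow> 'a \<Rightarrow> 'a \<Rightarrow>
  'a \<Rightarrow> 'a \<Rightarrow> 'b" where
  "split_sum f x1 x2 x3 y1 y2 y3 = f x1 x2 x3 y1 y2 y3
     + f x2 x3 y1 x1 y2 y3 + f x2 x3 y2 x1 y1 y3 + f x2 x3 y3 x1 y1 y2
     + f x1 x3 y1 x2 y2 y3 + f x1 x3 y2 x2 y1 y3 + f x1 x3 y3 x2 y1 y2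
     + f x1 x2 y1 x3 y2 y3 + f x1 x2 y2 x3 y1 y3 + f x1 x2 y3 x3 y1 y2"

lemma (in cubic_pair_function) sum6_split_sum:
  "sum6 \<alpha> f = of_nat (2 * stab) * split_sum f (\<alpha> 1) (\<alpha> 2) (\<alpha> 3) (\<alpha> 4) (\<alpha> 5) (\<alpha> 6)"
  unfolding sum6_eq split_sum_def ..

section \<open>Orbit sums as sums over splittings\<close>

lemma triangle_perm:
  "triangle x y z = triangle y x z" "triangle x y z = triangle x z y"
  for x y z :: "'a::idom"
  unfolding triangle_def by Groebner_Basis.algebra+

lemma matchings_perm:
  "matchings x1 x2 x3 y1 y2 y3 = matchings x2 x1 x3 y1 y2 y3"
  "matchings x1 x2 x3 y1 y2 y3 = matchings x1 x3 x2 y1 y2 y3"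
  "matchings x1 x2 x3 y1 y2 y3 = matchings x1 x2 x3 y2 y1 y3"
  "matchings x1 x2 x3 y1 y2 y3 = matchings x1 x2 x3 y1 y3 y2"
  "matchings x1 x2 x3 y1 y2 y3 = matchings y1 y2 y3 x1 x2 x3"
  for x1 x2 x3 y1 y2 y3 :: "'a::idom"
  unfolding matchings_def matching_def by Groebner_Basis.algebra+

interpretation J2: cubic_pair_function "matchings :: 'a::idom \<Rightarrow> _"
  by unfold_locales (rule matchings_perm)+

interpretation J4: cubic_pair_function "\<lambda>x1 x2 x3 y1 y2 y3. triangle x1 x2 x3 * triangle y1 y2 y3
  :: 'a::idom"
  by unfold_locales (metis triangle_perm mult.commute)+

interpretation J6: cubic_pair_function
  "\<lambda>x1 x2 x3 y1 y2 y3. triangle x1 x2 x3 * triangle y1 y2 y3 * matchings x1 x2 x3 y1 y2 y3 ::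
    'a::idom"
  by unfold_locales (metis triangle_perm matchings_perm mult.commute)+

text \<open>Each of the six terms is \<open>g\<close> with its last three arguments rearranged, and
  reindexing makes all six sums equal. This passes from \<open>matching\<close> to the symmetric
  \<open>matchings\<close>.\<close>

lemma sum6_symmetrize:
  fixes g :: "'a \<Rightarrow> 'a \<Rightarrow> 'a \<Rightarrow> 'a \<Rightarrow> 'a \<Rightarrow> 'a \<Rightarrow> 'b::comm_semiring_1"
  shows "sum6 \<alpha> (\<lambda>x1 x2 x3 y1 y2 y3. g x1 x2 x3 y1 y2 y3 + g x1 x2 x3 y1 y3 y2
    + g x1 x2 x3 y2 y1 y3 + g x1 x2 x3 y2 y3 y1 + g x1 x2 x3 y3 y1 y2
      + g x1 x2 x3 y3 y2 y1) = 6 * sum6 \<alpha> g"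
proof -
  have pos: "(\<Sum>\<sigma> | \<sigma> permutes {1..6}. g (\<alpha> (\<sigma> 1)) (\<alpha> (\<sigma> 2)) (\<alpha> (\<sigma> 3)) (\<alpha> (\<sigma> i)) (\<alpha> (\<sigma> j)) (\<alpha> (\<sigma>
    k))) = sum6 \<alpha> g"
    if "{1, 2, 3, i, j, k} = {1..6::nat}" for i j k
    using sum6_positions[OF that, of \<alpha> g] by simp
  have "(6::'b) = 1 + 1 + 1 + 1 + 1 + 1" by simp
  then have six: "6 * z = z + z + z + z + z + z" for z :: 'b
    by (simp only: distrib_right mult_1_left)
  have set: "{1, 2, 3, 4, 5, 6} = {1..6::nat}" "{1, 2, 3, 4, 6, 5} = {1..6::nat}"
    "{1, 2, 3, 5, 4, 6} = {1..6::nat}" "{1, 2, 3, 5, 6, 4} = {1..6::nat}"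
    "{1, 2, 3, 6, 4, 5} = {1..6::nat}" "{1, 2, 3, 6, 5, 4} = {1..6::nat}"
    by auto
  show ?thesis
    by (subst sum6_def) (simp only: sum.distrib pos[OF set(1)] pos[OF set(2)] pos[OF set(3)]
      pos[OF set(4)] pos[OF set(5)] pos[OF set(6)] six)
qed

lemma edge_expr_matching:
  fixes \<alpha> :: "nat \<Rightarrow> 'a::comm_ring_1" and \<sigma> :: "nat \<Rightarrow> nat"
  assumes "inj \<sigma>"
  shows "edge_expr \<alpha> ((`) \<sigma> ` {{1, 2}, {3, 4}, {5, 6}}) =
    matching (\<alpha> (\<sigma> 1)) (\<alpha> (\<sigma> 3)) (\<alpha> (\<sigma> 5)) (\<alpha> (\<sigma> 2)) (\<alpha> (\<sigma> 4)) (\<alpha> (\<sigma> 6))"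
  unfolding edge_expr_image[OF assms]
  by (simp add: doubleton_eq_iff sqdiff_Min_Max matching_def mult.assoc del: Min_insert Max_insert
    One_nat_def)

lemma edge_expr_triangles:
  fixes \<alpha> :: "nat \<Rightarrow> 'a::comm_ring_1" and \<sigma> :: "nat \<Rightarrow> nat"
  assumes "inj \<sigma>"
  shows "edge_expr \<alpha> ((`) \<sigma> ` {{1, 2}, {2, 3}, {3, 1}, {4, 5}, {5, 6}, {6, 4}}) =
    triangle (\<alpha> (\<sigma> 1)) (\<alpha> (\<sigma> 2)) (\<alpha> (\<sigma> 3)) * triangle (\<alpha> (\<sigma> 4)) (\<alpha> (\<sigma> 5)) (\<alpha> (\<sigma> 6))"
  unfolding edge_expr_image[OF assms]
  by (simp add: doubleton_eq_iff sqdiff_Min_Max triangle_def mult.assoc del: Min_insert Max_insert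
    One_nat_def)

lemma edge_expr_prism:
  fixes \<alpha> :: "nat \<Rightarrow> 'a::comm_ring_1" and \<sigma> :: "nat \<Rightarrow> nat"
  assumes "inj \<sigma>"
  shows "edge_expr \<alpha> ((`) \<sigma> ` {{1, 2}, {2, 3}, {3, 1}, {4, 5}, {5, 6}, {6, 4}, {1, 4}, {2, 5}, {3,
    6}}) =
    triangle (\<alpha> (\<sigma> 1)) (\<alpha> (\<sigma> 2)) (\<alpha> (\<sigma> 3)) * triangle (\<alpha> (\<sigma> 4)) (\<alpha> (\<sigma> 5)) (\<alpha> (\<sigma> 6))
    * matching (\<alpha> (\<sigma> 1)) (\<alpha> (\<sigma> 2)) (\<alpha> (\<sigma> 3)) (\<alpha> (\<sigma> 4)) (\<alpha> (\<sigma> 5)) (\<alpha> (\<sigma> 6))"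
  unfolding edge_expr_image[OF assms]
  by (simp add: doubleton_eq_iff sqdiff_Min_Max triangle_def matching_def mult.assoc del:
    Min_insert Max_insert One_nat_def)

text \<open>Every splitting is crossed by six perfect matchings and every one of the fifteen perfect
  matchings crosses four splittings, so the two sums are proportional.\<close>

lemma orbit_sum_matching:
  fixes \<alpha> :: "nat \<Rightarrow> 'a::idom"
  obtains m n where "m > 0" "n > 0" "of_nat m * orbit_sum \<alpha> {{1, 2}, {3, 4}, {5, 6}}
    = of_nat n * split_sum matchings (\<alpha> 1) (\<alpha> 2) (\<alpha> 3) (\<alpha> 4) (\<alpha> 5) (\<alpha> 6)"
proof -
  obtain m where m: "m > 0" "of_nat m * orbit_sum \<alpha> {{1, 2}, {3, 4}, {5, 6}} =
      (\<Sum>\<sigma> | \<sigma> permutes {1..6}. edge_expr \<alpha> ((`) \<sigma> ` {{1, 2}, {3, 4}, {5, 6}}))"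
    by (rule orbit_sum_eq_sum_permutes)
  note m(2)
  also have "(\<Sum>\<sigma> | \<sigma> permutes {1..6}. edge_expr \<alpha> ((`) \<sigma> ` {{1, 2}, {3, 4}, {5, 6}})) = sum6 \<alpha>
    matching"
  proof -
    \<comment> \<open>The edges join positions 1, 3, 5 to positions 2, 4, 6.\<close>
    have "{1, 3, 5, 2, 4, 6} = {1..6::nat}" by auto
    then show ?thesis
      unfolding sum6_positions[OF \<open>{1, 3, 5, 2, 4, 6} = {1..6}\<close>]
      by (intro sum.cong refl) (simp only: edge_expr_matching permutes_inj mem_Collect_eq)
  qed
  finally have "6 * (of_nat m * orbit_sum \<alpha> {{1, 2}, {3, 4}, {5, 6}}) = 6 * sum6 \<alpha> matching" by
    (rule arg_cong)
  also have "\<dots> = sum6 \<alpha> matchings"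
    unfolding sum6_symmetrize[symmetric] matchings_def ..
  finally have "of_nat (6 * m) * orbit_sum \<alpha> {{1, 2}, {3, 4}, {5, 6}} = sum6 \<alpha> matchings"
    by (simp add: mult.assoc)
  with that[of "6 * m" "2 * J2.stab"] m(1) J2.stab_pos show ?thesis
    by (simp only: J2.sum6_split_sum)
qed

lemma orbit_sum_triangles:
  fixes \<alpha> :: "nat \<Rightarrow> 'a::idom"
  obtains m n where "m > 0" "n > 0" "of_nat m * orbit_sum \<alpha> {{1, 2}, {2, 3}, {3, 1}, {4, 5}, {5,
    6}, {6, 4}}
    = of_nat n * split_sum (\<lambda>x1 x2 x3 y1 y2 y3. triangle x1 x2 x3 * triangle y1 y2 y3)
        (\<alpha> 1) (\<alpha> 2) (\<alpha> 3) (\<alpha> 4) (\<alpha> 5) (\<alpha> 6)"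
proof -
  obtain m where m: "m > 0" "of_nat m * orbit_sum \<alpha> {{1, 2}, {2, 3}, {3, 1}, {4, 5}, {5, 6}, {6,
    4}} =
      (\<Sum>\<sigma> | \<sigma> permutes {1..6}. edge_expr \<alpha> ((`) \<sigma> ` {{1, 2}, {2, 3}, {3, 1}, {4, 5}, {5, 6}, {6,
        4}}))"
    by (rule orbit_sum_eq_sum_permutes)
  note m(2)
  also have "(\<Sum>\<sigma> | \<sigma> permutes {1..6}. edge_expr \<alpha> ((`) \<sigma> ` {{1, 2}, {2, 3}, {3, 1}, {4, 5}, {5,
    6}, {6, 4}})) =
      sum6 \<alpha> (\<lambda>x1 x2 x3 y1 y2 y3. triangle x1 x2 x3 * triangle y1 y2 y3)"
    unfolding sum6_def by (rule sum.cong[OF refl]) (simp only: edge_expr_triangles permutes_inj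
      mem_Collect_eq)
  finally show ?thesis
    using that[of m "2 * J4.stab"] m(1) J4.stab_pos by (simp only: J4.sum6_split_sum)
qed

text \<open>A prism consists of a splitting, giving its two triangles, and one of the six matchings
  across it. The triangles are unaffected by the symmetrization.\<close>

lemma orbit_sum_prism:
  fixes \<alpha> :: "nat \<Rightarrow> 'a::idom"
  obtains m n where "m > 0" "n > 0" "of_nat m * orbit_sum \<alpha> {{1, 2}, {2, 3}, {3, 1}, {4, 5}, {5,
    6}, {6, 4}, {1, 4}, {2, 5}, {3, 6}}
    = of_nat n * split_sum (\<lambda>x1 x2 x3 y1 y2 y3. triangle x1 x2 x3 * triangle y1 y2 y3 * matchings
      x1 x2 x3 y1 y2 y3)
        (\<alpha> 1) (\<alpha> 2) (\<alpha> 3) (\<alpha> 4) (\<alpha> 5) (\<alpha> 6)"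
proof -
  let ?E = "{{1, 2}, {2, 3}, {3, 1}, {4, 5}, {5, 6}, {6, 4}, {1, 4}, {2, 5}, {3, 6}} :: nat set set"
  let ?h = "\<lambda>x1 x2 x3 y1 y2 y3. triangle x1 x2 x3 * triangle y1 y2 y3 * matching x1 x2 x3 y1 y2 y3
    :: 'a"
  let ?f = "\<lambda>x1 x2 x3 y1 y2 y3. triangle x1 x2 x3 * triangle y1 y2 y3 * matchings x1 x2 x3 y1 y2
    y3 :: 'a"
  obtain m where m: "m > 0" "of_nat m * orbit_sum \<alpha> ?E = (\<Sum>\<sigma> | \<sigma> permutes {1..6}. edge_expr \<alpha> ((`)
    \<sigma> ` ?E))"
    by (rule orbit_sum_eq_sum_permutes)
  note m(2)
  also have "(\<Sum>\<sigma> | \<sigma> permutes {1..6}. edge_expr \<alpha> ((`) \<sigma> ` ?E)) = sum6 \<alpha> ?h"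
    unfolding sum6_def by (rule sum.cong[OF refl]) (simp only: edge_expr_prism permutes_inj
      mem_Collect_eq)
  finally have "6 * (of_nat m * orbit_sum \<alpha> ?E) = 6 * sum6 \<alpha> ?h" by (rule arg_cong)
  also have "\<dots> = sum6 \<alpha> ?f"
  proof -
    have t: "triangle x z y = triangle x y z" "triangle y x z = triangle x y z"
      "triangle y z x = triangle x y z"
      "triangle z x y = triangle x y z" "triangle z y x = triangle x y z" for x y z :: 'a
      using triangle_perm by metis+
    show ?thesis
      unfolding sum6_symmetrize[symmetric] matchings_def distrib_left
      by (simp only: t[of "_ :: 'a"] sum6_def)
  qed
  finally have "of_nat (6 * m) * orbit_sum \<alpha> ?E = sum6 \<alpha> ?f"
    by (simp add: mult.assoc)
  with that[of "6 * m" "2 * J6.stab"] m(1) J6.stab_pos show ?thesis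
    by (simp only: J6.sum6_split_sum)
qed

text \<open>The scaling factor \<open>c\<close> may depend on the product \<open>P\<close> of all
  six arguments, and this product is the same for all ten splittings.\<close>

lemma split_sum_scale:
  fixes f :: "'a \<Rightarrow> 'a \<Rightarrow> 'a \<Rightarrow> 'a \<Rightarrow> 'a \<Rightarrow> 'a \<Rightarrow> 'a::field"
  assumes "\<And>x1 x2 x3 y1 y2 y3. x1 * x2 * x3 * y1 * y2 * y3 = P \<Longrightarrow>
    f (inverse x1) (inverse x2) (inverse x3) (inverse y1) (inverse y2) (inverse y3) = c * f x1 x2
      x3 y1 y2 y3"
    and "x1 * x2 * x3 * y1 * y2 * y3 = P"
  shows "split_sum f (inverse x1) (inverse x2) (inverse x3) (inverse y1) (inverse y2) (inverse y3)
    = c * split_sum f x1 x2 x3 y1 y2 y3"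
proof -
  note eq = assms(1)
  show ?thesis
    unfolding split_sum_def distrib_left
    by (intro arg_cong2[of _ _ _ _ "(+)"] eq) (use assms(2) in \<open>simp_all only: mult_ac\<close>)
qed

text \<open>\<open>1/s - 1/t = - (s - t) / (s * t)\<close>, and each argument occurs in two of the
  three squared differences.\<close>

lemma triangle_inverse:
  fixes x y z :: "'a::field"
  assumes "x \<noteq> 0" "y \<noteq> 0" "z \<noteq> 0"
  shows "triangle (inverse x) (inverse y) (inverse z) = triangle x y z / (x * y * z)^4"
proof -
  have d: "(inverse s - inverse t)^2 = (s - t)^2 / (s * t)^2" if "s \<noteq> 0" "t \<noteq> 0" for s t :: 'a
  proof -
    have "inverse s - inverse t = - ((s - t) / (s * t))" using that by (simp add: field_simps)
    then show ?thesis by (simp only: power2_minus power_divide)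
  qed
  show ?thesis unfolding triangle_def d[OF assms(1,2)] d[OF assms(2,3)] d[OF assms(3,1)]
    by (simp add: power_mult_distrib eval_nat_numeral field_simps)
qed

lemma matching_inverse:
  fixes x1 x2 x3 y1 y2 y3 :: "'a::field"
  assumes "x1 * x2 * x3 * y1 * y2 * y3 \<noteq> 0"
  shows "matching (inverse x1) (inverse x2) (inverse x3) (inverse y1) (inverse y2) (inverse y3) =
    matching x1 x2 x3 y1 y2 y3 / (x1 * x2 * x3 * y1 * y2 * y3)^2"
proof -
  have d: "(inverse s - inverse t)^2 = (s - t)^2 / (s * t)^2" if "s \<noteq> 0" "t \<noteq> 0" for s t :: 'a
  proof -
    have "inverse s - inverse t = - ((s - t) / (s * t))" using that by (simp add: field_simps)
    then show ?thesis by (simp only: power2_minus power_divide)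
  qed
  have nz: "x1 \<noteq> 0" "x2 \<noteq> 0" "x3 \<noteq> 0" "y1 \<noteq> 0" "y2 \<noteq> 0" "y3 \<noteq> 0" using assms by auto
  show ?thesis unfolding matching_def d[OF nz(1,4)] d[OF nz(2,5)] d[OF nz(3,6)]
    by (simp add: power_mult_distrib mult_ac)
qed

lemma matchings_inverse:
  fixes x1 x2 x3 y1 y2 y3 :: "'a::field"
  assumes "x1 * x2 * x3 * y1 * y2 * y3 \<noteq> 0"
  shows "matchings (inverse x1) (inverse x2) (inverse x3) (inverse y1) (inverse y2) (inverse y3) =
    matchings x1 x2 x3 y1 y2 y3 / (x1 * x2 * x3 * y1 * y2 * y3)^2"
proof -
  have "matching (inverse x1) (inverse x2) (inverse x3) (inverse z1) (inverse z2) (inverse z3) =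
    matching x1 x2 x3 z1 z2 z3 / (x1 * x2 * x3 * y1 * y2 * y3)^2"
    if "z1 * z2 * z3 = y1 * y2 * y3" for z1 z2 z3
  proof -
    have p: "x1 * x2 * x3 * z1 * z2 * z3 = x1 * x2 * x3 * y1 * y2 * y3" using that by (simp add:
      mult.assoc)
    show ?thesis using matching_inverse[of x1 x2 x3 z1 z2 z3] assms unfolding p by blast
  qed
  note m = this
  show ?thesis unfolding matchings_def add_divide_distrib
    by (intro arg_cong2[of _ _ _ _ "(+)"] m) (simp_all only: mult_ac)
qed

lemma cubic_root:
  fixes x p q :: "'a::idom"
  assumes "x + p + q = - c2" "x * p + x * q + p * q = c1" "x * p * q = - c0"
  shows "x^3 + c2*x^2 + c1*x + c0 = 0" "p + q = - (c2 + x)" "p * q = x^2 + c2*x + c1"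
  using assms by Groebner_Basis.algebra+

text \<open>The resultant of a monic cubic and a quadratic, expanded in the elementary symmetric
  functions of the roots of the cubic.\<close>

lemma norm_quadratic:
  fixes x1 x2 x3 A B C :: "'a::idom"
  assumes "e1 = x1 + x2 + x3" "e2 = x1 * x2 + x1 * x3 + x2 * x3" "e3 = x1 * x2 * x3"
  shows "(A*x1^2 + B*x1 + C) * (A*x2^2 + B*x2 + C) * (A*x3^2 + B*x3 + C) =
    A^3*e3^2 + A^2*B*e2*e3 + A^2*C*(e2^2 - 2*e1*e3) + A*B^2*e1*e3 + A*B*C*(e1*e2 - 3*e3)
    + A*C^2*(e1^2 - 2*e2) + B^3*e3 + B^2*C*e2 + B*C^2*e1 + C^3"
  unfolding assms by Groebner_Basis.algebra

text
  \<open>For \<open>F\<close>, \<open>G\<close> of the theorem: \<open>cov_w a b = 3 H(F, G)\<close>, \<open>- cov_Z a b\<close> is both the discriminant of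
    \<open>F\<close> and the resultant of \<open>F\<close> and \<open>G\<close>, and \<open>16 * (cov_w a b
    + cov_T a b)\<close> is the discriminant of \<open>G\<close>.\<close>

definition cov_w :: "'a::comm_ring_1 \<Rightarrow> 'a \<Rightarrow> 'a" where "cov_w a b = b^3 - 2*a*b - 9"

definition cov_T :: "'a::comm_ring_1 \<Rightarrow> 'a \<Rightarrow> 'a" where "cov_T a b = 2*a*b - 18"

definition cov_Z :: "'a::comm_ring_1 \<Rightarrow> 'a \<Rightarrow> 'a" where
  "cov_Z a b = 4*a^3 - a^2*b^2 - 18*a*b + 4*b^3 + 27"

text \<open>\<open>F\<close> and \<open>G\<close> have constant coefficient 1, so their reversals
  are monic and their roots satisfy Vieta's relations without denominators.\<close>

context
  fixes a b x1 x2 x3 y1 y2 y3 :: "'a::field_char_0"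
  assumes ex: "x1 + x2 + x3 = - b" "x1 * x2 + x1 * x3 + x2 * x3 = a" "x1 * x2 * x3 = - 1"
    and ey: "y1 + y2 + y3 = - (2 * b)" "y1 * y2 + y1 * y3 + y2 * y3 = b^2" "y1 * y2 * y3 = - 4"
begin

lemma permuted_relations:
  "x2 + x1 + x3 = - b" "x2 * x1 + x2 * x3 + x1 * x3 = a" "x2 * x1 * x3 = - 1"
  "x3 + x1 + x2 = - b" "x3 * x1 + x3 * x2 + x1 * x2 = a" "x3 * x1 * x2 = - 1"
  "y2 + y1 + y3 = - (2 * b)" "y2 * y1 + y2 * y3 + y1 * y3 = b^2" "y2 * y1 * y3 = - 4"
  "y3 + y1 + y2 = - (2 * b)" "y3 * y1 + y3 * y2 + y1 * y2 = b^2" "y3 * y1 * y2 = - 4"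
  using ex ey by (simp_all add: ac_simps)

lemma root_facts:
  "x1^3 + b*x1^2 + a*x1 + 1 = 0" "x2 + x3 = - (b + x1)" "x2 * x3 = x1^2 + b*x1 + a"
  "x2^3 + b*x2^2 + a*x2 + 1 = 0" "x1 + x3 = - (b + x2)" "x1 * x3 = x2^2 + b*x2 + a"
  "x3^3 + b*x3^2 + a*x3 + 1 = 0" "x1 + x2 = - (b + x3)" "x1 * x2 = x3^2 + b*x3 + a"
  "y1^3 + 2*b*y1^2 + b^2*y1 + 4 = 0" "y2 + y3 = - (2*b + y1)" "y2 * y3 = y1^2 + 2*b*y1 + b^2"
  "y2^3 + 2*b*y2^2 + b^2*y2 + 4 = 0" "y1 + y3 = - (2*b + y2)" "y1 * y3 = y2^2 + 2*b*y2 + b^2"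
  "y3^3 + 2*b*y3^2 + b^2*y3 + 4 = 0" "y1 + y2 = - (2*b + y3)" "y1 * y2 = y3^2 + 2*b*y3 + b^2"
  by (fact cubic_root[OF ex] cubic_root[OF permuted_relations(1-3)]
    cubic_root[OF permuted_relations(4-6)]
    cubic_root[OF ey] cubic_root[OF permuted_relations(7-9)] cubic_root[OF
      permuted_relations(10-12)])+

lemma power_sums:
  "x1^2 + x2^2 + x3^2 = b^2 - 2*a" "y1^2 + y2^2 + y3^2 = 2*b^2"
  using ex ey by Groebner_Basis.algebra+

lemmas grid_sum_family = grid_sum_biquad[OF ex(1) power_sums(1) ey(1) power_sums(2)]

lemma elementary:
  "b = - (x1 + x2 + x3)" "a = x1 * x2 + x1 * x3 + x2 * x3" "1 = - (x1 * x2 * x3)"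
  "2 * b = - (y1 + y2 + y3)" "b^2 = y1 * y2 + y1 * y3 + y2 * y3" "4 = - (y1 * y2 * y3)"
  using ex ey by simp_all

lemma triangle_family:
  "triangle x1 x2 x3 = - cov_Z a b" "triangle y1 y2 y3 = 16 * (b^3 - 27)"
  unfolding triangle_elementary[OF elementary(1-3)] triangle_elementary[OF elementary(4-6)]
    cov_Z_def power_one
  by Groebner_Basis.algebra+

lemma matchings_family:
  "matchings x1 x2 x3 y1 y2 y3 = 4 * a^2 * b^2 - 8 * a * b^4 + 144 * a * b + 2 * b^6 - 36 * b^3
    - 162"
  unfolding matchings_elementary[OF elementary] power_one by Groebner_Basis.algebra

text \<open>One splitting separates the two cubics; the other nine exchange some \<open>x\<close>
  with some \<open>y\<close> and are values of a single normal form, summed over the grid by power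
  sums. The next two sums are computed in the same way.\<close>

lemma split_sum_matchings:
  "split_sum matchings x1 x2 x3 y1 y2 y3 = 8 * (3 * cov_w a b ^ 2 - 2 * cov_T a b ^ 2)"
proof -
  have "split_sum matchings x1 x2 x3 y1 y2 y3 = matchings x1 x2 x3 y1 y2 y3
    + grid_sum (matchings_form a b) x1 x2 x3 y1 y2 y3"
    unfolding split_sum_def grid_sum_def
    by (simp only: matchings_swap[OF root_facts(1-3) root_facts(10-12)]
      matchings_swap[OF root_facts(1-3) root_facts(13-15)] matchings_swap[OF root_facts(1-3)
      root_facts(16-18)] matchings_swap[OF root_facts(4-6) root_facts(10-12)]
      matchings_swap[OF root_facts(4-6) root_facts(13-15)] matchings_swap[OF root_facts(4-6)
      root_facts(16-18)] matchings_swap[OF root_facts(7-9) root_facts(10-12)]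
      matchings_swap[OF root_facts(7-9) root_facts(13-15)] matchings_swap[OF root_facts(7-9)
      root_facts(16-18)] add.assoc)
  then show ?thesis
    unfolding matchings_form_def grid_sum_family matchings_family cov_w_def cov_T_def by
      Groebner_Basis.algebra
qed

lemma split_sum_triangles:
  "4 * split_sum (\<lambda>x1 x2 x3 y1 y2 y3. triangle x1 x2 x3 * triangle y1 y2 y3) x1 x2 x3 y1 y2 y3 =
    cov_T a b ^ 4 - 48 * (3 * cov_w a b + 4 * cov_T a b) * cov_Z a b"
proof -
  have "split_sum (\<lambda>x1 x2 x3 y1 y2 y3. triangle x1 x2 x3 * triangle y1 y2 y3) x1 x2 x3 y1 y2 y3 =
    triangle x1 x2 x3 * triangle y1 y2 y3 + grid_sum (triangles_form a b) x1 x2 x3 y1 y2 y3"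
    unfolding split_sum_def grid_sum_def
    by (simp only: triangles_swap[OF root_facts(1-3) root_facts(10-12)]
      triangles_swap[OF root_facts(1-3) root_facts(13-15)] triangles_swap[OF root_facts(1-3)
      root_facts(16-18)] triangles_swap[OF root_facts(4-6) root_facts(10-12)]
      triangles_swap[OF root_facts(4-6) root_facts(13-15)] triangles_swap[OF root_facts(4-6)
      root_facts(16-18)] triangles_swap[OF root_facts(7-9) root_facts(10-12)]
      triangles_swap[OF root_facts(7-9) root_facts(13-15)] triangles_swap[OF root_facts(7-9)
      root_facts(16-18)] add.assoc)
  then show ?thesis
    unfolding triangles_form_def grid_sum_family triangle_family cov_w_def cov_T_def cov_Z_def by
      Groebner_Basis.algebra
qed

lemma split_sum_prism:
  "8 * split_sum (\<lambda>x1 x2 x3 y1 y2 y3. triangle x1 x2 x3 * triangle y1 y2 y3 * matchings x1 x2 x3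
    y1 y2 y3) x1 x2 x3 y1 y2 y3 =
    cov_T a b ^ 4 * (4 * cov_w a b ^ 2 - 3 * cov_T a b ^ 2)
    + 8 * (40 * cov_T a b ^ 3 + 21 * cov_T a b ^ 2 * cov_w a b - 96 * cov_T a b * cov_w a b ^ 2
      - 72 * cov_w a b ^ 3) * cov_Z a b
    - 288 * cov_Z a b ^ 2"
proof -
  have "split_sum (\<lambda>x1 x2 x3 y1 y2 y3. triangle x1 x2 x3 * triangle y1 y2 y3 * matchings x1 x2 x3
    y1 y2 y3) x1 x2 x3 y1 y2 y3 =
    triangle x1 x2 x3 * triangle y1 y2 y3 * matchings x1 x2 x3 y1 y2 y3
      + grid_sum (prism_form a b) x1 x2 x3 y1 y2 y3"
    unfolding split_sum_def grid_sum_def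
    by (simp only: prism_swap[OF root_facts(1-3) root_facts(10-12)] prism_swap[OF root_facts(1-3)
      root_facts(13-15)] prism_swap[OF root_facts(1-3) root_facts(16-18)]
      prism_swap[OF root_facts(4-6) root_facts(10-12)] prism_swap[OF root_facts(4-6)
      root_facts(13-15)] prism_swap[OF root_facts(4-6) root_facts(16-18)]
      prism_swap[OF root_facts(7-9) root_facts(10-12)] prism_swap[OF root_facts(7-9)
      root_facts(13-15)] prism_swap[OF root_facts(7-9) root_facts(16-18)] add.assoc)
  then show ?thesis
    unfolding prism_form_def grid_sum_family triangle_family matchings_family cov_w_def cov_T_def
      cov_Z_def by Groebner_Basis.algebra
qed

lemma prod_differences:
  "(x1 - y1) * (x1 - y2) * (x1 - y3) * ((x2 - y1) * (x2 - y2) * (x2 - y3)) * ((x3 - y1) * (x3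
    - y2) * (x3 - y3)) = cov_Z a b"
proof -
  \<comment> \<open>At a root of the first cubic, the second cubic takes the value of the difference
    of the two, which is quadratic.\<close>
  have d: "(x - y1) * (x - y2) * (x - y3) = b * x^2 + (b^2 - a) * x + 3" if "x^3 + b*x^2 + a*x
    + 1 = 0" for x
    using that ey by Groebner_Basis.algebra
  have "(b * x1^2 + (b^2 - a) * x1 + 3) * (b * x2^2 + (b^2 - a) * x2 + 3) * (b * x3^2 + (b^2
    - a) * x3 + 3) = cov_Z a b"
    unfolding norm_quadratic[OF ex[symmetric]] cov_Z_def by Groebner_Basis.algebra
  then show ?thesis unfolding d[OF root_facts(1)] d[OF root_facts(4)] d[OF root_facts(7)] .
qed

end

section \<open>Resultants and discriminants of cubics\<close>

text \<open>Laplace expansion along the first row, on lists so that the simplifier can evaluate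
  it.\<close>

fun list_det :: "'a::comm_ring_1 list list \<Rightarrow> 'a" where
  "list_det [] = 1"
| "list_det (r # rs) = (\<Sum>j<length r. (-1)^j * r ! j * list_det (map (\<lambda>s. take j s @ drop (Suc j)
  s) rs))"

lemma det_mat_of_rows_list:
  "length rs = n \<Longrightarrow> (\<And>r. r \<in> set rs \<Longrightarrow> length r = n) \<Longrightarrow> det (mat_of_rows_list n rs) = list_det rs"
proof (induction n arbitrary: rs)
  case 0
  then show ?case by (simp add: mat_of_rows_list_def det_dim_zero)
next
  case (Suc n)
  then obtain r rs' where rs: "rs = r # rs'" "length rs' = n" by (cases rs) auto
  have len: "length r = Suc n" "\<And>s. s \<in> set rs' \<Longrightarrow> length s = Suc n" using Suc.prems rs by auto
  let ?A = "mat_of_rows_list (Suc n) rs"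
  have A: "?A \<in> carrier_mat (Suc n) (Suc n)" using Suc.prems by (simp add: mat_of_rows_list_def)
  have "det ?A = (\<Sum>j<Suc n. ?A $$ (0, j) * cofactor ?A 0 j)"
    by (rule laplace_expansion_row[OF A]) simp
  also have "\<dots> = (\<Sum>j<Suc n. (-1)^j * r ! j * list_det (map (\<lambda>s. take j s @ drop (Suc j) s) rs'))"
  proof (rule sum.cong[OF refl])
    fix j assume j: "j \<in> {..<Suc n}"
    have "mat_delete ?A 0 j = mat_of_rows_list n (map (\<lambda>s. take j s @ drop (Suc j) s) rs')"
    proof (rule eq_matI)
      fix i k assume "i < dim_row (mat_of_rows_list n (map (\<lambda>s. take j s @ drop (Suc j) s) rs'))"
        "k < dim_col (mat_of_rows_list n (map (\<lambda>s. take j s @ drop (Suc j) s) rs'))"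
      then have ik: "i < n" "k < n" by (simp_all add: mat_of_rows_list_def rs)
      then have "length (rs' ! i) = Suc n" using len(2) rs(2) by simp
      then show "mat_delete ?A 0 j $$ (i, k) = mat_of_rows_list n (map (\<lambda>s. take j s @ drop (Suc
        j) s) rs') $$ (i, k)"
        using ik rs j by (simp add: mat_delete_def mat_of_rows_list_def nth_append)
    qed (use rs in \<open>simp_all add: mat_delete_def mat_of_rows_list_def\<close>)
    moreover have "det (mat_of_rows_list n (map (\<lambda>s. take j s @ drop (Suc j) s) rs')) =
        list_det (map (\<lambda>s. take j s @ drop (Suc j) s) rs')"
      by (rule Suc.IH) (use rs len j in auto)
    moreover have "?A $$ (0, j) = r ! j" using j rs by (simp add: mat_of_rows_list_def)
    ultimately show "?A $$ (0, j) * cofactor ?A 0 j =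
        (-1)^j * r ! j * list_det (map (\<lambda>s. take j s @ drop (Suc j) s) rs')"
      by (simp add: cofactor_def)
  qed
  finally show ?case by (simp add: rs len(1))
qed

text
  \<open>Each pass of the simplifier in the two evaluations below expands the minors of one size only,
    so that the minors belonging to zero entries are discarded before they are expanded.\<close>

lemmas list_det_eval = list.size add_Suc_right add_0_right add_0_left sum.lessThan_Suc lessThan_0
  sum.empty
  list.map take_Suc_Cons take_0 drop_Suc_Cons drop_0 append.simps nth_Cons_0 nth_Cons_Suc
  mult_zero_left mult_zero_right mult_1_left mult_1_right power_0 power_Suc mult_minus_left
    minus_minus
  list_det.simps(1)

lemma resultant_cubic_quadratic:
  fixes p0 p1 p2 p3 q0 q1 q2 :: "'a::idom"
  assumes "p3 \<noteq> 0" "q2 \<noteq> 0"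
  shows "resultant [:p0, p1, p2, p3:] [:q0, q1, q2:] = list_det
    [[p3, p2, p1, p0, 0], [0, p3, p2, p1, p0], [q2, q1, q0, 0, 0], [0, q2, q1, q0, 0], [0, 0, q2,
      q1, q0]]"
proof -
  have "sylvester_mat [:p0, p1, p2, p3:] [:q0, q1, q2:] = mat_of_rows_list 5
    [[p3, p2, p1, p0, 0], [0, p3, p2, p1, p0], [q2, q1, q0, 0, 0], [0, q2, q1, q0, 0], [0, 0, q2,
      q1, q0]]"
    by (rule eq_matI) (use assms in \<open>auto simp: sylvester_mat_def sylvester_mat_sub_def
      mat_of_rows_list_def
      less_Suc_eq numeral_eq_Suc\<close>)
  then show ?thesis unfolding resultant_def by (simp only:) (rule det_mat_of_rows_list; auto)
qed

lemma resultant_cubic_cubic: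
  fixes p0 p1 p2 p3 q0 q1 q2 q3 :: "'a::idom"
  assumes "p3 \<noteq> 0" "q3 \<noteq> 0"
  shows "resultant [:p0, p1, p2, p3:] [:q0, q1, q2, q3:] = list_det
    [[p3, p2, p1, p0, 0, 0], [0, p3, p2, p1, p0, 0], [0, 0, p3, p2, p1, p0],
     [q3, q2, q1, q0, 0, 0], [0, q3, q2, q1, q0, 0], [0, 0, q3, q2, q1, q0]]"
proof -
  have "sylvester_mat [:p0, p1, p2, p3:] [:q0, q1, q2, q3:] = mat_of_rows_list 6
    [[p3, p2, p1, p0, 0, 0], [0, p3, p2, p1, p0, 0], [0, 0, p3, p2, p1, p0],
     [q3, q2, q1, q0, 0, 0], [0, q3, q2, q1, q0, 0], [0, 0, q3, q2, q1, q0]]"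
    by (rule eq_matI) (use assms in \<open>auto simp: sylvester_mat_def sylvester_mat_sub_def
      mat_of_rows_list_def
      less_Suc_eq numeral_eq_Suc\<close>)
  then show ?thesis unfolding resultant_def by (simp only:) (rule det_mat_of_rows_list; auto)
qed

lemma poly_discriminant_cubic:
  fixes p0 p1 p2 p3 :: "'a::field_char_0"
  assumes "p3 \<noteq> 0"
  shows "poly_discriminant [:p0, p1, p2, p3:] = p2^2*p1^2 - 4*p3*p1^3 - 4*p2^3*p0 - 27*p3^2*p0^2
    + 18*p3*p2*p1*p0"
proof -
  have pd: "pderiv [:p0, p1, p2, p3:] = [:p1, 2*p2, 3*p3:]"
    by (simp add: pderiv_pCons)
  have nz: "3 * p3 \<noteq> 0" using assms by simp
  \<comment> \<open>The factor \<open>- p3\<close> cancels against the sign \<open>(-1)^3\<close>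
    and the division by the leading coefficient in \<open>poly_discriminant\<close>.\<close>
  have "resultant [:p0, p1, p2, p3:] [:p1, 2*p2, 3*p3:] =
    - p3 * (p2^2*p1^2 - 4*p3*p1^3 - 4*p2^3*p0 - 27*p3^2*p0^2 + 18*p3*p2*p1*p0)"
    unfolding resultant_cubic_quadratic[OF assms nz]
    by (simp only: list_det_eval list_det.simps(2)[of r "[s1, s2, s3, s4]" for r s1 s2 s3 s4],
      simp only: list_det_eval list_det.simps(2)[of r "[s1, s2, s3]" for r s1 s2 s3], simp only:
      list_det_eval list_det.simps(2)[of r "[s1, s2]" for r s1 s2], simp only: list_det_eval
      list_det.simps(2)[of r "[s1]" for r s1], simp only: list_det_eval list_det.simps(2)[of r
      "[]" for r], Groebner_Basis.algebra)
  moreover have "degree [:p0, p1, p2, p3:] = 3" "lead_coeff [:p0, p1, p2, p3:] = p3" using assms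
    by simp_all
  ultimately show ?thesis using assms unfolding poly_discriminant_def pd by (simp add: field_simps)
qed

lemma resultant_family:
  fixes a b :: "'a::field_char_0"
  shows "resultant [:1, b, a, 1:] [:1, 2 * b, b^2, 4:] = - (4*a^3 - a^2*b^2 - 18*a*b + 4*b^3 + 27)"
proof -
  have nz: "(1::'a) \<noteq> 0" "(4::'a) \<noteq> 0" by simp_all
  show ?thesis unfolding resultant_cubic_cubic[OF nz]
    by (simp only: list_det_eval list_det.simps(2)[of r "[s1, s2, s3, s4, s5]" for r s1 s2 s3 s4
      s5],
      simp only: list_det_eval list_det.simps(2)[of r "[s1, s2, s3, s4]" for r s1 s2 s3 s4],
      simp only: list_det_eval list_det.simps(2)[of r "[s1, s2, s3]" for r s1 s2 s3],
      simp only: list_det_eval list_det.simps(2)[of r "[s1, s2]" for r s1 s2],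
      simp only: list_det_eval list_det.simps(2)[of r "[s1]" for r s1],
      simp only: list_det_eval list_det.simps(2)[of r "[]" for r], Groebner_Basis.algebra)
qed

section \<open>The invariants of the family\<close>

lemma monic_cubic_splits:
  fixes c0 c1 c2 :: "'a::alg_closed_field"
  obtains x1 x2 x3 where "x1 + x2 + x3 = - c2" "x1 * x2 + x1 * x3 + x2 * x3 = c1" "x1 * x2 * x3 =
    - c0"
proof -
  let ?p = "[:c0, c1, c2, 1:]"
  have lc: "lead_coeff ?p = 1" "degree ?p = 3" by simp_all
  have "?p \<noteq> 0" by simp
  then obtain A where A: "size A = degree ?p" "?p = smult (lead_coeff ?p) (\<Prod>x\<in>#A. [:-x, 1:])"
    using alg_closed_imp_factorization by blast
  obtain xs where xs: "mset xs = A" using ex_mset by blast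
  with A(1) lc(2) have "length xs = 3" by auto
  then obtain x1 x2 x3 where "xs = [x1, x2, x3]"
    by (auto simp: numeral_eq_Suc length_Suc_conv)
  with A(2) lc(1) xs have p: "?p = [:-x1, 1:] * ([:-x2, 1:] * [:-x3, 1:])" by auto
  show ?thesis
  proof
    show "x1 + x2 + x3 = - c2" using arg_cong[OF p, of "\<lambda>p. coeff p 2"]
      by (simp add: numeral_eq_Suc)
    show "x1 * x2 + x1 * x3 + x2 * x3 = c1" using arg_cong[OF p, of "\<lambda>p. coeff p 1"]
      by (simp add: algebra_simps)
    show "x1 * x2 * x3 = - c0" using arg_cong[OF p, of "\<lambda>p. coeff p 0"]
      by (simp add: algebra_simps)
  qed
qed

lemma prod_differences_6:
  fixes \<alpha> :: "nat \<Rightarrow> 'a::idom"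
  shows "(\<Prod>j\<in>{1..6}. \<Prod>i\<in>{1..<j}. (\<alpha> i - \<alpha> j)^2) = triangle (\<alpha> 1) (\<alpha> 2) (\<alpha> 3) * triangle (\<alpha> 4) (\<alpha>
    5) (\<alpha> 6) *
    ((\<alpha> 1 - \<alpha> 4) * (\<alpha> 1 - \<alpha> 5) * (\<alpha> 1 - \<alpha> 6) * ((\<alpha> 2 - \<alpha> 4) * (\<alpha> 2 - \<alpha> 5) * (\<alpha> 2 - \<alpha> 6))
     * ((\<alpha> 3 - \<alpha> 4) * (\<alpha> 3 - \<alpha> 5) * (\<alpha> 3 - \<alpha> 6)))^2"
proof -
  have s: "{1..<1} = ({} :: nat set)" "{1..<2} = {1::nat}" "{1..<3} = {1, 2::nat}"
    "{1..<4} = {1, 2, 3::nat}"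
    "{1..<5} = {1, 2, 3, 4::nat}" "{1..<6} = {1, 2, 3, 4, 5::nat}" by auto
  have "triangle (\<alpha> 1) (\<alpha> 2) (\<alpha> 3) = (\<alpha> 1 - \<alpha> 2)^2 * (\<alpha> 2 - \<alpha> 3)^2 * (\<alpha> 1 - \<alpha> 3)^2"
    "triangle (\<alpha> 4) (\<alpha> 5) (\<alpha> 6) = (\<alpha> 4 - \<alpha> 5)^2 * (\<alpha> 5 - \<alpha> 6)^2 * (\<alpha> 4 - \<alpha> 6)^2"
    by (simp_all only: triangle_def power2_commute[of "\<alpha> 3" "\<alpha> 1"] power2_commute[of "\<alpha> 6" "\<alpha> 4"])
  then show ?thesis
    unfolding atLeastAtMost_1_6
    by (simp add: s power_mult_distrib mult_ac del: One_nat_def)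
qed

section \<open>From the reversed cubics to the sextic\<close>

context
  fixes a b x1 x2 x3 y1 y2 y3 :: "'a::field_char_0"
  assumes ex: "x1 + x2 + x3 = - b" "x1 * x2 + x1 * x3 + x2 * x3 = a" "x1 * x2 * x3 = - 1"
    and ey: "y1 + y2 + y3 = - (2 * b)" "y1 * y2 + y1 * y3 + y2 * y3 = b^2" "y1 * y2 * y3 = - 4"
begin

lemma roots_nonzero: "x1 \<noteq> 0" "x2 \<noteq> 0" "x3 \<noteq> 0" "y1 \<noteq> 0" "y2 \<noteq> 0" "y3 \<noteq> 0"
  using ex(3) ey(3) by auto

lemma roots_prod: "x1 * x2 * x3 * y1 * y2 * y3 = 4"
proof -
  have "x1 * x2 * x3 * y1 * y2 * y3 = (x1 * x2 * x3) * (y1 * y2 * y3)" by (simp only: mult.assoc)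
  then show ?thesis unfolding ex(3) ey(3) by simp
qed

text \<open>The roots of the sextic are the inverses of those of the reversed cubics; up to a
  constant, each inverse is the product of the other two roots of its cubic.\<close>

lemma sextic_factorization:
  "[:1, b, a, 1:] * [:1, 2 * b, b^2, 4:] = smult 4 ([:- inverse x1, 1:] * ([:- inverse x2, 1:] *
    ([:- inverse x3, 1:] *
     ([:- inverse y1, 1:] * ([:- inverse y2, 1:] * [:- inverse y3, 1:])))))"
proof -
  have i: "inverse x1 = - (x2 * x3)" "inverse x2 = - (x1 * x3)" "inverse x3 = - (x1 * x2)"
    by (rule inverse_unique; use ex(3) in \<open>simp add: mult_ac\<close>)+
  have j: "inverse y1 = - (y2 * y3 / 4)" "inverse y2 = - (y1 * y3 / 4)" "inverse y3 =
    - (y1 * y2 / 4)"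
    by (rule inverse_unique; use ey(3) in \<open>simp add: mult_ac\<close>)+
  have "[:1, b, a, 1:] = [:x2 * x3, 1:] * ([:x1 * x3, 1:] * [:x1 * x2, 1:])"
  proof -
    have "1 = x2 * x3 * (x1 * x3 * (x1 * x2))" using ex(3) by Groebner_Basis.algebra
    moreover have "b = x2 * x3 * (x1 * x3 + x1 * x2) + x1 * x3 * (x1 * x2)" using ex by
      Groebner_Basis.algebra
    moreover have "a = x2 * x3 + (x1 * x3 + x1 * x2)" using ex(2) by (simp add: algebra_simps)
    ultimately show ?thesis by (simp add: algebra_simps)
  qed
  moreover have "[:1, 2 * b, b^2, 4:] = smult 4 ([:y2 * y3 / 4, 1:] * ([:y1 * y3 / 4, 1:] * [:y1 *
    y2 / 4, 1:]))"
  proof -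
    have b: "8 * b = y2 * y3 * (y1 * y3 + y1 * y2) + y1 * y3 * (y1 * y2)" using ey by
      Groebner_Basis.algebra
    have "16 = y2 * y3 * (y1 * y3 * (y1 * y2))" using ey(3) by Groebner_Basis.algebra
    moreover have "32 * b = 4 * (y2 * y3 * (y1 * y3 + y1 * y2)
      + y1 * y3 * (y1 * y2))" unfolding b[symmetric] by simp
    moreover have "b^2 = y2 * y3 + (y1 * y3 + y1 * y2)" using ey(2) by (simp add: algebra_simps)
    ultimately show ?thesis by (simp add: field_simps)
  qed
  ultimately show ?thesis unfolding i j minus_minus
    by (simp only: mult_smult_left mult_smult_right mult.assoc)
qed

text \<open>The six roots of the reversed cubics have product 4, which is also the leading
  coefficient of the sextic. The factors \<open>4^2\<close>, \<open>4^4\<close>, \<open>4^6\<close>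
  in the invariants therefore cancel exactly against those caused by inversion.\<close>

lemma split_sums_inverse:
  "16 * split_sum matchings (inverse x1) (inverse x2) (inverse x3) (inverse y1) (inverse y2)
    (inverse y3) =
     split_sum matchings x1 x2 x3 y1 y2 y3" (is ?J2)
  "4^4 * split_sum (\<lambda>x1 x2 x3 y1 y2 y3. triangle x1 x2 x3 * triangle y1 y2 y3)
     (inverse x1) (inverse x2) (inverse x3) (inverse y1) (inverse y2) (inverse y3) =
     split_sum (\<lambda>x1 x2 x3 y1 y2 y3. triangle x1 x2 x3 * triangle y1 y2 y3) x1 x2 x3 y1 y2 y3" (is
       ?J4)
  "4^6 * split_sum (\<lambda>x1 x2 x3 y1 y2 y3. triangle x1 x2 x3 * triangle y1 y2 y3 * matchings x1 x2 x3
    y1 y2 y3)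
     (inverse x1) (inverse x2) (inverse x3) (inverse y1) (inverse y2) (inverse y3) =
     split_sum (\<lambda>x1 x2 x3 y1 y2 y3. triangle x1 x2 x3 * triangle y1 y2 y3 * matchings x1 x2 x3 y1
       y2 y3) x1 x2 x3 y1 y2 y3" (is ?J6)
proof -
  have m: "matchings (inverse p1) (inverse p2) (inverse p3) (inverse q1) (inverse q2) (inverse q3) =
      1 / 16 * matchings p1 p2 p3 q1 q2 q3" if P: "p1 * p2 * p3 * q1 * q2 * q3 = 4" for p1 p2 p3
        q1 q2 q3 :: 'a
    using matchings_inverse[of p1 p2 p3 q1 q2 q3] unfolding P by simp
  have t: "triangle (inverse p1) (inverse p2) (inverse p3) * triangle (inverse q1) (inverse q2)
    (inverse q3) =
      1 / 4^4 * (triangle p1 p2 p3 * triangle q1 q2 q3)" if P: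
        "p1 * p2 * p3 * q1 * q2 * q3 = 4" for p1 p2 p3 q1 q2 q3 :: 'a
  proof -
    have nz: "p1 \<noteq> 0" "p2 \<noteq> 0" "p3 \<noteq> 0" "q1 \<noteq> 0" "q2 \<noteq> 0" "q3 \<noteq> 0" using P by auto
    have pw: "(p1 * p2 * p3)^4 * (q1 * q2 * q3)^4 = 4^4"
      unfolding power_mult_distrib[symmetric] using P by (simp only: mult.assoc)
    show ?thesis unfolding triangle_inverse[OF nz(1-3)] triangle_inverse[OF nz(4-6)]
      times_divide_times_eq pw
      by simp
  qed
  show ?J2 using split_sum_scale[where f = matchings, OF m roots_prod] by (simp add: mult.commute)
  show ?J4 using split_sum_scale[where f = "\<lambda>x1 x2 x3 y1 y2 y3. triangle x1 x2 x3 * triangle y1 y2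
    y3", OF t roots_prod] by (simp add: mult.commute)
  have tm: "triangle (inverse p1) (inverse p2) (inverse p3) * triangle (inverse q1) (inverse q2)
    (inverse q3)
      * matchings (inverse p1) (inverse p2) (inverse p3) (inverse q1) (inverse q2) (inverse q3) =
      1 / 4^6 * (triangle p1 p2 p3 * triangle q1 q2 q3 * matchings p1 p2 p3 q1 q2 q3)"
    if P: "p1 * p2 * p3 * q1 * q2 * q3 = 4" for p1 p2 p3 q1 q2 q3 :: 'a
    unfolding t[OF P] m[OF P] by simp
  show ?J6 using split_sum_scale[where f = "\<lambda>x1 x2 x3 y1 y2 y3. triangle x1 x2 x3 * triangle y1 y2
    y3 * matchings x1 x2 x3 y1 y2 y3",
      OF tm roots_prod] by (simp add: mult.commute)
qed

lemma discriminant_inverse: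
  "4^10 * (triangle (inverse x1) (inverse x2) (inverse x3) * triangle (inverse y1) (inverse y2)
    (inverse y3) *
    ((inverse x1 - inverse y1) * (inverse x1 - inverse y2) * (inverse x1 - inverse y3)
     * ((inverse x2 - inverse y1) * (inverse x2 - inverse y2) * (inverse x2 - inverse y3))
     * ((inverse x3 - inverse y1) * (inverse x3 - inverse y2) * (inverse x3 - inverse y3)))^2) =
   - 16 * (b^3 - 27) * cov_Z a b ^ 3"
proof -
  note nz = roots_nonzero
  have d: "inverse s - inverse r = - ((s - r) / (s * r))" if "s \<noteq> 0" "r \<noteq> 0" for s r :: 'a
    using that by (simp add: field_simps)
  have "(inverse x1 - inverse y1) * (inverse x1 - inverse y2) * (inverse x1 - inverse y3)
     * ((inverse x2 - inverse y1) * (inverse x2 - inverse y2) * (inverse x2 - inverse y3))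
     * ((inverse x3 - inverse y1) * (inverse x3 - inverse y2) * (inverse x3 - inverse y3)) =
     - (((x1 - y1) * (x1 - y2) * (x1 - y3) * ((x2 - y1) * (x2 - y2) * (x2 - y3)) * ((x3 - y1)
       * (x3 - y2) * (x3 - y3)))
       / ((x1 * x2 * x3)^3 * (y1 * y2 * y3)^3))"
    unfolding d[OF nz(1,4)] d[OF nz(1,5)] d[OF nz(1,6)] d[OF nz(2,4)] d[OF nz(2,5)] d[OF nz(2,6)]
      d[OF nz(3,4)] d[OF nz(3,5)] d[OF nz(3,6)]
    by (simp add: power3_eq_cube mult_ac)
  \<comment> \<open>Each root occurs in three of the nine differences, so the denominator is
    \<open>(-1)^3 * (-4)^3 = 64\<close>; nine sign changes leave one minus sign.\<close>
  also have "\<dots> = - (cov_Z a b / 64)"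
    unfolding prod_differences[OF ex ey] ex(3) ey(3) by simp
  finally have e: "(inverse x1 - inverse y1) * (inverse x1 - inverse y2) * (inverse x1 - inverse y3)
     * ((inverse x2 - inverse y1) * (inverse x2 - inverse y2) * (inverse x2 - inverse y3))
     * ((inverse x3 - inverse y1) * (inverse x3 - inverse y2) * (inverse x3 - inverse y3)) =
       - (cov_Z a b / 64)" .
  have "4^10 * (- z / (- 1)^4 * (16 * s / (- 4)^4) * (- (z / 64))^2) = - 16 * s * z^3" for z s :: 'a
    by (simp add: power2_eq_square power3_eq_cube)
  then show ?thesis
    unfolding e triangle_inverse[OF nz(1-3)] triangle_inverse[OF nz(4-6)]
      triangle_family[OF ex ey] ex(3) ey(3) .
qed

end

text
  \<open>The factors \<open>c2\<close>, \<open>c4\<close>, \<open>c6\<close> come from the orders of the stabilizers, which are not computed.\<close>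

lemma igusa_family:
  fixes a b :: "'a::{alg_closed_field, field_char_0}"
  defines "f \<equiv> [:1, b, a, 1:] * [:1, 2 * b, b^2, 4:]"
  obtains c2 c4 c6 where "c2 \<in> \<rat>" "c2 \<noteq> 0" "c4 \<in> \<rat>" "c4 \<noteq> 0" "c6 \<in> \<rat>" "c6 \<noteq> 0"
    "igusa_J2 f = c2 * (3 * cov_w a b ^ 2 - 2 * cov_T a b ^ 2)"
    "igusa_J4 f = c4 * (cov_T a b ^ 4 - 48 * (3 * cov_w a b + 4 * cov_T a b) * cov_Z a b)"
    "igusa_J6 f = c6 * (cov_T a b ^ 4 * (4 * cov_w a b ^ 2 - 3 * cov_T a b ^ 2)
      + 8 * (40 * cov_T a b ^ 3 + 21 * cov_T a b ^ 2 * cov_w a b - 96 * cov_T a b * cov_w a b ^ 2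
        - 72 * cov_w a b ^ 3) * cov_Z a b
      - 288 * cov_Z a b ^ 2)"
    "igusa_J10 f = - 16 * (b^3 - 27) * cov_Z a b ^ 3"
proof -
  obtain x1 x2 x3 where ex: "x1 + x2 + x3 = - b" "x1 * x2 + x1 * x3 + x2 * x3 = a" "x1 * x2 * x3 =
    - 1"
    by (rule monic_cubic_splits)
  obtain y1 y2 y3 where ey: "y1 + y2 + y3 = - (2 * b)" "y1 * y2 + y1 * y3 + y2 * y3 = b^2"
    "y1 * y2 * y3 = - 4"
    by (rule monic_cubic_splits)
  define \<alpha> where "\<alpha> = (\<lambda>n::nat. if n = 1 then inverse x1 else if n = 2 then inverse x2 else if n =
    3 then inverse x3
    else if n = 4 then inverse y1 else if n = 5 then inverse y2 else inverse y3)"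
  have \<alpha>: "\<alpha> 1 = inverse x1" "\<alpha> 2 = inverse x2" "\<alpha> 3 = inverse x3"
    "\<alpha> 4 = inverse y1" "\<alpha> 5 = inverse y2" "\<alpha> 6 = inverse y3" by (simp_all add: \<alpha>_def)
  have "(\<Prod>i\<in>{1..6}. [:- \<alpha> i, 1:]) = [:- \<alpha> 1, 1:] * ([:- \<alpha> 2, 1:] * ([:- \<alpha> 3, 1:] *
     ([:- \<alpha> 4, 1:] * ([:- \<alpha> 5, 1:] * [:- \<alpha> 6, 1:]))))"
    unfolding atLeastAtMost_1_6 by (simp del: mult_pCons_left mult_pCons_right One_nat_def)
  then have f: "f = smult 4 (\<Prod>i\<in>{1..6}. [:- \<alpha> i, 1:])"
    unfolding f_def sextic_factorization[OF ex ey] \<alpha> by (simp only:)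
  have "(4::'a) \<noteq> 0" by simp
  note J = igusa_clebsch_eq[OF f this]
  have quot: "X = of_nat n / of_nat m * Y" if "m > 0" "of_nat m * X = of_nat n * Y" for m n and X
    Y :: 'a
    using that by (simp add: field_simps)
  obtain m2 n2 where 2: "m2 > 0" "n2 > 0" "of_nat m2 * orbit_sum \<alpha> {{1, 2}, {3, 4}, {5, 6}}
    = of_nat n2 * split_sum matchings (\<alpha> 1) (\<alpha> 2) (\<alpha> 3) (\<alpha> 4) (\<alpha> 5) (\<alpha> 6)"
    by (rule orbit_sum_matching)
  obtain m4 n4 where 4: "m4 > 0" "n4 > 0" "of_nat m4 * orbit_sum \<alpha> {{1, 2}, {2, 3}, {3, 1}, {4,
    5}, {5, 6}, {6, 4}}
    = of_nat n4 * split_sum (\<lambda>x1 x2 x3 y1 y2 y3. triangle x1 x2 x3 * triangle y1 y2 y3)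
        (\<alpha> 1) (\<alpha> 2) (\<alpha> 3) (\<alpha> 4) (\<alpha> 5) (\<alpha> 6)"
    by (rule orbit_sum_triangles)
  obtain m6 n6 where 6: "m6 > 0" "n6 > 0" "of_nat m6 * orbit_sum \<alpha> {{1, 2}, {2, 3}, {3, 1}, {4,
    5}, {5, 6}, {6, 4}, {1, 4}, {2, 5}, {3, 6}}
    = of_nat n6 * split_sum (\<lambda>x1 x2 x3 y1 y2 y3. triangle x1 x2 x3 * triangle y1 y2 y3 * matchings
      x1 x2 x3 y1 y2 y3)
        (\<alpha> 1) (\<alpha> 2) (\<alpha> 3) (\<alpha> 4) (\<alpha> 5) (\<alpha> 6)"
    by (rule orbit_sum_prism)
  note inv = split_sums_inverse[OF ex ey]
  show ?thesis
  \<comment> \<open>The constants 8, 1/4 and 1/8 come from the evaluations of the three split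
    sums.\<close>
  proof (rule that[of "of_nat n2 / of_nat m2 * 8" "of_nat n4 / of_nat m4 / 4"
    "of_nat n6 / of_nat m6 / 8"])
    have "igusa_J2 f = of_nat n2 / of_nat m2 * (16 * split_sum matchings (\<alpha> 1) (\<alpha> 2) (\<alpha> 3) (\<alpha> 4)
      (\<alpha> 5) (\<alpha> 6))"
      unfolding J(1) quot[OF 2(1,3)] by simp
    also have "\<dots> = of_nat n2 / of_nat m2 * (8 * (3 * cov_w a b ^ 2 - 2 * cov_T a b ^ 2))"
      unfolding \<alpha> inv(1) split_sum_matchings[OF ex ey] ..
    finally show "igusa_J2 f = of_nat n2 / of_nat m2 * 8 * (3 * cov_w a b ^ 2 - 2 * cov_T a b ^ 2)"
      by (simp only: mult.assoc)
    have "igusa_J4 f = of_nat n4 / of_nat m4 / 4 * (4 * (4^4 * split_sum (\<lambda>x1 x2 x3 y1 y2 y3.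
      triangle x1 x2 x3 * triangle y1 y2 y3)
        (\<alpha> 1) (\<alpha> 2) (\<alpha> 3) (\<alpha> 4) (\<alpha> 5) (\<alpha> 6)))"
      unfolding J(2) quot[OF 4(1,3)] by simp
    then show "igusa_J4 f = of_nat n4 / of_nat m4 / 4 *
        (cov_T a b ^ 4 - 48 * (3 * cov_w a b + 4 * cov_T a b) * cov_Z a b)"
      unfolding \<alpha> inv(2) split_sum_triangles[OF ex ey] .
    have "igusa_J6 f = of_nat n6 / of_nat m6 / 8 * (8 * (4^6 * split_sum (\<lambda>x1 x2 x3 y1 y2 y3.
      triangle x1 x2 x3 * triangle y1 y2 y3 * matchings x1 x2 x3 y1 y2 y3)
        (\<alpha> 1) (\<alpha> 2) (\<alpha> 3) (\<alpha> 4) (\<alpha> 5) (\<alpha> 6)))"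
      unfolding J(3) quot[OF 6(1,3)] by simp
    then show "igusa_J6 f = of_nat n6 / of_nat m6 / 8 * (cov_T a b ^ 4 * (4 * cov_w a b ^ 2
      - 3 * cov_T a b ^ 2)
      + 8 * (40 * cov_T a b ^ 3 + 21 * cov_T a b ^ 2 * cov_w a b - 96 * cov_T a b * cov_w a b ^ 2
        - 72 * cov_w a b ^ 3) * cov_Z a b
      - 288 * cov_Z a b ^ 2)"
      unfolding \<alpha> inv(3) split_sum_prism[OF ex ey] .
    show "igusa_J10 f = - 16 * (b^3 - 27) * cov_Z a b ^ 3"
      unfolding J(4) prod_differences_6 \<alpha> by (rule discriminant_inverse[OF ex ey])
  qed (use 2 4 6 in auto)
qed

section \<open>Recovering the parameters\<close>

text
  \<open>Solving the definition of \<open>A\<close> in \<open>elim_root\<close> below for \<open>q\<close> gives \<open>q = Q / (48 (3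
    + 4 t))\<close> with \<open>Q = t\<^sup>4 - A (3 - 2 t\<^sup>2)\<^sup>2\<close>. Substituting this into the definitions of \<open>B\<close> and \<open>C\<close>
    and clearing denominators yields the following two polynomials in \<open>t\<close>; \<open>110592 = 48\<^sup>3\<close>.\<close>

definition elim1 :: "'a::field \<Rightarrow> 'a \<Rightarrow> 'a poly" where
  "elim1 A B = (let Q = [:0, 0, 0, 0, 1:] - [:A:] * [:3, 0, -2:]^2 in
     24 * [:3, 4:]^2 * ([:0, 0, 0, 0, 4, 0, -3:] - [:B:] * [:3, 0, -2:]^3)
     + 4 * [:-72, -96, 21, 40:] * [:3, 4:] * Q - 3 * Q^2)"

definition elim2 :: "'a::field \<Rightarrow> 'a \<Rightarrow> 'a poly" where
  "elim2 A C = (let Q = [:0, 0, 0, 0, 1:] - [:A:] * [:3, 0, -2:]^2 in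
     [:1, 1:] * Q^3 - [:110592 * C:] * [:3, 4:]^3 * [:3, 0, -2:]^5)"

text \<open>The bounds are uniform in the parameters, so they can serve as formal degrees both
  generically and at the special point.\<close>

lemma degree_elim:
  fixes A B C :: "'a::field_char_0"
  shows "degree (elim1 A B) \<le> 8" "degree (elim2 A C) \<le> 13"
proof -
  define Q :: "'a poly" where "Q = [:0, 0, 0, 0, 1:] - [:A:] * [:3, 0, -2:]^2"
  have m: "degree (p * q) \<le> i + j" if "degree p \<le> i" "degree q \<le> j" for p q :: "'a poly" and i j
    using degree_mult_le[of p q] that by linarith
  have p: "degree (p ^ n) \<le> i * n" if "degree p \<le> i" for p :: "'a poly" and i n
    using degree_power_le[of p n] that by (meson le_trans mult_le_mono1)
  have d: "degree [:A:] \<le> 0" "degree [:B:] \<le> 0" "degree [:110592 * C:] \<le> 0"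
    "degree [:3, 0, -2:: 'a:] \<le> 2"
    "degree [:3, 4 :: 'a:] \<le> 1" "degree [:1, 1 :: 'a:] \<le> 1" "degree [:0, 0, 0, 0, 1 :: 'a:] \<le> 4"
    "degree [:0, 0, 0, 0, 4, 0, -3 :: 'a:] \<le> 6" "degree [:-72, -96, 21, 40 :: 'a:] \<le> 3"
    "degree (24 :: 'a poly) \<le> 0" "degree (4 :: 'a poly) \<le> 0" "degree (3 :: 'a poly) \<le> 0"
    by (simp_all add: numeral_poly)
  have Q: "degree Q \<le> 4"
    unfolding Q_def using m[OF d(1) p[OF d(4), of 2]] d(7) by (intro degree_diff_le) auto
  have 1: "degree ([:0, 0, 0, 0, 4, 0, -3:] - [:B:] * [:3, 0, -2:]^3) \<le> 6"
    using m[OF d(2) p[OF d(4), of 3]] d(8) by (intro degree_diff_le) auto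
  show "degree (elim1 A B) \<le> 8"
    unfolding elim1_def Let_def Q_def[symmetric]
    using m[OF m[OF d(10) p[OF d(5), of 2]] 1] m[OF m[OF m[OF d(11) d(9)] d(5)] Q] m[OF d(12)
      p[OF Q, of 2]]
    by (intro degree_diff_le degree_add_le) auto
  show "degree (elim2 A C) \<le> 13"
    unfolding elim2_def Let_def Q_def[symmetric]
    using m[OF d(6) p[OF Q, of 3]] m[OF m[OF d(3) p[OF d(5), of 3]] p[OF d(4), of 5]]
    by (intro degree_diff_le) auto
qed

lemma poly_over_elim:
  assumes K: "is_subfield K" and "A \<in> K" "B \<in> K" "C \<in> K"
  shows "poly_over K (elim1 A B)" "poly_over K (elim2 A C)"
  unfolding elim1_def elim2_def Let_def
  using assms by (intro poly_over_intros K; simp add: is_subfield_closed)+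

lemma elim_root:
  fixes t q A B C :: "'a::field_char_0"
  assumes n: "3 - 2 * t^2 \<noteq> 0"
    and A: "A = (t^4 - 48 * (3 + 4 * t) * q) / (3 - 2 * t^2)^2"
    and B: "B = (t^4 * (4 - 3 * t^2) + 8 * (40 * t^3 + 21 * t^2 - 96 * t - 72) * q
      - 288 * q^2) / (3 - 2 * t^2)^3"
    and C: "C = (t + 1) * q^3 / (3 - 2 * t^2)^5"
  shows "poly (elim1 A B) t = 0" "poly (elim2 A C) t = 0"
proof -
  have A': "A * (3 - 2 * t^2)^2 = t^4 - 48 * (3 + 4 * t) * q" unfolding A using n by simp
  have B': "B * (3 - 2 * t^2)^3 = t^4 * (4 - 3 * t^2) + 8 * (40 * t^3 + 21 * t^2 - 96 * t
    - 72) * q - 288 * q^2"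
    unfolding B using n by simp
  have C': "C * (3 - 2 * t^2)^5 = (t + 1) * q^3" unfolding C using n by simp
  have p: "poly [:3, 0, -2:] t = 3 - 2 * t^2" "poly [:0, 0, 0, 0, 1:] t = t^4"
    "poly [:3, 4:] t = 3 + 4 * t"
    "poly [:0, 0, 0, 0, 4, 0, -3:] t = 4 * t^4 - 3 * t^6" "poly [:1, 1:] t = t + 1"
    "poly [:-72, -96, 21, 40:] t = 40 * t^3 + 21 * t^2 - 96 * t - 72"
    by (simp_all add: algebra_simps eval_nat_numeral)
  have pc: "poly [:c:] t = c" for c :: 'a by simp
  show "poly (elim1 A B) t = 0"
    unfolding elim1_def Let_def poly_add poly_diff poly_mult poly_power p pc
      poly_numeral A' B' by Groebner_Basis.algebra
  have "poly (elim2 A C) t = (t + 1) * (48 * (3 + 4 * t) * q)^3 - 110592 * (3 + 4 * t)^3 * (C * (3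
    - 2 * t^2)^5)"
    unfolding elim2_def Let_def poly_add poly_diff poly_mult poly_power p pc A' by (simp add:
      mult_ac)
  then show "poly (elim2 A C) t = 0" unfolding C' by Groebner_Basis.algebra
qed

context bivariate_place begin

lemma poly_spec_elim:
  assumes s: "spec A A'" "spec B B'" "spec C C'"
  shows "poly_spec (elim1 A B) (elim1 A' B')" "poly_spec (elim2 A C) (elim2 A' C')"
  unfolding elim1_def elim2_def Let_def by (intro poly_spec_intros spec_intros s)+

end

text
  \<open>The place \<open>(a, b) = (57, 3)\<close> is chosen on the curve \<open>b\<^sup>3 = 27\<close>, where \<open>J\<^sub>1\<^sub>0\<close> vanishes, and there
    \<open>(t, q) = (-1, -1/48)\<close> makes \<open>A\<close> and \<open>C\<close> vanish: the cofactor of \<open>X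
    - t\<close> in the second polynomial specializes to \<open>X ^ 12\<close>.\<close>

lemma elim_generates:
  fixes K L :: "'a::{alg_closed_field, field_char_0} set"
  assumes K: "is_subfield K" and indep: "independent_transcendentals K a b" and L: "is_subfield L"
    and t: "specializes K (a, b) (57, 3) t (-1)" and q: "specializes K (a, b) (57, 3) q (-1/48)"
    and A: "A = (t^4 - 48 * (3 + 4 * t) * q) / (3 - 2 * t^2)^2"
    and B: "B = (t^4 * (4 - 3 * t^2) + 8 * (40 * t^3 + 21 * t^2 - 96 * t - 72) * q
      - 288 * q^2) / (3 - 2 * t^2)^3"
    and C: "C = (t + 1) * q^3 / (3 - 2 * t^2)^5"
    and mem: "A \<in> L" "B \<in> L" "C \<in> L"
  shows "t \<in> L" "q \<in> L"
proof -
  interpret bivariate_place K a b 57 3 by unfold_locales (rule K indep)+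
  have n: "spec (3 - 2 * t^2) 1"
    using spec_diff[OF spec_numeral[of "num.Bit1 num.One"] spec_mult[OF spec_numeral[of
      "num.Bit0 num.One"] spec_power[OF t, of 2]]]
    by simp
  have n0: "3 - 2 * t^2 \<noteq> 0" by (rule spec_nonzero[OF n]) simp
  have d: "spec (3 + 4 * t) (3 + 4 * (- 1))" by (intro spec_intros t)
  have d0: "3 + 4 * t \<noteq> 0" by (rule spec_nonzero[OF d]) simp
  have sA: "spec A 0"
  proof -
    have "spec A (((-1)^4 - 48 * (3 + 4 * (-1)) * (-1/48)) / 1^2)"
      unfolding A by (intro spec_divide spec_intros t q n) simp
    then show ?thesis by simp
  qed
  have sB: "spec B (1/24)"
  proof -
    have "spec B (((-1)^4 * (4 - 3 * (-1)^2) + 8 * (40 * (-1)^3 + 21 * (-1)^2 - 96 * (-1)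
      - 72) * (-1/48) - 288 * (-1/48)^2) / 1^3)"
      unfolding B by (intro spec_divide spec_intros t q n) simp
    also have "((-1)^4 * (4 - 3 * (-1)^2) + 8 * (40 * (-1)^3 + 21 * (-1)^2 - 96 * (-1)
      - 72) * (-1/48) - 288 * (-1/48)^2) / 1^3 = (1/24 :: 'a)"
      by (simp add: power2_eq_square)
    finally show ?thesis .
  qed
  have sC: "spec C 0"
  proof -
    have "spec C ((- 1 + 1) * (-1/48)^3 / 1^5)"
      unfolding C by (intro spec_divide spec_intros t q n) simp
    then show ?thesis by simp
  qed
  have root: "poly (elim1 A B) t = 0" "poly (elim2 A C) t = 0" by (rule elim_root[OF n0 A B C])+
  then obtain p1 p2 where p: "elim1 A B = [:- t, 1:] * p1" "elim2 A C = [:- t, 1:] * p2"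
    by (auto simp: poly_eq_0_iff_dvd dvd_def)
  have "poly (elim1 0 (1/24)) (- 1 :: 'a) = 0"
    by (simp add: elim1_def Let_def eval_nat_numeral)
  then obtain r1 :: "'a poly" where r1: "elim1 0 (1/24) = [:- (- 1), 1:] * r1"
    by (auto simp: poly_eq_0_iff_dvd dvd_def)
  have r2: "elim2 0 0 = [:- (- 1), 1:] * monom (1 :: 'a) 12"
  proof -
    have "[:0, 0, 0, 0, 1 :: 'a:] ^ 3 = monom 1 12"
    proof -
      have "[:0, 0, 0, 0, 1 :: 'a:] = monom 1 4" by (simp add: monom_altdef eval_nat_numeral)
      then show ?thesis by (simp only: monom_power) simp
    qed
    then show ?thesis by (simp add: elim2_def Let_def)
  qed
  note ps = poly_spec_elim[OF sA sB sC]
  have p1: "poly_spec p1 r1"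
    by (rule poly_spec_linear_cofactor[OF ps(1) p(1) r1 t, of 7]) (simp_all add: degree_elim)
  have p2: "poly_spec p2 (monom 1 12)"
    by (rule poly_spec_linear_cofactor[OF ps(2) p(2) r2 t, of 12]) (simp_all add: degree_elim)
  have deg: "degree r \<le> N" if "degree ([:- s, 1:] * r) \<le> Suc N" for r :: "'a poly" and s N
    using that by (cases "r = 0") (simp_all add: degree_mult_eq del: mult_pCons_left)
  have "degree p1 \<le> 7"
    by (rule deg[of t], unfold p(1)[symmetric]) (use degree_elim(1)[of A B] in simp)
  moreover have "degree p2 \<le> 12"
    by (rule deg[of t], unfold p(2)[symmetric]) (use degree_elim(2)[of A C] in simp)
  \<comment> \<open>The cofactor \<open>X^12\<close> has only the root 0, so the specialized
    cofactors are coprime as soon as \<open>r1\<close> does not vanish at 0. As \<open>X + 1\<close>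
    has constant term 1, this value is that of \<open>elim1 0 (1/24)\<close> at 0.\<close>
  moreover have "coeff r1 0 \<noteq> 0"
  proof -
    have "coeff r1 0 = poly (elim1 0 (1/24)) 0" unfolding r1 by (simp add: poly_0_coeff_0)
    also have "\<dots> = - 243" by (simp add: elim1_def Let_def eval_nat_numeral)
    finally show ?thesis by simp
  qed
  ultimately have "\<not> (poly p1 x = 0 \<and> poly p2 x = 0)" for x
    by (intro spec_no_common_root[OF p1 p2])
  then show tL: "t \<in> L"
    by (intro common_root_mem_subfield[OF L poly_over_elim[OF L mem] p]) auto
  \<comment> \<open>Given \<open>t\<close>, the definition of \<open>A\<close> is linear in
    \<open>q\<close>, with coefficient a multiple of \<open>3 + 4 * t\<close>, which takes the value
    -1 at the place.\<close>
  have "t^4 - A * (3 - 2 * t^2)^2 = 48 * (3 + 4 * t) * q" unfolding A using n0 by simp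
  moreover have "48 * (3 + 4 * t) \<noteq> 0" unfolding mult_eq_0_iff using d0 by simp
  ultimately have "q = (t^4 - A * (3 - 2 * t^2)^2) / (48 * (3 + 4 * t))"
    by (metis nonzero_mult_div_cancel_left)
  then show "q \<in> L" using tL mem L by (simp add: is_subfield_closed)
qed

text \<open>With weights 1, 1, 3 for \<open>w\<close>, \<open>T\<close>, \<open>Z\<close>, the
  invariants \<open>J2\<close>, \<open>J4\<close>, \<open>J6\<close>, \<open>J10\<close> are
  isobaric of weights 2, 4, 6, 10. Substituting \<open>T = t * w\<close> and
  \<open>Z = q * w^3\<close> extracts powers of \<open>w\<close>, which cancel in the absolute
  invariants.\<close>

lemma abs_invariants_family:
  fixes a b t q :: "'a::{alg_closed_field, field_char_0}"
  defines "f \<equiv> [:1, b, a, 1:] * [:1, 2 * b, b^2, 4:]"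
  assumes w: "cov_w a b \<noteq> 0" and t: "cov_T a b = t * cov_w a b" and q:
    "cov_Z a b = q * cov_w a b ^ 3"
    and n: "3 - 2 * t^2 \<noteq> 0"
  obtains d1 d2 d3 d4 where "d1 \<in> \<rat>" "d1 \<noteq> 0" "d2 \<in> \<rat>" "d3 \<in> \<rat>" "d3 \<noteq> 0" "d4 \<in> \<rat>" "d4 \<noteq> 0"
    "igusa_J2 f \<noteq> 0"
    "abs_i1 f = d1 * ((t^4 - 48 * (3 + 4 * t) * q) / (3 - 2 * t^2)^2)"
    "abs_i2 f = d2 * ((t^4 - 48 * (3 + 4 * t) * q) / (3 - 2 * t^2)^2)
      + d3 * ((t^4 * (4 - 3 * t^2) + 8 * (40 * t^3 + 21 * t^2 - 96 * t - 72) * q - 288 * q^2) / (3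
        - 2 * t^2)^3)"
    "abs_i3 f = d4 * ((t + 1) * q^3 / (3 - 2 * t^2)^5)"
proof -
  obtain c2 c4 c6 where c: "c2 \<in> \<rat>" "c2 \<noteq> 0" "c4 \<in> \<rat>" "c4 \<noteq> 0" "c6 \<in> \<rat>" "c6 \<noteq> 0" and
    J: "igusa_J2 f = c2 * (3 * cov_w a b ^ 2 - 2 * cov_T a b ^ 2)"
    "igusa_J4 f = c4 * (cov_T a b ^ 4 - 48 * (3 * cov_w a b + 4 * cov_T a b) * cov_Z a b)"
    "igusa_J6 f = c6 * (cov_T a b ^ 4 * (4 * cov_w a b ^ 2 - 3 * cov_T a b ^ 2)
      + 8 * (40 * cov_T a b ^ 3 + 21 * cov_T a b ^ 2 * cov_w a b - 96 * cov_T a b * cov_w a b ^ 2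
        - 72 * cov_w a b ^ 3) * cov_Z a b
      - 288 * cov_Z a b ^ 2)"
    "igusa_J10 f = - 16 * (b^3 - 27) * cov_Z a b ^ 3"
    unfolding f_def by (rule igusa_family[of b a])
  let ?w = "cov_w a b"
  define A' where "A' = t^4 - 48 * (3 + 4 * t) * q"
  define B' where "B' = t^4 * (4 - 3 * t^2) + 8 * (40 * t^3 + 21 * t^2 - 96 * t - 72) * q
    - 288 * q^2"
  define m where "m = 3 - 2 * t^2"
  have J2: "igusa_J2 f = c2 * (?w^2 * m)" unfolding J(1) t m_def by Groebner_Basis.algebra
  have J4: "igusa_J4 f = c4 * (?w^4 * A')" unfolding J(2) t q A'_def by Groebner_Basis.algebra
  have J6: "igusa_J6 f = c6 * (?w^6 * B')" unfolding J(3) t q B'_def by Groebner_Basis.algebra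
  \<comment> \<open>This factor of \<open>J10\<close> equals \<open>w + T\<close>, so it supplies
    the tenth power of \<open>w\<close> besides \<open>w^9\<close> from \<open>Z^3\<close>.\<close>
  have "b^3 - 27 = ?w * (t + 1)"
  proof -
    have "b^3 - 27 = cov_T a b + ?w" by (simp add: cov_T_def cov_w_def)
    then show ?thesis unfolding t by (simp add: algebra_simps)
  qed
  then have J10: "igusa_J10 f = - 16 * (?w^10 * ((t + 1) * q^3))"
    unfolding J(4) q by Groebner_Basis.algebra
  have m0: "m \<noteq> 0" using n by (simp add: m_def)
  have w10: "(x::'a) ^ 10 = (x^2)^5" "x^4 = (x^2)^2" "x^6 = (x^2)^3" for x by (simp_all flip:
    power_mult)
  show ?thesis
  proof (rule that[of "144 * c4 / c2^2" "- 1728 * (c4 / c2^2)" "1728 * (3 * (c6 / c2^3))"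
    "486 * (- 16 / c2^5)"])
    show "igusa_J2 f \<noteq> 0" unfolding J2 using c(2) w m0 by simp
    define W where "W = ?w^2"
    have W: "W \<noteq> 0" using w by (simp add: W_def)
    have "abs_i1 f = 144 * (c4 * (W^2 * A')) / (c2 * (W * m))^2"
      unfolding abs_i1_def J2 J4 w10(2) W_def ..
    also have "\<dots> = 144 * c4 / c2^2 * (A' / m^2)"
      using c(2) W m0 by (simp add: field_simps power2_eq_square)
    finally show "abs_i1 f = 144 * c4 / c2^2 * ((t^4 - 48 * (3 + 4 * t) * q) / (3 - 2 * t^2)^2)"
      unfolding A'_def[symmetric] m_def[symmetric] .
    have "abs_i2 f = - 1728 * (c2 * (W * m) * (c4 * (W^2 * A'))
      - 3 * (c6 * (W^3 * B'))) / (c2 * (W * m))^3"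
      unfolding abs_i2_def J2 J4 J6 w10(2,3) W_def ..
    also have "\<dots> = - 1728 * (c4 / c2^2) * (A' / m^2) + 1728 * (3 * (c6 / c2^3)) * (B' / m^3)"
      using c(2) W m0 by (simp add: field_simps power2_eq_square power3_eq_cube)
    finally show "abs_i2 f = - 1728 * (c4 / c2^2) * ((t^4 - 48 * (3 + 4 * t) * q) / (3 - 2 * t^2)^2)
      + 1728 * (3 * (c6 / c2^3)) * ((t^4 * (4 - 3 * t^2) + 8 * (40 * t^3 + 21 * t^2 - 96 * t
        - 72) * q - 288 * q^2) / (3 - 2 * t^2)^3)"
      unfolding A'_def[symmetric] B'_def[symmetric] m_def[symmetric] .
    have "abs_i3 f = 486 * (- 16 * (W^5 * ((t + 1) * q^3))) / (c2 * (W * m))^5"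
      unfolding abs_i3_def J2 J10 w10(1) W_def ..
    also have "\<dots> = 486 * (- 16 / c2^5) * ((t + 1) * q^3 / m^5)"
      using c(2) W m0 by (simp add: power_mult_distrib)
    finally show "abs_i3 f = 486 * (- 16 / c2^5) * ((t + 1) * q^3 / (3 - 2 * t^2)^5)"
      unfolding m_def[symmetric] .
  qed (use c in \<open>auto intro!: Rats_mult Rats_divide Rats_power\<close>)
qed

text \<open>The ambient field is algebraically closed, so the sextic splits in it. Since division by
  zero yields 0, the nonvanishing clauses certify that every fraction defining an invariant is
  genuine.\<close>

theorem lemma8:
  fixes k :: "'a::{alg_closed_field, field_char_0} set"
    and a b u v :: 'a
    and F G :: "'a poly"
  assumes "alg_closed_subfield k"
    and "independent_transcendentals k a b"
    and "F = [:1, b, a, 1:]"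
    and "G = [:1, 2 * b, b\<^sup>2, 4:]"
    and "u = a * b"
    and "v = b ^ 3"
  shows "igusa_J2 (F * G) \<noteq> 0 \<and> resultant F G \<noteq> 0 \<and>
           poly_discriminant F \<noteq> 0 \<and> poly_discriminant G \<noteq> 0 \<and>
         {abs_i1 (F * G), abs_i2 (F * G), abs_i3 (F * G), cubic_r1 F G, cubic_r2 F G}
           \<subseteq> adjoin k {u, v} \<and>
         adjoin k {abs_i1 (F * G), abs_i2 (F * G), abs_i3 (F * G)} =
           adjoin k {cubic_r1 F G, cubic_r2 F G}"
proof -
  have k: "is_subfield k" using assms(1) by (simp add: alg_closed_subfield_def)
  interpret P: bivariate_place k a b 57 3 by unfold_locales (rule k assms(2))+
  interpret O: bivariate_place k a b 0 0 by unfold_locales (rule k assms(2))+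
  \<comment> \<open>At \<open>(57, 3)\<close> one has \<open>w = -324\<close>,
    \<open>T = 324\<close> and \<open>Z = 324^3 / 48\<close>, whence \<open>t = -1\<close> and
    \<open>q = -1/48\<close>.\<close>
  have "P.spec (cov_w a b) (3^3 - 2 * 57 * 3 - 9)" "P.spec (cov_T a b) (2 * 57 * 3 - 18)"
    "P.spec (cov_Z a b) (4 * 57^3 - 57^2 * 3^2 - 18 * 57 * 3 + 4 * 3^3 + 27)"
    unfolding cov_w_def cov_T_def cov_Z_def by (intro P.spec_intros P.spec_a P.spec_b)+
  then have s: "P.spec (cov_w a b) (- 324)" "P.spec (cov_T a b) 324" "P.spec (cov_Z a b) 708588"
    by simp_all
  define w where "w = cov_w a b"
  define t where "t = cov_T a b / w"
  define q where "q = cov_Z a b / w^3"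
  have w0: "w \<noteq> 0" unfolding w_def by (rule P.spec_nonzero[OF s(1)]) simp
  have Z0: "cov_Z a b \<noteq> 0" by (rule P.spec_nonzero[OF s(3)]) simp
  have st: "P.spec t (- 1)"
    using P.spec_divide[OF s(2,1)] by (simp add: t_def w_def)
  have sq: "P.spec q (- 1 / 48)"
    using P.spec_divide[OF s(3) P.spec_power[OF s(1), of 3]] by (simp add: q_def w_def)
  have n0: "3 - 2 * t^2 \<noteq> 0"
    using P.spec_nonzero[OF P.spec_diff[OF P.spec_numeral P.spec_mult[OF P.spec_numeral P.spec_power[OF st, of 2]]],
      of "num.Bit1 num.One" "num.Bit0 num.One"] by simp
  have b0: "b \<noteq> 0" by (rule P.spec_nonzero[OF P.spec_b]) simp
  \<comment> \<open>The point \<open>(57, 3)\<close> lies on \<open>b^3 = 27\<close>, so this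
    nonvanishing is tested at the origin.\<close>
  have "O.spec (b^3 - 27) (0^3 - 27)" by (intro O.spec_intros O.spec_b)
  then have S0: "b^3 - 27 \<noteq> 0" by (rule O.spec_nonzero) simp
  have S: "b^3 - 27 = w * (t + 1)"
    using w0 by (simp add: t_def w_def cov_T_def cov_w_def field_simps)
  have t1: "t + 1 \<noteq> 0" using S S0 by auto
  have q0: "q \<noteq> 0" using Z0 w0 by (simp add: q_def)
  have Z: "cov_Z a b = q * w^3" using w0 by (simp add: q_def)

  \<comment> \<open>The invariants of the pair of cubics in terms of \<open>t\<close> and
    \<open>q\<close>\<close>
  have res: "resultant F G = - cov_Z a b"
    unfolding assms(3,4) resultant_family cov_Z_def ..
  have dF: "poly_discriminant F = - cov_Z a b"
    unfolding assms(3) by (subst poly_discriminant_cubic) (simp_all add: cov_Z_def)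
  have dG: "poly_discriminant G = 16 * (b^3 - 27)"
    unfolding assms(4) by (subst poly_discriminant_cubic) (simp_all add: algebra_simps eval_nat_numeral)
  have H: "cubic_H F G = w / 3"
    unfolding assms(3,4) cubic_H_def w_def cov_w_def by (simp add: eval_nat_numeral field_simps)
  have r1: "cubic_r1 F G = - 1 / (27 * q)"
    unfolding cubic_r1_def H res Z using w0 q0 by (simp add: power_divide)
  have "(w / 3)^4 / (- (q * w^3) * (16 * (w * s))) = - 1 / (1296 * q * s)" if "s \<noteq> 0" for s
    using that w0 q0 by (simp add: power_divide field_simps eval_nat_numeral)
  then have r2: "cubic_r2 F G = - 1 / (1296 * q * (t + 1))"
    unfolding cubic_r2_def H dF dG Z S using t1 by blast

  \<comment> \<open>The absolute invariants in terms of \<open>A\<close>, \<open>B\<close>,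
    \<open>C\<close>\<close>
  define A where "A = (t^4 - 48 * (3 + 4 * t) * q) / (3 - 2 * t^2)^2"
  define B where "B = (t^4 * (4 - 3 * t^2) + 8 * (40 * t^3 + 21 * t^2 - 96 * t - 72) * q - 288 * q^2) / (3 - 2 * t^2)^3"
  define C where "C = (t + 1) * q^3 / (3 - 2 * t^2)^5"
  obtain d1 d2 d3 d4 where d: "d1 \<in> \<rat>" "d1 \<noteq> 0" "d2 \<in> \<rat>" "d3 \<in> \<rat>" "d3 \<noteq> 0" "d4 \<in> \<rat>" "d4 \<noteq> 0"
    and J2: "igusa_J2 (F * G) \<noteq> 0"
    and i: "abs_i1 (F * G) = d1 * A" "abs_i2 (F * G) = d2 * A + d3 * B" "abs_i3 (F * G) = d4 * C"
    unfolding assms(3,4) A_def B_def C_def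
    by (rule abs_invariants_family[of a b t q]) (use w0 n0 in \<open>simp_all add: t_def q_def w_def\<close>)

  let ?U = "adjoin k {u, v}" and ?L = "adjoin k {abs_i1 (F * G), abs_i2 (F * G), abs_i3 (F * G)}"
  let ?R = "adjoin k {cubic_r1 F G, cubic_r2 F G}"
  have U: "is_subfield ?U" and L: "is_subfield ?L" and R: "is_subfield ?R" by (rule is_subfield_adjoin)+
  have sub: "k \<subseteq> ?U" "k \<subseteq> ?L" "k \<subseteq> ?R" using adjoin_base by blast+
  have dM: "d1 \<in> M" "d2 \<in> M" "d3 \<in> M" "d4 \<in> M" if "is_subfield M" for M
    using Rats_subset_subfield[OF that] d by auto

  have r_mem: "cubic_r1 F G \<in> M" "cubic_r2 F G \<in> M" if "is_subfield M" "t \<in> M" "q \<in> M" for M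
    unfolding r1 r2 using that by (simp_all add: is_subfield_closed)

  \<comment> \<open>The inclusion of \<open>?L\<close> in \<open>?R\<close>\<close>
  have rR: "cubic_r1 F G \<in> ?R" "cubic_r2 F G \<in> ?R" by (auto intro: adjoin_gen)
  have "q = - 1 / (27 * cubic_r1 F G)" unfolding r1 using q0 by simp
  then have qR: "q \<in> ?R" using rR R by (simp add: is_subfield_closed)
  have "t = - 1 / (1296 * q * cubic_r2 F G) - 1" unfolding r2 using q0 t1 by (simp add: field_simps)
  then have tR: "t \<in> ?R" using rR qR R by (simp add: is_subfield_closed)
  have "A \<in> ?R" "B \<in> ?R" "C \<in> ?R"
    unfolding A_def B_def C_def using tR qR R by (simp_all add: is_subfield_closed)
  then have iR: "{abs_i1 (F * G), abs_i2 (F * G), abs_i3 (F * G)} \<subseteq> ?R"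
    unfolding i using dM[OF R] R by (simp add: is_subfield_closed)
  then have LR: "?L \<subseteq> ?R" using adjoin_least[OF R sub(3)] by blast

  \<comment> \<open>The inclusion of \<open>?R\<close> in \<open>?L\<close>\<close>
  have iL: "abs_i1 (F * G) \<in> ?L" "abs_i2 (F * G) \<in> ?L" "abs_i3 (F * G) \<in> ?L" by (auto intro: adjoin_gen)
  have "A = abs_i1 (F * G) / d1" unfolding i using d by simp
  then have AL: "A \<in> ?L" using iL dM[OF L] L by (simp add: is_subfield_closed)
  have "B = (abs_i2 (F * G) - d2 * A) / d3" unfolding i using d by simp
  then have BL: "B \<in> ?L" using iL dM[OF L] AL L by (simp add: is_subfield_closed)
  have "C = abs_i3 (F * G) / d4" unfolding i using d by simp
  then have CL: "C \<in> ?L" using iL dM[OF L] L by (simp add: is_subfield_closed)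
  note tq = elim_generates[OF k assms(2) L st sq A_def B_def C_def AL BL CL]
  have RL: "?R \<subseteq> ?L"
    using adjoin_least[OF L sub(2)] r_mem[OF L tq] by simp

  \<comment> \<open>Membership in \<open>k(u, v)\<close>\<close>
  have uv: "u \<in> ?U" "v \<in> ?U" by (auto intro: adjoin_gen)
  have "w = v - 2 * u - 9" "cov_T a b = 2 * u - 18" by (simp_all add: w_def cov_w_def cov_T_def assms(5,6))
  then have wU: "w \<in> ?U" "cov_T a b \<in> ?U" using uv U by (simp_all add: is_subfield_closed)
  \<comment> \<open>Only the term \<open>4 * a^3\<close> is not a polynomial in \<open>u\<close> and
    \<open>v\<close>; it equals \<open>4 * u^3 / v\<close>.\<close>
  have "cov_Z a b = 4 * u^3 / v - u^2 - 18 * u + 4 * v + 27"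
    unfolding cov_Z_def assms(5,6) using b0 by (simp add: power_mult_distrib)
  then have ZU: "cov_Z a b \<in> ?U" using uv U by (simp add: is_subfield_closed)
  have "t \<in> ?U" "q \<in> ?U" unfolding t_def q_def using wU ZU U by (simp_all add: is_subfield_closed)
  note rU = r_mem[OF U this]
  have "?R \<subseteq> ?U" using adjoin_least[OF U sub(1)] rU by simp
  with iR have iU: "{abs_i1 (F * G), abs_i2 (F * G), abs_i3 (F * G)} \<subseteq> ?U" by blast

  show ?thesis
  proof (intro conjI)
    show "igusa_J2 (F * G) \<noteq> 0" by (rule J2)
    show "resultant F G \<noteq> 0" "poly_discriminant F \<noteq> 0" unfolding res dF using Z0 by simp_all
    show "poly_discriminant G \<noteq> 0" unfolding dG using S0 by simp
    show "{abs_i1 (F * G), abs_i2 (F * G), abs_i3 (F * G), cubic_r1 F G, cubic_r2 F G} \<subseteq> ?U"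
      using iU rU by simp
    show "?L = ?R" using LR RL by (rule subset_antisym)
  qed
qed

end
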